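(* Let $\pi$ be any (fixed) consecutive permutation pattern of length $k$, let $s=\mathrm{inv}(\pi)$ and $s'=\mathrm{inv}(\overline{\pi})$, and let $a$ be any positive constant. Let $m=m(n)$ and let $\boldsymbol{\sigma}_{n,m}$ be a uniformly random $n$-permutation with exactly $m$ inversions. (i) If $s>0$, then \[ \lim_{n\to\infty}\mathbb{P}\big[\boldsymbol{\sigma}_{n,m}\text{ contains }\pi\big]= \begin{cases} 0 & \text{if } m\ll n^{1-1/s},\\ 1-e^{-a^{s}} & \text{if } m\sim a n^{1-1/s}\text{ and } s>1,\\ 1 & \text{if } m\sim a \text{ and } s=1,\\ 1 & \text{if } n^{1-1/s}\ll m\ll n^{1+1/k}. \end{cases} \] (ii) If $s'>0$, then \[ \lim_{n\to\infty}\mathbb{P}\big[\boldsymbol{\sigma}_{n,m}\text{ contains }\pi\big]= \begin{cases} 1 & \text{if } n^{1+1/k}\gg \binom n2-m\gg n^{1-1/s'},\\ 1 & \text{if } \binom n2-m\sim a\text{ and } s'=1,\\ 1-e^{-a^{s'}} & \text{if } \binom n2-m\sim a n^{1-1/s'}\text{ and } s'>1,\\ 0 & \text{if } \binom n2-m\ll n^{1-1/s'}. \end{cases} \]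
   Context: An $n$-permutation is an arrangement $\sigma=\sigma(1)\ldots\sigma(n)$ of $[n]=\{1,\dots,n\}$. Its complement $\overline{\sigma}$ is given by $\overline{\sigma}(i)=n+1-\sigma(i)$. An inversion of $\sigma$ is a pair $i<j$ with $\sigma(i)>\sigma(j)$; $\mathrm{inv}(\sigma)$ is the number of inversions. For an integer $m$ with $0\le m\le\binom n2$, $\boldsymbol{\sigma}_{n,m}$ is chosen uniformly at random from the set of $n$-permutations with exactly $m$ inversions. Here $m=m(n)$ is an integer-valued function of $n$. A $k$-permutation $\pi$ occurs as a consecutive pattern at position $j$ in $\sigma$ if the terms $\sigma(j),\sigma(j+1),\ldots,\sigma(j+k-1)$ have the same relative order as $\pi(1),\ldots,\pi(k)$; $\sigma$ contains the consecutive pattern $\pi$ if $\pi$ occurs at some position in $\sigma$. Notation: $f\ll g$ (equivalently $g\gg f$) means $\lim_{n\to\infty}f/g=0$, and $f\sim g$ means $\lim_{n\to\infty}f/g=1$. *)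

theory Defs
  imports
    "HOL-Probability.Probability"
    "HOL-Combinatorics.Combinatorics"
    "HOL-Library.Landau_Symbols"
begin

text \<open>
  An $n$-permutation is a function \<open>\<sigma> :: nat \<Rightarrow> nat\<close> with \<open>\<sigma> permutes {1..n}\<close>; such a function is
  the identity outside \<open>{1..n}\<close>, so $n$-permutations correspond one-to-one to arrangements of $[n]$.
\<close>

definition inv_count :: "nat \<Rightarrow> (nat \<Rightarrow> nat) \<Rightarrow> nat" where
  "inv_count n \<sigma> = card {(i, j). i \<in> {1..n} \<and> j \<in> {1..n} \<and> i < j \<and> \<sigma> i > \<sigma> j}"

definition perm_complement :: "nat \<Rightarrow> (nat \<Rightarrow> nat) \<Rightarrow> nat \<Rightarrow> nat" where
  "perm_complement n \<sigma> i = (if i \<in> {1..n} then n + 1 - \<sigma> i else i)"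

definition occurs_at :: "nat \<Rightarrow> (nat \<Rightarrow> nat) \<Rightarrow> nat \<Rightarrow> (nat \<Rightarrow> nat) \<Rightarrow> nat \<Rightarrow> bool" where
  "occurs_at k \<pi> n \<sigma> j \<longleftrightarrow>
     1 \<le> j \<and> j + k \<le> n + 1 \<and>
     (\<forall>u\<in>{1..k}. \<forall>v\<in>{1..k}. \<sigma> (j + u - 1) < \<sigma> (j + v - 1) \<longleftrightarrow> \<pi> u < \<pi> v)"

definition contains_consecutive :: "nat \<Rightarrow> (nat \<Rightarrow> nat) \<Rightarrow> nat \<Rightarrow> (nat \<Rightarrow> nat) \<Rightarrow> bool" where
  "contains_consecutive k \<pi> n \<sigma> \<longleftrightarrow> (\<exists>j. occurs_at k \<pi> n \<sigma> j)"

definition perms_with_inv :: "nat \<Rightarrow> nat \<Rightarrow> (nat \<Rightarrow> nat) set" where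
  "perms_with_inv n m = {\<sigma>. \<sigma> permutes {1..n} \<and> inv_count n \<sigma> = m}"

text \<open>Only meaningful for \<open>m \<le> n choose 2\<close>, which is exactly when \<open>perms_with_inv n m\<close> is nonempty.\<close>

definition random_perm :: "nat \<Rightarrow> nat \<Rightarrow> (nat \<Rightarrow> nat) pmf" where
  "random_perm n m = pmf_of_set (perms_with_inv n m)"

definition prob_contains :: "nat \<Rightarrow> (nat \<Rightarrow> nat) \<Rightarrow> nat \<Rightarrow> nat \<Rightarrow> real" where
  "prob_contains k \<pi> n m =
     measure_pmf.prob (random_perm n m) {\<sigma>. contains_consecutive k \<pi> n \<sigma>}"

text \<open>
  The relation $f \ll g$ is rendered by the library's \<open>f \<in> o(g)\<close>, and $f \sim g$ by
  \<open>f \<sim>[sequentially] g\<close>. Where \<open>g\<close> is eventually nonzero, \<open>f \<in> o(g)\<close> is the same as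
  \<open>(\<lambda>n. f n / g n) \<longlonglongrightarrow> 0\<close>; unlike that limit, it does not become vacuously true
  through the convention \<open>x / 0 = 0\<close> when \<open>g\<close> vanishes.
\<close>

end

theory Submission
  imports Defs "HOL-Real_Asymp.Real_Asymp"
begin

text \<open>
  The proof turns permutations into integer sequences. The code of \<open>\<sigma>\<close> records at position \<open>j\<close> how many
  earlier entries exceed \<open>\<sigma>(j)\<close>; this is a bijection from the \<open>n\<close>-permutations with \<open>m\<close> inversions onto the
  sequences \<open>e\<^sub>1, \<dots>, e\<^sub>n\<close> with \<open>e\<^sub>j < j\<close> and sum \<open>m\<close> (\<open>bij_betw_code\<close>). A window of \<open>\<sigma>\<close> is a copy of \<open>\<pi>\<close> if its
  entries of the code are exactly those of \<open>\<pi>\<close>, and only if they are pointwise at least those of \<open>\<pi>\<close>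
  (\<open>occurs_if_window_code\<close>, \<open>window_code_ge_if_occurs\<close>). As the code of \<open>\<pi>\<close> has sum \<open>s\<close>, the question
  becomes when a uniformly random sequence contains a given word of sum \<open>s\<close>.

  Without the caps \<open>e\<^sub>j < j\<close> the sequences are the weak compositions of \<open>m\<close> into \<open>n\<close> parts, and everything
  about a fixed set of positions can be counted exactly by binomial coefficients. The caps are harmless: a
  composition exceeds level \<open>j\<close> at position \<open>j\<close> with probability at most \<open>q\<^sup>j\<close>, where \<open>q = m/(n+m-1)\<close>, so
  that all but a proportion \<open>q\<^sup>r\<^sup>+\<^sup>1/(1-q)\<close> of the compositions on positions beyond \<open>r\<close> respect them
  (\<open>card_capped_ge\<close>). For \<open>m\<close> of smaller order than \<open>n\<close> the choice \<open>r = 0\<close> is good enough. For larger \<open>m\<close>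
  the first \<open>r \<approx> \<surd>m\<close> entries are conditioned upon; because of the caps they carry at most half of the
  inversions, whatever they are (\<open>capped_fraction_by_prefix\<close>).

  The limits then come from counting occurrences in weak compositions.

  \<^item> Few inversions: a window dominates the code of \<open>\<pi>\<close> with probability at most \<open>q\<^sup>s\<close>, and \<open>n q\<^sup>s\<close> tends
    to 0 (first moment, \<open>limit_too_few_inversions\<close>).

  \<^item> Many inversions: the word \<open>\<pi>\<close> fills a given block of \<open>k\<close> positions with probability of order
    \<open>\<rho>\<^sup>s/(1+\<rho>)\<^sup>s\<^sup>+\<^sup>k\<close> where \<open>\<rho> = m/n\<close>. The expected number of such blocks tends to infinity exactly between
    the two thresholds, and the events for two blocks are asymptotically uncorrelated (second moment,
    \<open>limit_many_inversions\<close>).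

  \<^item> The critical window: cut the positions into blocks of slowly growing length \<open>L\<close> and count the
    blocks that consist of one copy of the word \<open>\<pi>\<close> and zeros. The factorial moments of this count are
    explicit and converge to those of a Poisson variable with mean \<open>a\<^sup>s\<close>; inclusion-exclusion and
    Tannery's theorem give the probability \<open>exp (-a\<^sup>s)\<close> that there is none (\<open>avoid_fraction_tendsto\<close>).
    Occurrences of other kinds cross a block boundary or use an extra inversion, and are negligible
    (\<open>card_dominating_without_good_block\<close>).

  \<^item> A bounded number of inversions and \<open>s = 1\<close>: with high probability the nonzero entries of the code
    are ones far from each other and from both ends, and each of them creates the pattern (\<open>limit_single_inversion\<close>).

  Part (ii) follows from part (i) because complementation exchanges \<open>m\<close> with \<open>n choose 2 - m\<close> and \<open>\<pi>\<close> with
  its complement (\<open>prob_contains_complement\<close>).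
\<close>

section \<open>Inversion codes of permutations\<close>

definition code :: "nat \<Rightarrow> (nat \<Rightarrow> nat) \<Rightarrow> nat \<Rightarrow> nat" where
  "code n \<sigma> j = (if j \<in> {1..n} then card {i \<in> {1..<j}. \<sigma> i > \<sigma> j} else 0)"

lemma code_less: "j \<in> {1..n} \<Longrightarrow> code n \<sigma> j < j"
proof -
  assume j: "j \<in> {1..n}"
  have "card {i \<in> {1..<j}. \<sigma> i > \<sigma> j} \<le> card {1..<j}"
    by (intro card_mono) auto
  with j show ?thesis by (auto simp: code_def)
qed

lemma sum_code: "(\<Sum>j\<in>{1..n}. code n \<sigma> j) = inv_count n \<sigma>"
proof -
  have "{(i, j). i \<in> {1..n} \<and> j \<in> {1..n} \<and> i < j \<and> \<sigma> i > \<sigma> j}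
      = (\<lambda>(j, i). (i, j)) ` (SIGMA j:{1..n}. {i \<in> {1..<j}. \<sigma> i > \<sigma> j})"
    by (auto simp: image_iff)
  then have "inv_count n \<sigma> = card (SIGMA j:{1..n}. {i \<in> {1..<j}. \<sigma> i > \<sigma> j})"
    unfolding inv_count_def by (simp add: card_image inj_on_def)
  also have "\<dots> = (\<Sum>j\<in>{1..n}. card {i \<in> {1..<j}. \<sigma> i > \<sigma> j})"
    by (rule card_SigmaI) auto
  finally show ?thesis by (simp add: code_def)
qed

text \<open>
  The entry at position \<open>j\<close> is above \<open>\<sigma>(w)\<close> exactly if it has at most as many earlier entries above it as
  \<open>\<sigma>(w)\<close> has. So the code decides every comparison once the number of entries above \<open>\<sigma>(w)\<close> is known.
\<close>

lemma entry_less_iff_code_le: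
  assumes "inj_on \<sigma> {1..n}" "w \<in> {1..<j}" "j \<le> n"
  shows "\<sigma> w < \<sigma> j \<longleftrightarrow> code n \<sigma> j \<le> card {i \<in> {1..<j}. \<sigma> i > \<sigma> w}"
proof
  assume "\<sigma> w < \<sigma> j"
  then have "card {i \<in> {1..<j}. \<sigma> i > \<sigma> j} \<le> card {i \<in> {1..<j}. \<sigma> i > \<sigma> w}"
    by (intro card_mono) auto
  then show "code n \<sigma> j \<le> card {i \<in> {1..<j}. \<sigma> i > \<sigma> w}"
    using assms by (simp add: code_def)
next
  assume le: "code n \<sigma> j \<le> card {i \<in> {1..<j}. \<sigma> i > \<sigma> w}"
  show "\<sigma> w < \<sigma> j"
  proof (rule ccontr)
    assume "\<not> \<sigma> w < \<sigma> j"
    moreover have "\<sigma> w \<noteq> \<sigma> j"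
      using assms by (auto dest: inj_onD)
    ultimately have "\<sigma> j < \<sigma> w" by simp
    then have "{i \<in> {1..<j}. \<sigma> i > \<sigma> w} \<subset> {i \<in> {1..<j}. \<sigma> i > \<sigma> j}"
      using assms by auto
    then have "card {i \<in> {1..<j}. \<sigma> i > \<sigma> w} < card {i \<in> {1..<j}. \<sigma> i > \<sigma> j}"
      by (intro psubset_card_mono) auto
    with le assms show False by (simp add: code_def)
  qed
qed

text \<open>
  The relative order inside a window depends only on the code of the window. Reading the window from left
  to right, the number of entries above each entry read so far is determined: the code gives it for a new
  entry, and \<open>entry_less_iff_code_le\<close> tells which of the older numbers increase by one. The window may
  start anywhere in either permutation; this yields both the recognition of patterns and, with the
  whole permutation as the window, the injectivity of the code.
\<close>

lemma window_order_from_code: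
  assumes \<sigma>: "inj_on \<sigma> {1..n}" and \<tau>: "inj_on \<tau> {1..n'}"
    and len: "p + k \<le> n" "q + k \<le> n'"
    and code: "\<And>v. v \<in> {1..k} \<Longrightarrow> code n \<sigma> (p + v) = code n' \<tau> (q + v)"
    and uv: "u \<in> {1..k}" "v \<in> {1..k}"
  shows "\<sigma> (p + u) < \<sigma> (p + v) \<longleftrightarrow> \<tau> (q + u) < \<tau> (q + v)"
proof -
  \<comment> \<open>The number of entries above the \<open>w\<close>-th entry of the window, among those up to its \<open>t\<close>-th entry.\<close>
  define A where "A = (\<lambda>t w. card {i \<in> {1..<p + t + 1}. \<sigma> i > \<sigma> (p + w)})"
  define B where "B = (\<lambda>t w. card {i \<in> {1..<q + t + 1}. \<tau> i > \<tau> (q + w)})"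
  have "\<forall>w\<in>{1..t}. A t w = B t w \<and>
          (\<forall>v\<in>{1..t}. w < v \<longrightarrow> (\<sigma> (p + w) < \<sigma> (p + v) \<longleftrightarrow> \<tau> (q + w) < \<tau> (q + v)))"
    if "t \<le> k" for t
    using that
  proof (induction t)
    case (Suc t)
    have IH: "A t w = B t w" if "w \<in> {1..t}" for w using Suc that by simp
    have cA: "\<sigma> (p + w) < \<sigma> (p + Suc t) \<longleftrightarrow> code n \<sigma> (p + Suc t) \<le> A t w" if "w \<in> {1..t}" for w
      unfolding A_def using entry_less_iff_code_le[OF \<sigma>, of "p + w" "p + Suc t"] that len Suc.prems by simp
    have cB: "\<tau> (q + w) < \<tau> (q + Suc t) \<longleftrightarrow> code n' \<tau> (q + Suc t) \<le> B t w" if "w \<in> {1..t}" for w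
      unfolding B_def using entry_less_iff_code_le[OF \<tau>, of "q + w" "q + Suc t"] that len Suc.prems by simp
    have c: "\<sigma> (p + w) < \<sigma> (p + Suc t) \<longleftrightarrow> \<tau> (q + w) < \<tau> (q + Suc t)" if "w \<in> {1..t}" for w
      using cA[OF that] cB[OF that] IH[OF that] code[of "Suc t"] Suc.prems by simp
    have sA: "A (Suc t) w = A t w + (if \<sigma> (p + w) < \<sigma> (p + Suc t) then 1 else 0)" for w
    proof -
      have "{i \<in> {1..<p + Suc t + 1}. \<sigma> i > \<sigma> (p + w)} = {i \<in> {1..<p + t + 1}. \<sigma> i > \<sigma> (p + w)} \<union>
         (if \<sigma> (p + w) < \<sigma> (p + Suc t) then {p + Suc t} else {})"
        by (auto simp: less_Suc_eq)
      then show ?thesis unfolding A_def by (auto simp: card_insert_if)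
    qed
    have sB: "B (Suc t) w = B t w + (if \<tau> (q + w) < \<tau> (q + Suc t) then 1 else 0)" for w
    proof -
      have "{i \<in> {1..<q + Suc t + 1}. \<tau> i > \<tau> (q + w)} = {i \<in> {1..<q + t + 1}. \<tau> i > \<tau> (q + w)} \<union>
         (if \<tau> (q + w) < \<tau> (q + Suc t) then {q + Suc t} else {})"
        by (auto simp: less_Suc_eq)
      then show ?thesis unfolding B_def by (auto simp: card_insert_if)
    qed
    have dA: "A t (Suc t) = code n \<sigma> (p + Suc t)"
      using len Suc.prems by (simp add: A_def code_def)
    have dB: "B t (Suc t) = code n' \<tau> (q + Suc t)"
      using len Suc.prems by (simp add: B_def code_def)
    have e: "A (Suc t) w = B (Suc t) w" if "w \<in> {1..Suc t}" for w
    proof (cases "w = Suc t")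
      case True
      then show ?thesis using dA dB code[of "Suc t"] Suc.prems by (simp add: sA sB)
    next
      case False
      with that have "w \<in> {1..t}" by auto
      then show ?thesis using c IH by (simp add: sA sB)
    qed
    have "\<sigma> (p + w) < \<sigma> (p + v) \<longleftrightarrow> \<tau> (q + w) < \<tau> (q + v)"
      if "w \<in> {1..Suc t}" "v \<in> {1..Suc t}" "w < v" for w v
    proof (cases "v = Suc t")
      case True
      then show ?thesis using c[of w] that by auto
    next
      case False
      then have "w \<in> {1..t}" "v \<in> {1..t}" using that by auto
      then show ?thesis using Suc that by simp
    qed
    then show ?case using e by blast
  qed simp
  then have lt: "\<sigma> (p + w) < \<sigma> (p + v) \<longleftrightarrow> \<tau> (q + w) < \<tau> (q + v)"
    if "w \<in> {1..k}" "v \<in> {1..k}" "w < v" for w v using that by blast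
  have ne: "\<sigma> (p + w) \<noteq> \<sigma> (p + v) \<and> \<tau> (q + w) \<noteq> \<tau> (q + v)"
    if "w \<in> {1..k}" "v \<in> {1..k}" "w \<noteq> v" for w v
    using that len inj_onD[OF \<sigma>, of "p + w" "p + v"] inj_onD[OF \<tau>, of "q + w" "q + v"] by auto
  show ?thesis
  proof (cases u v rule: linorder_cases)
    case less
    then show ?thesis using lt uv by blast
  next
    case greater
    then show ?thesis using lt[of v u] ne[of u v] uv by auto
  qed simp
qed

lemma occurs_if_window_code:
  assumes "\<sigma> permutes {1..n}" "\<pi> permutes {1..k}" "p + k \<le> n"
    and "\<And>v. v \<in> {1..k} \<Longrightarrow> code n \<sigma> (p + v) = code k \<pi> v"
  shows "contains_consecutive k \<pi> n \<sigma>"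
proof -
  have "occurs_at k \<pi> n \<sigma> (p + 1)"
    unfolding occurs_at_def
    using window_order_from_code[of \<sigma> n \<pi> k p k 0] assms
    by (simp add: permutes_inj_on)
  then show ?thesis unfolding contains_consecutive_def by blast
qed

text \<open>
  Every inversion of the pattern is an inversion of the permutation inside the window.
\<close>

lemma window_code_ge_if_occurs:
  assumes "occurs_at k \<pi> n \<sigma> (p + 1)" "v \<in> {1..k}"
  shows "code k \<pi> v \<le> code n \<sigma> (p + v)"
proof -
  have "(\<lambda>u. p + u) ` {u \<in> {1..<v}. \<pi> u > \<pi> v} \<subseteq> {i \<in> {1..<p + v}. \<sigma> i > \<sigma> (p + v)}"
    using assms unfolding occurs_at_def by auto
  then have "card ((\<lambda>u. p + u) ` {u \<in> {1..<v}. \<pi> u > \<pi> v}) \<le> card {i \<in> {1..<p + v}. \<sigma> i > \<sigma> (p + v)}"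
    by (intro card_mono) auto
  then show ?thesis
    using assms by (auto simp: code_def card_image occurs_at_def)
qed

text \<open>
  The value of an entry is one more than the number of smaller entries.
\<close>

lemma permutes_eq_if_same_order:
  assumes \<sigma>: "\<sigma> permutes {1..n}" and \<tau>: "\<tau> permutes {1..n}"
    and o: "\<And>u v. u \<in> {1..n} \<Longrightarrow> v \<in> {1..n} \<Longrightarrow> \<sigma> u < \<sigma> v \<longleftrightarrow> \<tau> u < \<tau> v"
  shows "\<sigma> = (\<tau> :: nat \<Rightarrow> nat)"
proof
  fix v
  have rank: "card {u \<in> {1..n}. \<rho> u < \<rho> v} = \<rho> v - 1" if \<rho>: "\<rho> permutes {1..n}" and v: "v \<in> {1..n}" for \<rho> :: "nat \<Rightarrow> nat"
  proof -
    have "\<rho> ` {u \<in> {1..n}. \<rho> u < \<rho> v} = {1..<\<rho> v}"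
    proof
      show "\<rho> ` {u \<in> {1..n}. \<rho> u < \<rho> v} \<subseteq> {1..<\<rho> v}"
        using permutes_in_image[OF \<rho>] by fastforce
      show "{1..<\<rho> v} \<subseteq> \<rho> ` {u \<in> {1..n}. \<rho> u < \<rho> v}"
      proof
        fix y assume y: "y \<in> {1..<\<rho> v}"
        have "\<rho> v \<in> {1..n}" using permutes_in_image[OF \<rho>] v by blast
        then have "y \<in> {1..n}" using y by auto
        then obtain u where "u \<in> {1..n}" "y = \<rho> u" using permutes_image[OF \<rho>] by (metis imageE)
        then show "y \<in> \<rho> ` {u \<in> {1..n}. \<rho> u < \<rho> v}" using y by auto
      qed
    qed
    moreover have "inj_on \<rho> {u \<in> {1..n}. \<rho> u < \<rho> v}"
      using \<rho> by (simp add: permutes_inj_on)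
    ultimately show ?thesis using card_image by fastforce
  qed
  show "\<sigma> v = \<tau> v"
  proof (cases "v \<in> {1..n}")
    case True
    have "{u \<in> {1..n}. \<sigma> u < \<sigma> v} = {u \<in> {1..n}. \<tau> u < \<tau> v}" using o True by blast
    then have "\<sigma> v - 1 = \<tau> v - 1" using rank[OF \<sigma> True] rank[OF \<tau> True] by simp
    moreover have "\<sigma> v \<in> {1..n}" "\<tau> v \<in> {1..n}"
      using True by (simp_all only: permutes_in_image[OF \<sigma>] permutes_in_image[OF \<tau>])
    ultimately show ?thesis by (simp, arith)
  next
    case False
    then show ?thesis using \<sigma> \<tau> by (simp add: permutes_not_in)
  qed
qed

lemma inj_on_code: "inj_on (code n) {\<sigma>. \<sigma> permutes {1..n}}"
proof (rule inj_onI)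
  fix \<sigma> \<tau> assume \<sigma>: "\<sigma> \<in> {\<sigma>. \<sigma> permutes {1..n}}" and \<tau>: "\<tau> \<in> {\<sigma>. \<sigma> permutes {1..n}}"
    and eq: "code n \<sigma> = code n \<tau>"
  show "\<sigma> = \<tau>"
  proof (rule permutes_eq_if_same_order)
    fix u v assume "u \<in> {1..n}" "v \<in> {1..n}"
    then show "\<sigma> u < \<sigma> v \<longleftrightarrow> \<tau> u < \<tau> v"
      using window_order_from_code[of \<sigma> n \<tau> n 0 n 0 u v] \<sigma> \<tau> eq by (simp add: permutes_inj_on)
  qed (use \<sigma> \<tau> in auto)
qed

text \<open>
  Weak compositions of \<open>M\<close> with parts indexed by \<open>I\<close>. They are functions that vanish outside \<open>I\<close>, so that
  compositions on different index sets can be added and compared pointwise.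
\<close>

definition comps :: "nat set \<Rightarrow> nat \<Rightarrow> (nat \<Rightarrow> nat) set" where
  "comps I M = {e. (\<forall>i. i \<notin> I \<longrightarrow> e i = 0) \<and> sum e I = M}"

definition capped :: "nat set \<Rightarrow> nat \<Rightarrow> (nat \<Rightarrow> nat) set" where
  "capped I M = {e \<in> comps I M. \<forall>j\<in>I. e j < j}"

text \<open>
  Surjectivity follows by counting: there are \<open>1 \<cdot> 2 \<cdots> n\<close> sequences with \<open>e\<^sub>j < j\<close>.
\<close>

lemma bij_betw_code_all:
  "bij_betw (code n) {\<sigma>. \<sigma> permutes {1..n}} (PiE_dflt {1..n} 0 (\<lambda>j. {..<j}))"
proof -
  have sub: "code n ` {\<sigma>. \<sigma> permutes {1..n}} \<subseteq> PiE_dflt {1..n} 0 (\<lambda>j. {..<j})"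
    unfolding PiE_dflt_def using code_less by (auto simp: code_def)
  have "card (PiE_dflt {1..n} (0::nat) (\<lambda>j. {..<j})) = (\<Prod>j\<in>{1..n}. card {..<j})"
    by (rule card_PiE_dflt) auto
  also have "\<dots> = card {\<sigma>. \<sigma> permutes {1..n}}"
    by (subst card_permutations[of _ n]) (auto simp: fact_prod)
  also have "\<dots> = card (code n ` {\<sigma>. \<sigma> permutes {1..n}})"
    by (rule card_image[OF inj_on_code, symmetric])
  finally have "code n ` {\<sigma>. \<sigma> permutes {1..n}} = PiE_dflt {1..n} 0 (\<lambda>j. {..<j})"
    by (intro card_subset_eq sub) (auto intro!: finite_PiE_dflt)
  then show ?thesis using inj_on_code by (simp add: bij_betw_def)
qed

lemma bij_betw_code: "bij_betw (code n) (perms_with_inv n m) (capped {1..n} m)"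
proof (rule bij_betw_imageI)
  show "inj_on (code n) (perms_with_inv n m)"
    by (rule inj_on_subset[OF inj_on_code]) (auto simp: perms_with_inv_def)
  have "capped {1..n} m = {e \<in> PiE_dflt {1..n} 0 (\<lambda>j. {..<j}). sum e {1..n} = m}"
    by (auto simp: capped_def comps_def PiE_dflt_def)
  also have "\<dots> = {e \<in> code n ` {\<sigma>. \<sigma> permutes {1..n}}. sum e {1..n} = m}"
    using bij_betw_code_all[of n] by (simp add: bij_betw_def)
  also have "\<dots> = code n ` perms_with_inv n m"
    unfolding perms_with_inv_def sum_code[of n, symmetric] by blast
  finally show "code n ` perms_with_inv n m = capped {1..n} m" by simp
qed

section \<open>Counting weak compositions\<close>

lemma finite_comps: "finite I \<Longrightarrow> finite (comps I M)"
proof -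
  assume I: "finite I"
  have "comps I M \<subseteq> PiE_dflt I 0 (\<lambda>_. {..M})"
  proof
    fix e assume e: "e \<in> comps I M"
    have "e i \<le> M" if "i \<in> I" for i
      using member_le_sum[OF that, of e] e I by (simp add: comps_def)
    then show "e \<in> PiE_dflt I 0 (\<lambda>_. {..M})" using e by (auto simp: PiE_dflt_def comps_def)
  qed
  then show ?thesis by (rule finite_subset) (use I in auto)
qed

definition ncomps :: "nat \<Rightarrow> nat \<Rightarrow> nat" where
  "ncomps n m = (n + m - 1) choose m"

lemma ncomps_pos: "n > 0 \<Longrightarrow> ncomps n m > 0"
  by (simp add: ncomps_def)

text \<open>
  Subtracting \<open>v\<close> is a bijection. This exact count is the source of all upper bounds on probabilities.
\<close>

lemma card_comps_dominating:
  assumes I: "finite I" and v: "v \<in> comps I u" "u \<le> M"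
  shows "card {e \<in> comps I M. \<forall>i. v i \<le> e i} = card (comps I (M - u))"
proof (rule bij_betw_same_card)
  show "bij_betw (\<lambda>e i. e i - v i) {e \<in> comps I M. \<forall>i. v i \<le> e i} (comps I (M - u))"
  proof (rule bij_betw_byWitness[where f' = "\<lambda>e i. e i + v i"])
    have "(\<Sum>i\<in>I. e i - v i) = sum e I - sum v I" if "\<forall>i. v i \<le> e i" for e
      using that by (intro sum_subtractf_nat) auto
    then show "(\<lambda>e i. e i - v i) ` {e \<in> comps I M. \<forall>i. v i \<le> e i} \<subseteq> comps I (M - u)"
      using v by (auto simp: comps_def)
  qed (use v in \<open>auto simp: comps_def sum.distrib\<close>)
qed

text \<open>
  Pascal's rule: either a fixed part vanishes, or it can be decreased by one.
\<close>

lemma card_comps: "finite I \<Longrightarrow> card (comps I M) = ncomps (card I) M"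
proof (induction "card I + M" arbitrary: I M rule: less_induct)
  case less
  show ?case
  proof (cases "I = {} \<or> M = 0")
    case True
    then have "comps I M = (if M = 0 then {\<lambda>_. 0} else {})"
      using less.prems by (auto simp: comps_def)
    then show ?thesis using True less.prems by (auto simp: ncomps_def)
  next
    case False
    then obtain i where i: "i \<in> I" by auto
    obtain n where n: "card I = Suc n" using i less.prems by (metis card_gt_0_iff empty_iff gr0_implies_Suc)
    obtain l where l: "M = Suc l" using False by (cases M) auto
    define v where "v = (\<lambda>j. if j = i then 1 else 0 :: nat)"
    have v: "v \<in> comps I 1" using i less.prems by (auto simp: comps_def v_def)
    have "card {e \<in> comps I M. e i = 0} = card (comps (I - {i}) M)"
    proof -
      have "{e \<in> comps I M. e i = 0} = comps (I - {i}) M"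
        using less.prems i by (auto simp: comps_def sum.remove[of I i])
      then show ?thesis by simp
    qed
    also have "\<dots> = ncomps n M"
      using less.hyps[of "I - {i}" M] less.prems i n by simp
    finally have 1: "card {e \<in> comps I M. e i = 0} = ncomps n M" .
    have "{e \<in> comps I M. e i \<noteq> 0} = {e \<in> comps I M. \<forall>j. v j \<le> e j}"
      by (auto simp: v_def)
    then have "card {e \<in> comps I M. e i \<noteq> 0} = card (comps I (M - 1))"
      using card_comps_dominating[OF less.prems v, of M] l by simp
    also have "\<dots> = ncomps (Suc n) l"
      using less.hyps[of I l] less.prems n l by simp
    finally have 2: "card {e \<in> comps I M. e i \<noteq> 0} = ncomps (Suc n) l" .
    have "card (comps I M) = card {e \<in> comps I M. e i = 0} + card {e \<in> comps I M. e i \<noteq> 0}"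
      by (subst card_Un_disjoint[symmetric])
         (use finite_comps[OF less.prems, of M] in \<open>auto intro!: arg_cong[of _ _ card]\<close>)
    also have "\<dots> = ncomps (Suc n) M"
      unfolding 1 2 by (simp add: l ncomps_def add.commute)
    finally show ?thesis using n by simp
  qed
qed

lemma ncomps_remove_value:
  assumes "n > 0" "m > 0"
  shows "ncomps n (m - 1) * (n + m - 1) = ncomps n m * m"
proof -
  obtain l where l: "m = Suc l" using assms by (cases m) auto
  obtain p where p: "n = Suc p" using assms by (cases n) auto
  show ?thesis
    using Suc_times_binomial[of l "p + l"] by (simp add: ncomps_def l p algebra_simps)
qed

lemma ncomps_remove_part:
  assumes "n > 1"
  shows "ncomps (n - 1) m * (n + m - 1) = ncomps n m * (n - 1)"
proof -
  obtain p where p: "n = Suc (Suc p)" using assms by (metis Suc_lessE less_natE One_nat_def add_Suc)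
  have "(Suc p + m choose m) * Suc p = (p + m choose m) * (Suc p + m)"
    using Suc_times_binomial[of p "p + m"] binomial_symmetric[of m "p + m"] binomial_symmetric[of m "Suc p + m"]
    by (simp add: algebra_simps)
  then show ?thesis by (simp add: ncomps_def p algebra_simps)
qed

lemma mult_ratios_compose:
  fixes a :: real
  assumes "a * x = b * y" "b * P = N * Q"
  shows "a * (P * x) = N * (Q * y)"
proof -
  have "a * (P * x) = (a * x) * P" by simp
  also have "\<dots> = (b * P) * y" unfolding assms(1) by simp
  finally show ?thesis unfolding assms(2) by simp
qed

text \<open>
  The probability that a random weak composition takes prescribed values with sum \<open>u\<close> on \<open>t\<close> given
  positions is \<open>ncomps (n - t) (m - u) / ncomps n m\<close>; here it appears as a quotient of falling factorials.
\<close>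

lemma ncomps_ratio:
  assumes "u \<le> m" "t < n"
  shows "real (ncomps (n - t) (m - u)) * (\<Prod>i<t + u. real (n + m - 1 - i))
       = real (ncomps n m) * (\<Prod>i<u. real (m - i)) * (\<Prod>i<t. real (n - 1 - i))"
proof -
  have A: "real (ncomps n (m - u)) * (\<Prod>i<u. real (n + m - 1 - i))
       = real (ncomps n m) * (\<Prod>i<u. real (m - i))" if "u \<le> m" "n > 0" for u m n
    using that(1)
  proof (induction u)
    case (Suc u)
    have "real (ncomps n (m - Suc u)) * real (n + m - 1 - u) = real (ncomps n (m - u)) * real (m - u)"
      unfolding of_nat_mult[symmetric] of_nat_eq_iff
      using ncomps_remove_value[of n "m - u"] Suc.prems that(2) by simp
    from mult_ratios_compose[OF this Suc.IH] Suc.prems show ?case by simp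
  qed simp
  have B: "real (ncomps (n - t) m) * (\<Prod>i<t. real (n + m - 1 - i))
       = real (ncomps n m) * (\<Prod>i<t. real (n - 1 - i))" if "t < n" for t m n
    using that
  proof (induction t)
    case (Suc t)
    have "real (ncomps (n - Suc t) m) * real (n + m - 1 - t) = real (ncomps (n - t) m) * real (n - 1 - t)"
      unfolding of_nat_mult[symmetric] of_nat_eq_iff
      using ncomps_remove_part[of "n - t" m] Suc.prems by (simp add: algebra_simps)
    from mult_ratios_compose[OF this Suc.IH] Suc.prems show ?case by simp
  qed simp
  have split: "(\<Prod>i<t + u. real (n + m - 1 - i)) =
      (\<Prod>i<t. real (n + m - 1 - i)) * (\<Prod>i<u. real (n - t + m - 1 - i))"
  proof -
    have "(\<Prod>i\<in>{t..<t + u}. real (n + m - 1 - i)) = (\<Prod>i\<in>{0..<u}. real (n + m - 1 - (i + t)))"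
      using prod.shift_bounds_nat_ivl[of "\<lambda>i. real (n + m - 1 - i)" 0 t u] by (simp add: add.commute)
    also have "\<dots> = (\<Prod>i<u. real (n - t + m - 1 - i))"
      using assms by (intro prod.cong) (auto simp: lessThan_atLeast0)
    finally show ?thesis
      by (metis lessThan_atLeast0 prod.atLeastLessThan_concat zero_le le_add1)
  qed
  show ?thesis
    unfolding split using mult_ratios_compose[OF A[OF assms(1), of "n - t"] B[OF assms(2), of m]] assms(2)
    by (simp only: mult_ac zero_less_diff)
qed

text \<open>
  The probability that a given part of a random weak composition of \<open>m\<close> into \<open>n\<close> parts is positive. It is
  the ratio of the geometric distribution that the parts follow approximately.
\<close>

definition fill :: "nat \<Rightarrow> nat \<Rightarrow> real" where
  "fill n m = real m / real (n + m - 1)"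

lemma fill_bounds: "n > 0 \<Longrightarrow> 0 \<le> fill n m" "n > 0 \<Longrightarrow> fill n m \<le> 1"
  by (auto simp: fill_def divide_le_eq_1)

lemma ncomps_decrease_le:
  assumes "u \<le> m" "n > 0"
  shows "real (ncomps n (m - u)) \<le> fill n m ^ u * real (ncomps n m)"
  using assms(1)
proof (induction u)
  case (Suc u)
  have "real (ncomps n (m - Suc u)) * real (n + m - 1 - u) = real (ncomps n (m - u)) * real (m - u)"
    unfolding of_nat_mult[symmetric] of_nat_eq_iff
    using ncomps_remove_value[of n "m - u"] Suc.prems assms(2) by simp
  then have step: "real (ncomps n (m - Suc u)) = real (ncomps n (m - u)) * (real (m - u) / real (n + m - 1 - u))"
    using Suc.prems assms(2) by (simp add: field_simps)
  have le: "real (m - u) / real (n + m - 1 - u) \<le> fill n m"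
  proof -
    have "real (m - u) * real (n + m - 1) \<le> real m * real (n + m - 1 - u)"
    proof -
      obtain d where d: "m = Suc u + d" using Suc.prems le_Suc_ex by blast
      obtain p where p: "n = Suc p" using assms by (cases n) auto
      show ?thesis by (simp add: d p algebra_simps)
    qed
    then show ?thesis using Suc.prems assms(2) by (simp add: fill_def field_simps)
  qed
  have "real (ncomps n (m - Suc u)) \<le> (fill n m ^ u * real (ncomps n m)) * fill n m"
    unfolding step using Suc le by (intro mult_mono) auto
  then show ?case by (simp add: algebra_simps)
qed simp

lemma card_dominating_le:
  assumes I: "finite I" "I \<noteq> {}" and v: "v \<in> comps I u"
  shows "real (card {e \<in> comps I M. \<forall>i. v i \<le> e i}) \<le> fill (card I) M ^ u * real (ncomps (card I) M)"
proof (cases "u \<le> M")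
  case True
  then show ?thesis
    using card_comps_dominating[OF I(1) v True] card_comps[OF I(1)] ncomps_decrease_le[OF True, of "card I"] I
    by (simp add: card_gt_0_iff)
next
  case False
  have "{e \<in> comps I M. \<forall>i. v i \<le> e i} = {}"
  proof safe
    fix e assume e: "e \<in> comps I M" "\<forall>i. v i \<le> e i"
    then have "sum v I \<le> sum e I" by (intro sum_mono) auto
    with e v False show "e \<in> {}" by (auto simp: comps_def)
  qed
  then have "card {e \<in> comps I M. \<forall>i. v i \<le> e i} = 0" by (simp only: card.empty)
  then show ?thesis using fill_bounds(1)[of "card I" M] I by (simp add: card_gt_0_iff)
qed

definition restrict_zero :: "nat set \<Rightarrow> (nat \<Rightarrow> nat) \<Rightarrow> nat \<Rightarrow> nat" where
  "restrict_zero T e i = (if i \<in> T then e i else 0)"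

section \<open>Blocks of positions and moments of the number of good blocks\<close>

lemma card_eq_sum_fibres:
  assumes "finite A" "finite B" "h ` A \<subseteq> B"
  shows "card A = (\<Sum>y\<in>B. card {x \<in> A. h x = y})"
  using sum.group[OF assms, of "\<lambda>_. 1 :: nat"] by simp

text \<open>
  Fixing the values on \<open>T\<close> leaves a composition of the remaining sum on the remaining positions. The
  predicate \<open>Q\<close> stands for conditions on these remaining positions.
\<close>

lemma card_prescribed_on:
  assumes I: "finite I" "T \<subseteq> I" and v: "v \<in> comps T s"
    and Q: "\<And>e e'. (\<And>i. i \<in> I - T \<Longrightarrow> e i = e' i) \<Longrightarrow> Q e \<longleftrightarrow> Q e'"
  shows "card {e \<in> comps I M. restrict_zero T e = v \<and> Q e} =
         (if s \<le> M then card {e \<in> comps (I - T) (M - s). Q e} else 0)"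
proof -
  have fT: "finite T" using I finite_subset by blast
  have split: "sum e I = sum e T + sum e (I - T)" for e :: "nat \<Rightarrow> nat"
    using sum.subset_diff[OF I(2,1), of e] by simp
  have rs: "sum e T = s" if "restrict_zero T e = v" for e
  proof -
    have "sum e T = sum v T" using that by (intro sum.cong) (auto simp: restrict_zero_def)
    then show ?thesis using v by (simp add: comps_def)
  qed
  show ?thesis
  proof (cases "s \<le> M")
    case True
    have "bij_betw (restrict_zero (I - T)) {e \<in> comps I M. restrict_zero T e = v \<and> Q e} {e \<in> comps (I - T) (M - s). Q e}"
    proof (rule bij_betw_byWitness[where f' = "\<lambda>e i. if i \<in> T then v i else e i"])
      show "\<forall>e\<in>{e \<in> comps I M. restrict_zero T e = v \<and> Q e}. (\<lambda>i. if i \<in> T then v i else restrict_zero (I - T) e i) = e"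
        using I by (auto simp: restrict_zero_def comps_def fun_eq_iff)
      show "\<forall>e\<in>{e \<in> comps (I - T) (M - s). Q e}. restrict_zero (I - T) (\<lambda>i. if i \<in> T then v i else e i) = e"
        by (auto simp: restrict_zero_def comps_def fun_eq_iff)
      show "restrict_zero (I - T) ` {e \<in> comps I M. restrict_zero T e = v \<and> Q e} \<subseteq> {e \<in> comps (I - T) (M - s). Q e}"
      proof safe
        fix e assume e: "e \<in> comps I M" "Q e" "v = restrict_zero T e"
        have "sum (restrict_zero (I - T) e) (I - T) = sum e (I - T)"
          by (intro sum.cong) (auto simp: restrict_zero_def)
        then show "restrict_zero (I - T) e \<in> comps (I - T) (M - s)"
          using e rs[of e] split[of e] by (auto simp: comps_def restrict_zero_def)
        show "Q (restrict_zero (I - T) e)"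
          using e(2) Q[of e "restrict_zero (I - T) e"] by (auto simp: restrict_zero_def)
      qed
      show "(\<lambda>e i. if i \<in> T then v i else e i) ` {e \<in> comps (I - T) (M - s). Q e}
              \<subseteq> {e \<in> comps I M. restrict_zero T e = v \<and> Q e}"
      proof safe
        fix e assume e: "e \<in> comps (I - T) (M - s)" "Q e"
        let ?e = "\<lambda>i. if i \<in> T then v i else e i"
        have "sum ?e T = s" "sum ?e (I - T) = M - s"
          using v e by (auto simp: comps_def)
        then show "?e \<in> comps I M"
          using e split[of ?e] I True by (auto simp: comps_def)
        show "restrict_zero T ?e = v" using v by (auto simp: restrict_zero_def comps_def fun_eq_iff)
        show "Q ?e" using e(2) Q[of e ?e] by auto
      qed
    qed
    then show ?thesis using True bij_betw_same_card by fastforce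
  next
    case False
    have "{e \<in> comps I M. restrict_zero T e = v \<and> Q e} = {}"
      using rs split False by (auto simp: comps_def)
    then show ?thesis using False by (simp only: card.empty) simp
  qed
qed

text \<open>
  If each of several disjoint blocks of \<open>L\<close> positions is to carry one of \<open>\<beta>\<close> allowed words of sum \<open>s\<close>, the
  number of compositions depends only on the number of blocks. This makes all factorial moments of the
  number of such blocks explicit.
\<close>

lemma card_block_choices:
  assumes "finite R" "finite I" "\<And>b. b \<in> R \<Longrightarrow> T b \<subseteq> I" "disjoint_family_on T R"
    and "\<And>b. b \<in> R \<Longrightarrow> card (T b) = L" "\<And>b. b \<in> R \<Longrightarrow> V b \<subseteq> comps (T b) s"
    and "\<And>b. b \<in> R \<Longrightarrow> card (V b) = \<beta>"
  shows "card {e \<in> comps I M. \<forall>b\<in>R. restrict_zero (T b) e \<in> V b} =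
         \<beta> ^ card R * (if card R * s \<le> M then ncomps (card I - card R * L) (M - card R * s) else 0)"
  using assms
proof (induction R arbitrary: I M)
  case empty
  then show ?case by (simp add: card_comps)
next
  case (insert b R)
  let ?Q = "\<lambda>e. \<forall>b\<in>R. restrict_zero (T b) e \<in> V b"
  have Tb: "T b \<subseteq> I" "finite (T b)"
    using insert.prems(2)[of b] insert.prems(1) finite_subset[of "T b" I] by auto
  have Vb: "finite (V b)"
    using insert.prems(5)[of b] finite_subset[OF _ finite_comps[OF Tb(2)]] by simp
  have TR: "T b' \<subseteq> I - T b" if "b' \<in> R" for b'
  proof -
    have "b \<noteq> b'" using insert.hyps that by auto
    then have "T b \<inter> T b' = {}"
      using insert.prems(3) that unfolding disjoint_family_on_def by blast
    then show ?thesis using insert.prems(2)[of b'] that by auto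
  qed
  have "card {e \<in> comps I M. \<forall>b\<in>insert b R. restrict_zero (T b) e \<in> V b}
      = (\<Sum>v\<in>V b. card {e \<in> {e \<in> comps I M. \<forall>b\<in>insert b R. restrict_zero (T b) e \<in> V b}. restrict_zero (T b) e = v})"
    by (intro card_eq_sum_fibres Vb finite_subset[OF _ finite_comps[OF insert.prems(1), of M]]) auto
  also have "\<dots> = (\<Sum>v\<in>V b. if s \<le> M then card {e \<in> comps (I - T b) (M - s). ?Q e} else 0)"
  proof (rule sum.cong[OF refl])
    fix v assume v: "v \<in> V b"
    have "?Q e \<longleftrightarrow> ?Q e'" if eq: "\<And>i. i \<in> I - T b \<Longrightarrow> e i = e' i" for e e'
    proof -
      have "restrict_zero (T b') e = restrict_zero (T b') e'" if "b' \<in> R" for b'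
        using eq TR[OF that] by (auto simp: restrict_zero_def fun_eq_iff)
      then show ?thesis by auto
    qed
    moreover have "v \<in> comps (T b) s" using v insert.prems(5)[of b] by auto
    moreover have "{e \<in> {e \<in> comps I M. \<forall>b\<in>insert b R. restrict_zero (T b) e \<in> V b}. restrict_zero (T b) e = v}
        = {e \<in> comps I M. restrict_zero (T b) e = v \<and> ?Q e}"
      using v by auto
    ultimately show "card {e \<in> {e \<in> comps I M. \<forall>b\<in>insert b R. restrict_zero (T b) e \<in> V b}. restrict_zero (T b) e = v}
        = (if s \<le> M then card {e \<in> comps (I - T b) (M - s). ?Q e} else 0)"
      using card_prescribed_on[of I "T b" v s ?Q M] insert.prems(1) Tb(1) by presburger
  qed
  also have "\<dots> = \<beta> * (if s \<le> M then card {e \<in> comps (I - T b) (M - s). ?Q e} else 0)"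
    using insert.prems by simp
  also have "card {e \<in> comps (I - T b) (M - s). ?Q e}
      = \<beta> ^ card R * (if card R * s \<le> M - s
          then ncomps (card (I - T b) - card R * L) (M - s - card R * s) else 0)"
    using insert.prems TR
    by (intro insert.IH) (auto simp: disjoint_family_on_def)
  also have "card (I - T b) = card I - L"
    using insert.prems Tb by (simp add: card_Diff_subset)
  finally show ?case
    using insert.hyps by (auto simp: algebra_simps)
qed

text \<open>
  The binomial moments of a number of events are sums over sets of events that occur jointly.
\<close>

lemma sum_choose_card_eq:
  assumes "finite E" "finite B"
  shows "(\<Sum>e\<in>E. card {b \<in> B. P e b} choose r) =
         (\<Sum>R\<in>{R. R \<subseteq> B \<and> card R = r}. card {e \<in> E. \<forall>b\<in>R. P e b})"
proof -
  have fin: "finite {R. R \<subseteq> B \<and> card R = r}" using assms by simp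
  have "(\<Sum>e\<in>E. card {b \<in> B. P e b} choose r) =
        (\<Sum>e\<in>E. \<Sum>R\<in>{R. R \<subseteq> B \<and> card R = r}. of_bool (\<forall>b\<in>R. P e b))"
  proof (rule sum.cong[OF refl])
    fix e
    have "card {b \<in> B. P e b} choose r = card {R. R \<subseteq> {b \<in> B. P e b} \<and> card R = r}"
      using assms by (subst n_subsets) auto
    also have "{R. R \<subseteq> {b \<in> B. P e b} \<and> card R = r} = {R \<in> {R. R \<subseteq> B \<and> card R = r}. \<forall>b\<in>R. P e b}"
      by auto
    also have "card \<dots> = (\<Sum>R\<in>{R. R \<subseteq> B \<and> card R = r}. of_bool (\<forall>b\<in>R. P e b))"
      using fin by (simp add: sum_of_bool_eq Int_def)
    finally show "card {b \<in> B. P e b} choose r = (\<Sum>R\<in>{R. R \<subseteq> B \<and> card R = r}. of_bool (\<forall>b\<in>R. P e b))" .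
  qed
  also have "\<dots> = (\<Sum>R\<in>{R. R \<subseteq> B \<and> card R = r}. \<Sum>e\<in>E. of_bool (\<forall>b\<in>R. P e b))"
    by (rule sum.swap)
  also have "\<dots> = (\<Sum>R\<in>{R. R \<subseteq> B \<and> card R = r}. card {e \<in> E. \<forall>b\<in>R. P e b})"
    using assms by (simp add: sum_of_bool_eq Int_def)
  finally show ?thesis .
qed

lemma card_zero_inclusion_exclusion:
  fixes X :: "'a \<Rightarrow> nat"
  assumes "finite E" "\<And>e. e \<in> E \<Longrightarrow> X e \<le> N"
  shows "real (card {e \<in> E. X e = 0}) = (\<Sum>r\<le>N. (-1) ^ r * real (\<Sum>e\<in>E. X e choose r))"
proof -
  have "(\<Sum>r\<le>N. (-1) ^ r * real (\<Sum>e\<in>E. X e choose r))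
      = (\<Sum>e\<in>E. \<Sum>r\<le>N. (-1) ^ r * real (X e choose r))"
    unfolding of_nat_sum sum_distrib_left by (rule sum.swap)
  also have "\<dots> = (\<Sum>e\<in>E. of_bool (X e = 0))"
  proof (rule sum.cong[OF refl])
    fix e assume e: "e \<in> E"
    have "(\<Sum>r\<le>N. (-1) ^ r * real (X e choose r)) = (\<Sum>r\<le>X e. (-1) ^ r * real (X e choose r))"
      using assms(2)[OF e] by (intro sum.mono_neutral_right) (auto simp: binomial_eq_0)
    also have "\<dots> = of_bool (X e = 0)"
      using choose_alternating_sum[of "X e", where 'a = real] by (cases "X e = 0") auto
    finally show "(\<Sum>r\<le>N. (-1) ^ r * real (X e choose r)) = of_bool (X e = 0)" .
  qed
  also have "\<dots> = real (card {e \<in> E. X e = 0})"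
    using assms(1) by (simp add: sum_of_bool_eq Int_def)
  finally show ?thesis by simp
qed

text \<open>
  Chebyshev's inequality in terms of the first two binomial moments: elements with \<open>X = 0\<close> deviate from
  the mean by the whole mean.
\<close>

lemma card_zero_second_moment:
  fixes X :: "'a \<Rightarrow> nat"
  assumes "finite E" and S1: "S1 = real (\<Sum>e\<in>E. X e)" "S1 > 0"
    and S2: "S2 = real (\<Sum>e\<in>E. X e choose 2)"
  shows "real (card {e \<in> E. X e = 0}) \<le>
     real (card E) * (real (card E) * (2 * S2 + S1) / S1\<^sup>2 - 1)"
proof -
  define n where "n = real (card E)"
  have sq: "(\<Sum>e\<in>E. (real (X e))\<^sup>2) = 2 * S2 + S1"
  proof -
    have "(real x)\<^sup>2 = 2 * real (x choose 2) + real x" for x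
      by (induction x) (auto simp: numeral_2_eq_2 algebra_simps power2_eq_square)
    then show ?thesis by (simp add: S1 S2 sum.distrib sum_distrib_left)
  qed
  have "real (card {e \<in> E. X e = 0}) * S1\<^sup>2 = (\<Sum>e\<in>{e \<in> E. X e = 0}. (S1 - n * real (X e))\<^sup>2)"
    by simp
  also have "\<dots> \<le> (\<Sum>e\<in>E. (S1 - n * real (X e))\<^sup>2)"
    using assms(1) by (intro sum_mono2) auto
  also have "\<dots> = (\<Sum>e\<in>E. S1\<^sup>2 - 2 * n * S1 * real (X e) + n\<^sup>2 * (real (X e))\<^sup>2)"
    by (intro sum.cong) (auto simp: power2_eq_square algebra_simps)
  also have "\<dots> = n * S1\<^sup>2 - 2 * n * S1 * S1 + n\<^sup>2 * (2 * S2 + S1)"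
    unfolding sum.distrib sum_subtractf sum_distrib_left[symmetric] sq using S1 by (simp add: n_def)
  also have "\<dots> = n * (n * (2 * S2 + S1) - S1\<^sup>2)"
    by (simp add: power2_eq_square algebra_simps)
  finally have "real (card {e \<in> E. X e = 0}) \<le> n * (n * (2 * S2 + S1) - S1\<^sup>2) / S1\<^sup>2"
    using S1 by (simp add: field_simps)
  also have "\<dots> = n * (n * (2 * S2 + S1) / S1\<^sup>2 - 1)"
    using S1 by (simp add: diff_divide_distrib right_diff_distrib)
  finally show ?thesis unfolding n_def .
qed

text \<open>
  As subtraction is truncated, the positions up to \<open>p\<close> carry \<open>c 0\<close>, which is 0 for words on \<open>{1..k}\<close>.
\<close>

definition shift :: "(nat \<Rightarrow> nat) \<Rightarrow> nat \<Rightarrow> nat \<Rightarrow> nat" where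
  "shift c p x = c (x - p)"

lemma shift_in_comps:
  assumes "c \<in> comps {1..k} s" "{p + 1..p + k} \<subseteq> T" "finite T"
  shows "shift c p \<in> comps T s"
proof -
  have z: "shift c p x = 0" if "x \<notin> {p + 1..p + k}" for x
  proof -
    have "x - p \<notin> {1..k}" using that by auto
    then show ?thesis using assms(1) by (simp add: shift_def comps_def)
  qed
  have "sum (shift c p) T = sum (shift c p) {p + 1..p + k}"
    using assms z by (intro sum.mono_neutral_right) auto
  also have "\<dots> = sum c {1..k}"
    using sum.shift_bounds_cl_nat_ivl[of "shift c p" 1 p k] by (simp add: shift_def add.commute)
  also have "\<dots> = s" using assms(1) by (simp add: comps_def)
  finally have "sum (shift c p) T = s" .
  moreover have "shift c p x = 0" if "x \<notin> T" for x using that assms(2) by (intro z) blast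
  ultimately show ?thesis unfolding comps_def by blast
qed

text \<open>
  Shifts of a nonzero word differ because their first nonzero letters are at different places.
\<close>

lemma shift_inject:
  assumes c: "c \<in> comps {1..k} s" "s > 0" and eq: "shift c p = shift c p'"
  shows "p = p'"
proof -
  define u where "u = (LEAST u. c u \<noteq> 0)"
  have "sum c {1..k} \<noteq> 0" using c by (simp add: comps_def)
  then obtain u0 where u0: "c u0 \<noteq> 0" by (metis sum.neutral)
  have u: "c u \<noteq> 0" unfolding u_def using u0 by (rule LeastI)
  have min: "u \<le> x" if "c x \<noteq> 0" for x unfolding u_def using that by (rule Least_le)
  have c0: "c 0 = 0" using c by (auto simp: comps_def)
  have "c (u + p - p') \<noteq> 0" using fun_cong[OF eq, of "u + p"] u by (simp add: shift_def)
  moreover have "c (u + p' - p) \<noteq> 0" using fun_cong[OF eq, of "u + p'"] u by (simp add: shift_def)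
  ultimately have "u \<le> u + p - p'" "u \<le> u + p' - p" using min by auto
  moreover have "u > 0" using u c0 by (cases u) auto
  ultimately show ?thesis by arith
qed

definition block :: "nat \<Rightarrow> nat \<Rightarrow> nat \<Rightarrow> nat set" where
  "block r L b = {r + b * L + 1..r + b * L + L}"

text \<open>
  The words that a good block may carry: one shifted copy of \<open>c\<close>, and zeros elsewhere. Blocks are
  numbered from 0 and the first one starts just after position \<open>r\<close>. For \<open>L = k\<close> the only good word is \<open>c\<close>
  itself; for long blocks, few placements of a copy of \<open>c\<close> straddle two blocks.
\<close>

definition good_words :: "nat \<Rightarrow> (nat \<Rightarrow> nat) \<Rightarrow> nat \<Rightarrow> nat \<Rightarrow> nat \<Rightarrow> (nat \<Rightarrow> nat) set" where
  "good_words k c r L b = (\<lambda>i. shift c (r + b * L + i)) ` {..L - k}"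

definition good_blocks :: "nat \<Rightarrow> (nat \<Rightarrow> nat) \<Rightarrow> nat \<Rightarrow> nat \<Rightarrow> nat \<Rightarrow> (nat \<Rightarrow> nat) \<Rightarrow> nat" where
  "good_blocks k c r L N e = card {b \<in> {..<N}. restrict_zero (block r L b) e \<in> good_words k c r L b}"

lemma disjoint_blocks: "disjoint_family (block r L)"
proof -
  have "block r L a \<inter> block r L b = {}" if "a < b" for a b
  proof -
    have "a * L + L \<le> b * L" using mult_le_mono1[of "Suc a" b L] that by simp
    then show ?thesis by (auto simp: block_def)
  qed
  then show ?thesis unfolding disjoint_family_on_def by (metis Int_commute linorder_neqE_nat)
qed

lemma block_subset: "b < N \<Longrightarrow> r + N * L \<le> n \<Longrightarrow> block r L b \<subseteq> {r + 1..n}"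
  using mult_le_mono1[of "Suc b" N L] by (auto simp: block_def)

lemma sum_choose_good_blocks:
  assumes c: "c \<in> comps {1..k} s" "s > 0" and kL: "k \<le> L" and N: "r + N * L \<le> n"
  shows "(\<Sum>e\<in>comps {r + 1..n} M. good_blocks k c r L N e choose j) =
     (N choose j) * (L - k + 1) ^ j * (if j * s \<le> M then ncomps (n - r - j * L) (M - j * s) else 0)"
proof -
  have "(\<Sum>e\<in>comps {r + 1..n} M. good_blocks k c r L N e choose j) =
     (\<Sum>R\<in>{R. R \<subseteq> {..<N} \<and> card R = j}. card {e \<in> comps {r + 1..n} M. \<forall>b\<in>R. restrict_zero (block r L b) e \<in> good_words k c r L b})"
    unfolding good_blocks_def by (rule sum_choose_card_eq) (auto intro: finite_comps)
  also have "\<dots> = (\<Sum>R\<in>{R. R \<subseteq> {..<N} \<and> card R = j}.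
      (L - k + 1) ^ j * (if j * s \<le> M then ncomps (n - r - j * L) (M - j * s) else 0))"
  proof (rule sum.cong[OF refl])
    fix R assume R: "R \<in> {R. R \<subseteq> {..<N} \<and> card R = j}"
    have "card {e \<in> comps {r + 1..n} M. \<forall>b\<in>R. restrict_zero (block r L b) e \<in> good_words k c r L b} =
         (L - k + 1) ^ card R * (if card R * s \<le> M then ncomps (card {r + 1..n} - card R * L) (M - card R * s) else 0)"
    proof (rule card_block_choices)
      show "finite R" using R finite_subset by auto
      show "disjoint_family_on (block r L) R"
        using disjoint_blocks[of r L] by (auto simp: disjoint_family_on_def)
      fix b assume "b \<in> R"
      then show "block r L b \<subseteq> {r + 1..n}" using R N by (intro block_subset) auto
      show "card (block r L b) = L" by (simp add: block_def)
      show "good_words k c r L b \<subseteq> comps (block r L b) s"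
        unfolding good_words_def using kL by (auto intro!: shift_in_comps[OF c(1)] simp: block_def)
      have "inj_on (\<lambda>i. shift c (r + b * L + i)) {..L - k}"
        by (rule inj_onI) (auto dest: shift_inject[OF c])
      then show "card (good_words k c r L b) = L - k + 1"
        unfolding good_words_def by (simp add: card_image)
    qed auto
    then show "card {e \<in> comps {r + 1..n} M. \<forall>b\<in>R. restrict_zero (block r L b) e \<in> good_words k c r L b} =
         (L - k + 1) ^ j * (if j * s \<le> M then ncomps (n - r - j * L) (M - j * s) else 0)"
      using R by simp
  qed
  also have "\<dots> = (N choose j) * (L - k + 1) ^ j * (if j * s \<le> M then ncomps (n - r - j * L) (M - j * s) else 0)"
    by (simp add: n_subsets)
  finally show ?thesis .
qed

lemma pattern_in_good_block:
  assumes "good_blocks k c r L N e > 0" "k \<le> L" "r + N * L \<le> n"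
  obtains p where "p + k \<le> n" "\<And>v. v \<in> {1..k} \<Longrightarrow> e (p + v) = c v"
proof -
  have "{b \<in> {..<N}. restrict_zero (block r L b) e \<in> good_words k c r L b} \<noteq> {}"
    using assms(1) unfolding good_blocks_def by (metis card.empty less_irrefl)
  then obtain b i where b: "b < N" "i \<le> L - k" "restrict_zero (block r L b) e = shift c (r + b * L + i)"
    unfolding good_words_def by auto
  have le: "b * L + L \<le> N * L" using mult_le_mono1[of "Suc b" N L] b by simp
  show ?thesis
  proof (rule that)
    show "r + b * L + i + k \<le> n" using le b assms by auto
    fix v assume v: "v \<in> {1..k}"
    then have "r + b * L + i + v \<in> block r L b" using b assms by (auto simp: block_def)
    then show "e (r + b * L + i + v) = c v"
      using fun_cong[OF b(3), of "r + b * L + i + v"] by (simp add: restrict_zero_def shift_def)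
  qed
qed

section \<open>The caps exclude few compositions\<close>

lemma finite_capped: "finite I \<Longrightarrow> finite (capped I M)"
  unfolding capped_def by (rule finite_subset[OF _ finite_comps]) auto

lemma card_dominating_some_le:
  assumes I: "finite I" "I \<noteq> {}" and J: "finite J" and v: "\<And>j. j \<in> J \<Longrightarrow> v j \<in> comps I (u j)"
  shows "real (card {e \<in> comps I M. \<exists>j\<in>J. \<forall>i. v j i \<le> e i})
         \<le> (\<Sum>j\<in>J. fill (card I) M ^ u j) * real (ncomps (card I) M)"
proof -
  have "{e \<in> comps I M. \<exists>j\<in>J. \<forall>i. v j i \<le> e i} = (\<Union>j\<in>J. {e \<in> comps I M. \<forall>i. v j i \<le> e i})"
    by auto
  then have "real (card {e \<in> comps I M. \<exists>j\<in>J. \<forall>i. v j i \<le> e i})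
      \<le> real (\<Sum>j\<in>J. card {e \<in> comps I M. \<forall>i. v j i \<le> e i})"
    using card_UN_le[OF J, of "\<lambda>j. {e \<in> comps I M. \<forall>i. v j i \<le> e i}"] by (simp only: of_nat_le_iff)
  also have "\<dots> \<le> (\<Sum>j\<in>J. fill (card I) M ^ u j * real (ncomps (card I) M))"
    unfolding of_nat_sum by (intro sum_mono card_dominating_le I v)
  finally show ?thesis by (simp add: sum_distrib_right)
qed

text \<open>
  The geometric series \<open>q\<^sup>r\<^sup>+\<^sup>1 + q\<^sup>r\<^sup>+\<^sup>2 + \<dots>\<close> for \<open>q = fill n m\<close>, which bounds the proportion of compositions on
  \<open>n\<close> positions following position \<open>r\<close> that violate a cap.
\<close>

definition cap_loss :: "nat \<Rightarrow> nat \<Rightarrow> nat \<Rightarrow> real" where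
  "cap_loss r n m = fill n m ^ (r + 1) / (1 - fill n m)"

text \<open>
  A composition that violates the cap at position \<open>j\<close> has an entry of at least \<open>j\<close> there.
\<close>

lemma card_capped_ge:
  assumes q: "r < n" "fill (n - r) M < 1"
  shows "(1 - cap_loss r (n - r) M) * real (ncomps (n - r) M) \<le> real (card (capped {r + 1..n} M))"
proof -
  let ?I = "{r + 1..n}" and ?q = "fill (n - r) M"
  let ?v = "\<lambda>j x. if x = j then j else 0 :: nat"
  have v: "?v j \<in> comps ?I j" if "j \<in> ?I" for j
    using that by (auto simp: comps_def)
  have bad: "comps ?I M - capped ?I M = {e \<in> comps ?I M. \<exists>j\<in>?I. \<forall>i. ?v j i \<le> e i}"
    unfolding capped_def by (auto simp: not_less)
  have sub: "capped ?I M \<subseteq> comps ?I M" by (auto simp: capped_def)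
  have q0: "0 \<le> ?q" using fill_bounds(1)[of "n - r"] q by simp
  have "(\<Sum>j\<in>?I. ?q ^ j) \<le> cap_loss r (n - r) M"
  proof -
    have "(\<Sum>j\<in>?I. ?q ^ j) = (\<Sum>j<n - r. ?q ^ (r + 1 + j))"
      by (rule sum.reindex_bij_witness[where i = "\<lambda>j. r + 1 + j" and j = "\<lambda>j. j - (r + 1)"]) auto
    also have "\<dots> = ?q ^ (r + 1) * (\<Sum>j<n - r. ?q ^ j)"
      by (simp add: power_add sum_distrib_left mult.assoc)
    also have "(\<Sum>j<n - r. ?q ^ j) \<le> 1 / (1 - ?q)"
      using q q0 by (simp add: sum_gp_strict divide_right_mono)
    finally show ?thesis using q0 by (simp add: cap_loss_def mult_left_mono)
  qed
  then have "(\<Sum>j\<in>?I. ?q ^ j) * real (ncomps (n - r) M) \<le> cap_loss r (n - r) M * real (ncomps (n - r) M)"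
    by (rule mult_right_mono) simp
  moreover have "real (card (comps ?I M - capped ?I M)) \<le> (\<Sum>j\<in>?I. ?q ^ j) * real (ncomps (n - r) M)"
    unfolding bad using card_dominating_some_le[of ?I ?I ?v "\<lambda>j. j" M] v q by simp
  moreover have "real (card (comps ?I M - capped ?I M)) = real (ncomps (n - r) M) - real (card (capped ?I M))"
    using card_Diff_subset[OF finite_capped sub] card_mono[OF finite_comps sub] card_comps[of ?I M]
    by (simp add: of_nat_diff)
  ultimately show ?thesis by (simp add: algebra_simps)
qed

lemma capped_nonempty: "m \<le> n choose 2 \<Longrightarrow> capped {1..n} m \<noteq> {}"
proof (induction n arbitrary: m)
  case 0
  then have "(\<lambda>_. 0) \<in> capped {1..0} m" by (auto simp: capped_def comps_def numeral_2_eq_2)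
  then show ?case by blast
next
  case (Suc n)
  have "Suc n choose 2 = (n choose 2) + n" by (simp add: numeral_2_eq_2)
  then have "m - min m n \<le> n choose 2" using Suc.prems by auto
  from Suc.IH[OF this] obtain e where e: "e \<in> capped {1..n} (m - min m n)" by blast
  \<comment> \<open>The last entry takes as much of the sum as its cap allows.\<close>
  have "sum (e(Suc n := min m n)) {1..Suc n} = sum e {1..n} + min m n"
    by (simp add: atLeastAtMostSuc_conv)
  then have "e(Suc n := min m n) \<in> capped {1..Suc n} m"
    using e by (auto simp: capped_def comps_def)
  then show ?case by blast
qed

lemma perms_with_inv_finite_nonempty:
  assumes "m \<le> n choose 2"
  shows "finite (perms_with_inv n m)" "perms_with_inv n m \<noteq> {}"
  using bij_betw_finite[OF bij_betw_code[of n m]] bij_betw_empty1[of "code n" "perms_with_inv n m"]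
    bij_betw_code[of n m] capped_nonempty[OF assms] finite_capped[of "{1..n}" m]
  by (auto dest: bij_betw_imp_surj_on)

lemma prob_contains_eq_card:
  assumes "m \<le> n choose 2"
  shows "prob_contains k \<pi> n m =
     real (card {\<sigma> \<in> perms_with_inv n m. contains_consecutive k \<pi> n \<sigma>}) / real (card (perms_with_inv n m))"
  using perms_with_inv_finite_nonempty[OF assms]
  by (simp add: prob_contains_def random_perm_def measure_pmf_of_set Int_def)

lemma card_perms_le_card_codes:
  assumes "\<And>\<sigma>. \<sigma> \<in> perms_with_inv n m \<Longrightarrow> A \<sigma> \<Longrightarrow> P (code n \<sigma>)"
  shows "card {\<sigma> \<in> perms_with_inv n m. A \<sigma>} \<le> card {e \<in> capped {1..n} m. P e}"
proof (rule card_inj_on_le)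
  show "inj_on (code n) {\<sigma> \<in> perms_with_inv n m. A \<sigma>}"
    by (rule inj_on_subset[OF bij_betw_imp_inj_on[OF bij_betw_code]]) auto
  show "code n ` {\<sigma> \<in> perms_with_inv n m. A \<sigma>} \<subseteq> {e \<in> capped {1..n} m. P e}"
    using assms bij_betw_imp_surj_on[OF bij_betw_code, of n m] by blast
qed (use finite_capped[of "{1..n}" m] in auto)

lemma prob_contains_le:
  assumes m: "m \<le> n choose 2"
    and P: "\<And>\<sigma>. \<sigma> \<in> perms_with_inv n m \<Longrightarrow> contains_consecutive k \<pi> n \<sigma> \<Longrightarrow> P (code n \<sigma>)"
  shows "prob_contains k \<pi> n m \<le> real (card {e \<in> capped {1..n} m. P e}) / real (card (capped {1..n} m))"
  unfolding prob_contains_eq_card[OF m] bij_betw_same_card[OF bij_betw_code]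
  using card_perms_le_card_codes[of n m "contains_consecutive k \<pi> n" P] P by (simp add: divide_right_mono)

lemma prob_avoids_le:
  assumes m: "m \<le> n choose 2"
    and P: "\<And>\<sigma>. \<sigma> \<in> perms_with_inv n m \<Longrightarrow> \<not> contains_consecutive k \<pi> n \<sigma> \<Longrightarrow> P (code n \<sigma>)"
  shows "1 - prob_contains k \<pi> n m \<le> real (card {e \<in> capped {1..n} m. P e}) / real (card (capped {1..n} m))"
proof -
  let ?S = "perms_with_inv n m" and ?C = "contains_consecutive k \<pi> n"
  have "card {\<sigma> \<in> ?S. ?C \<sigma>} + card {\<sigma> \<in> ?S. \<not> ?C \<sigma>} = card ?S"
    using perms_with_inv_finite_nonempty[OF m] by (subst card_Un_disjoint[symmetric]) (auto intro: arg_cong[of _ _ card])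
  then have "real (card ?S) = real (card {\<sigma> \<in> ?S. ?C \<sigma>}) + real (card {\<sigma> \<in> ?S. \<not> ?C \<sigma>})" by simp
  moreover have "real (card ?S) > 0" using perms_with_inv_finite_nonempty[OF m] by (simp add: card_gt_0_iff)
  ultimately have "1 - prob_contains k \<pi> n m = real (card {\<sigma> \<in> ?S. \<not> ?C \<sigma>}) / real (card ?S)"
    unfolding prob_contains_eq_card[OF m] by (simp add: field_simps)
  also have "\<dots> \<le> real (card {e \<in> capped {1..n} m. P e}) / real (card ?S)"
    using card_perms_le_card_codes[of n m "\<lambda>\<sigma>. \<not> ?C \<sigma>" P] P by (simp add: divide_right_mono)
  finally show ?thesis unfolding bij_betw_same_card[OF bij_betw_code] .
qed

text \<open>
  An event that is rare among all weak compositions is rare among those that respect the caps, as these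
  are most of them. This transfers one-sided bounds only, which is all that is used below.
\<close>

lemma capped_fraction_le:
  assumes q: "r < n" "fill (n - r) M < 1" "cap_loss r (n - r) M < 1"
    and x: "real (card {e \<in> comps {r + 1..n} M. P e}) \<le> x * real (ncomps (n - r) M)"
  shows "real (card {e \<in> capped {r + 1..n} M. P e}) \<le> x / (1 - cap_loss r (n - r) M) * real (card (capped {r + 1..n} M))"
proof -
  let ?D = "real (ncomps (n - r) M)"
  have D: "?D > 0" using ncomps_pos[of "n - r"] q by simp
  have "0 \<le> x * ?D" using x by (rule order_trans[rotated]) simp
  then have x0: "0 \<le> x" using D by (simp add: zero_le_mult_iff)
  have "card {e \<in> capped {r + 1..n} M. P e} \<le> card {e \<in> comps {r + 1..n} M. P e}"
    by (intro card_mono finite_subset[OF _ finite_comps[of "{r + 1..n}" M]]) (auto simp: capped_def)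
  then have "real (card {e \<in> capped {r + 1..n} M. P e}) \<le> x * ?D" using x by linarith
  also have "?D \<le> real (card (capped {r + 1..n} M)) / (1 - cap_loss r (n - r) M)"
    using card_capped_ge[OF q(1,2)] q(3) by (simp add: field_simps)
  finally show ?thesis using x0 by (simp add: mult_left_mono)
qed

lemma capped_fraction_le_unconditioned:
  assumes q: "0 < n" "fill n M < 1" "cap_loss 0 n M < 1"
    and x: "real (card {e \<in> comps {1..n} M. P e}) \<le> x * real (ncomps n M)"
  shows "real (card {e \<in> capped {1..n} M. P e}) / real (card (capped {1..n} M)) \<le> x / (1 - cap_loss 0 n M)"
proof (cases "card (capped {1..n} M) = 0")
  case True
  have "0 \<le> x * real (ncomps n M)" using x by (rule order_trans[rotated]) simp
  then have "0 \<le> x" using ncomps_pos[OF q(1), of M] by (simp add: zero_le_mult_iff)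
  then show ?thesis using True q by simp
next
  case False
  then show ?thesis using capped_fraction_le[of 0 n M P x] assms by (simp add: field_simps)
qed

section \<open>Bounds by the first moment\<close>

lemma code_in_comps: "code n \<sigma> \<in> comps {1..n} (inv_count n \<sigma>)"
  using sum_code[of n \<sigma>] by (auto simp: comps_def code_def)

lemma code_dominates_if_contains:
  assumes "contains_consecutive k \<pi> n \<sigma>"
  shows "\<exists>p. p + k \<le> n \<and> (\<forall>i. shift (code k \<pi>) p i \<le> code n \<sigma> i)"
proof -
  from assms obtain j where j: "occurs_at k \<pi> n \<sigma> j" unfolding contains_consecutive_def by blast
  then have j1: "1 \<le> j" "j + k \<le> n + 1" by (auto simp: occurs_at_def)
  define p where "p = j - 1"
  have "shift (code k \<pi>) p i \<le> code n \<sigma> i" for i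
  proof (cases "i - p \<in> {1..k}")
    case True
    then show ?thesis
      using window_code_ge_if_occurs[of k \<pi> n \<sigma> p "i - p"] j j1 by (auto simp: p_def shift_def)
  next
    case False
    then have "code k \<pi> (i - p) = 0" unfolding code_def by (rule if_not_P)
    then show ?thesis by (simp add: shift_def)
  qed
  moreover have "p + k \<le> n" using j1 by (auto simp: p_def)
  ultimately show ?thesis by blast
qed

lemma shift_code_in_comps:
  "p + k \<le> n \<Longrightarrow> shift (code k \<pi>) p \<in> comps {1..n} (inv_count k \<pi>)"
  by (rule shift_in_comps[OF code_in_comps]) auto

lemma prob_contains_first_moment:
  assumes m: "m \<le> n choose 2" and n: "0 < n" and k: "k \<ge> 1"
    and q: "fill n m < 1" "cap_loss 0 n m < 1"
  shows "prob_contains k \<pi> n m \<le> real n * fill n m ^ inv_count k \<pi> / (1 - cap_loss 0 n m)"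
proof -
  let ?J = "{p. p + k \<le> n}" and ?s = "inv_count k \<pi>"
  let ?P = "\<lambda>e. \<exists>p\<in>?J. \<forall>i. shift (code k \<pi>) p i \<le> e i"
  have J: "?J \<subseteq> {..<n}" using k by auto
  then have fJ: "finite ?J" using finite_subset by blast
  have "real (card {e \<in> comps {1..n} m. ?P e}) \<le> (\<Sum>p\<in>?J. fill n m ^ ?s) * real (ncomps n m)"
    using card_dominating_some_le[of "{1..n}" ?J "shift (code k \<pi>)" "\<lambda>_. ?s" m] fJ n shift_code_in_comps
    by simp
  also have "(\<Sum>p\<in>?J. fill n m ^ ?s) \<le> real n * fill n m ^ ?s"
    using card_mono[OF _ J] fill_bounds(1)[OF n, of m] by (simp add: mult_right_mono)
  finally have "real (card {e \<in> comps {1..n} m. ?P e}) \<le> real n * fill n m ^ ?s * real (ncomps n m)"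
    by (simp add: mult_right_mono)
  from capped_fraction_le_unconditioned[OF n q this] show ?thesis
    by (intro order_trans[OF prob_contains_le[OF m, of k \<pi> ?P]]) (use code_dominates_if_contains in blast)+
qed

text \<open>
  The code of a pattern with one inversion is a single 1. So any 1 in the code of a permutation that is
  not near an end and has only zeros near it produces the pattern, and avoidance forces a nonzero entry
  near an end, an entry of at least 2, or two nonzero entries close to each other.
\<close>

lemma prob_avoids_single_inversion:
  assumes m: "m \<le> n choose 2" "m > 0" and n: "0 < n" and \<pi>: "\<pi> permutes {1..k}" "inv_count k \<pi> = 1"
    and q: "fill n m < 1" "cap_loss 0 n m < 1"
  shows "1 - prob_contains k \<pi> n m
    \<le> (2 * real k * fill n m + real n * real k * fill n m ^ 2) / (1 - cap_loss 0 n m)"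
proof -
  let ?q = "fill n m"
  define U :: "nat \<Rightarrow> nat \<Rightarrow> nat" where "U = (\<lambda>j x. if x = j then 1 else 0)"
  have U: "U j \<in> comps {1..n} 1" if "j \<in> {1..n}" for j using that by (auto simp: U_def comps_def)
  have UU: "(\<lambda>x. U j x + U l x) \<in> comps {1..n} 2" if "j \<in> {1..n}" "l \<in> {1..n}" for j l
    using U[OF that(1)] U[OF that(2)] by (auto simp: comps_def sum.distrib)
  have sum1: "sum (code k \<pi>) {1..k} = 1" using sum_code \<pi> by simp
  then obtain w where w: "w \<in> {1..k}" "code k \<pi> w = 1" "\<And>v. v \<in> {1..k} \<Longrightarrow> v \<noteq> w \<Longrightarrow> code k \<pi> v = 0"
    using sum_eq_1_iff[of "{1..k}" "code k \<pi>"] by auto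
  \<comment> \<open>The positions near an end, and the pairs of a position with another one in its window (for \<open>v = w\<close> the position itself, which then stands for an entry of at least 2).\<close>
  define J1 where "J1 = {1..n} \<inter> ({1..k} \<union> {n + 1 - k..n})"
  define J2 where "J2 = {(j, v). j \<in> {1..n} \<and> v \<in> {1..k} \<and> j + v - w \<in> {1..n}}"
  define P1 where "P1 = (\<lambda>e. \<exists>j\<in>J1. \<forall>i. U j i \<le> e i)"
  define P2 where "P2 = (\<lambda>e. \<exists>j\<in>J2. \<forall>i. U (fst j) i + U (fst j + snd j - w) i \<le> e i)"
  have J2: "J2 \<subseteq> {1..n} \<times> {1..k}" by (auto simp: J2_def)
  then have fJ2: "finite J2" by (rule finite_subset) auto
  have cJ2: "card J2 \<le> n * k" using card_mono[OF _ J2] by (simp add: card_cartesian_product)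
  have cJ1: "card J1 \<le> 2 * k"
  proof -
    have "card J1 \<le> card ({1..k} \<union> {n + 1 - k..n})" by (intro card_mono) (auto simp: J1_def)
    also have "\<dots> \<le> card {1..k} + card {n + 1 - k..n}" by (rule card_Un_le)
    finally show ?thesis by simp
  qed
  have q0: "0 \<le> ?q" using fill_bounds(1)[OF n] .
  have "real (card {e \<in> comps {1..n} m. P1 e}) \<le> (\<Sum>j\<in>J1. ?q ^ 1) * real (ncomps n m)"
    using card_dominating_some_le[of "{1..n}" J1 U "\<lambda>_. 1" m] n U unfolding P1_def by (auto simp: J1_def)
  also have "\<dots> \<le> (2 * real k * ?q) * real (ncomps n m)"
    using cJ1 q0 by (intro mult_right_mono) (auto intro!: mult_right_mono)
  finally have 1: "real (card {e \<in> comps {1..n} m. P1 e}) \<le> (2 * real k * ?q) * real (ncomps n m)" .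
  have "real (card {e \<in> comps {1..n} m. P2 e}) \<le> (\<Sum>j\<in>J2. ?q ^ 2) * real (ncomps n m)"
    using card_dominating_some_le[of "{1..n}" J2 "\<lambda>j i. U (fst j) i + U (fst j + snd j - w) i" "\<lambda>_. 2" m] n UU fJ2
    unfolding P2_def by (auto simp: J2_def)
  also have "\<dots> \<le> (real n * real k * ?q ^ 2) * real (ncomps n m)"
    using cJ2 q0 by (intro mult_right_mono) (auto intro!: mult_right_mono simp flip: of_nat_mult)
  finally have 2: "real (card {e \<in> comps {1..n} m. P2 e}) \<le> (real n * real k * ?q ^ 2) * real (ncomps n m)" .
  have "{e \<in> comps {1..n} m. P1 e \<or> P2 e} = {e \<in> comps {1..n} m. P1 e} \<union> {e \<in> comps {1..n} m. P2 e}" by auto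
  then have "card {e \<in> comps {1..n} m. P1 e \<or> P2 e}
      \<le> card {e \<in> comps {1..n} m. P1 e} + card {e \<in> comps {1..n} m. P2 e}"
    by (simp only: card_Un_le)
  then have "real (card {e \<in> comps {1..n} m. P1 e \<or> P2 e})
      \<le> (2 * real k * ?q + real n * real k * ?q ^ 2) * real (ncomps n m)"
    using 1 2 by (simp add: distrib_right)
  note bound = capped_fraction_le_unconditioned[OF n q this]
  have "P1 (code n \<sigma>) \<or> P2 (code n \<sigma>)"
    if \<sigma>: "\<sigma> \<in> perms_with_inv n m" and no: "\<not> contains_consecutive k \<pi> n \<sigma>" for \<sigma>
  proof -
    have perm: "\<sigma> permutes {1..n}" "inv_count n \<sigma> = m" using \<sigma> by (auto simp: perms_with_inv_def)
    have "sum (code n \<sigma>) {1..n} \<noteq> 0" using perm sum_code[of n \<sigma>] m by simp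
    then obtain j where j: "j \<in> {1..n}" "code n \<sigma> j \<noteq> 0" by (metis sum.neutral)
    show ?thesis
    proof (cases "j \<in> J1")
      case True
      then show ?thesis using j by (auto simp: P1_def U_def intro!: bexI[of _ j])
    next
      case False
      then have jk: "k < j" "j + k \<le> n" using j by (auto simp: J1_def)
      define p where "p = j - w"
      have p: "p + k \<le> n" "p + w = j" using jk w by (auto simp: p_def)
      obtain v where v: "v \<in> {1..k}" "code n \<sigma> (p + v) \<noteq> code k \<pi> v"
        using occurs_if_window_code[OF perm(1) \<pi>(1) p(1)] no by blast
      have "U j i + U (j + v - w) i \<le> code n \<sigma> i" for i
      proof (cases "v = w")
        case True
        then have "code n \<sigma> j \<noteq> 1" using v w p by simp
        then show ?thesis using j True by (auto simp: U_def)
      next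
        case False
        then have "code n \<sigma> (p + v) \<noteq> 0" using v w by auto
        moreover have "j + v - w = p + v" "j \<noteq> j + v - w" using p False by auto
        ultimately show ?thesis using j by (auto simp: U_def)
      qed
      moreover have "(j, v) \<in> J2" using j v jk w by (auto simp: J2_def)
      ultimately show ?thesis unfolding P2_def by force
    qed
  qed
  then show ?thesis
    by (intro order_trans[OF prob_avoids_le[OF m(1), of k \<pi> "\<lambda>e. P1 e \<or> P2 e"] bound])
qed

section \<open>A bound by the second moment\<close>

text \<open>
  The events that two disjoint blocks of \<open>k\<close> positions carry prescribed words of sum \<open>s\<close> are almost
  uncorrelated: the left-hand side is the probability of the joint event, up to the factor
  \<open>(ncomps n M)\<^sup>2\<close>, and the right-hand side is nearly the product of the probabilities, up to the same
  factor. In the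
  quotient of falling factorials the numerators of the joint event are smaller than those of the product,
  and the denominators differ only by a shift of their \<open>k + s\<close> factors.
\<close>

lemma ncomps_pair_ratio_le:
  assumes M: "2 * s \<le> M" and n: "2 * k < n"
  shows "real (ncomps n M) * real (ncomps (n - 2 * k) (M - 2 * s)) \<le>
     (1 + real (k + s) / real (n - 2 * k)) ^ (k + s) * (real (ncomps (n - k) (M - s)))\<^sup>2"
proof -
  define D D1 D2 where "D = real (ncomps n M)" and "D1 = real (ncomps (n - k) (M - s))"
    and "D2 = real (ncomps (n - 2 * k) (M - 2 * s))"
  define F where "F = (\<lambda>x n. \<Prod>i<x. real (n - i))"
  define z where "z = 1 + real (k + s) / real (n - 2 * k)"
  have r1: "D1 * F (k + s) (n + M - 1) = D * (F s M * F k (n - 1))"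
    using ncomps_ratio[of s M k n] assms by (simp add: D1_def D_def F_def)
  have eq: "n - k - k = n - 2 * k" "M - s - s = M - 2 * s" "n - k + (M - s) - 1 = n + M - 1 - (k + s)"
    using assms by auto
  have r2: "D2 * F (k + s) (n + M - 1 - (k + s)) = D1 * (F s (M - s) * F k (n - k - 1))"
    using ncomps_ratio[of s "M - s" k "n - k"] assms
    unfolding D1_def D2_def F_def eq by (simp add: mult.assoc)
  have pos: "F (k + s) (n + M - 1 - (k + s)) > 0" "F s M * F k (n - 1) > 0"
    "F (k + s) (n + M - 1) > 0"
    unfolding F_def using assms by (auto intro!: prod_pos mult_pos_pos)
  have le1: "F s (M - s) * F k (n - k - 1) \<le> F s M * F k (n - 1)"
    unfolding F_def using assms by (intro mult_mono prod_mono) (auto intro!: prod_nonneg)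
  have le2: "F (k + s) (n + M - 1) \<le> z ^ (k + s) * F (k + s) (n + M - 1 - (k + s))"
  proof -
    have "z ^ (k + s) * F (k + s) (n + M - 1 - (k + s)) = (\<Prod>i<k + s. z * real (n + M - 1 - (k + s) - i))"
      by (simp add: F_def prod.distrib)
    moreover have "F (k + s) (n + M - 1) \<le> (\<Prod>i<k + s. z * real (n + M - 1 - (k + s) - i))"
      unfolding F_def
    proof (intro prod_mono conjI)
      fix i assume i: "i \<in> {..<k + s}"
      define y where "y = n + M - 1 - (k + s) - i"
      have y: "n - 2 * k \<le> y" "n + M - 1 - i = y + (k + s)" using i assms by (auto simp: y_def)
      have "real (k + s) / real (n - 2 * k) * real y \<ge> real (k + s) / real (n - 2 * k) * real (n - 2 * k)"
        using y by (intro mult_left_mono) auto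
      then have "real (k + s) / real (n - 2 * k) * real y \<ge> real (k + s)" using n by simp
      then have "real (y + (k + s)) \<le> z * real y" by (simp add: z_def distrib_right)
      then show "real (n + M - 1 - i) \<le> z * real (n + M - 1 - (k + s) - i)"
        unfolding y(2) y_def[symmetric] .
    qed auto
    ultimately show ?thesis by simp
  qed
  have D0: "D \<ge> 0" "D1 \<ge> 0" "D2 \<ge> 0" by (auto simp: D_def D1_def D2_def)
  let ?A = "F s M * F k (n - 1)" and ?G = "F (k + s) (n + M - 1 - (k + s))"
  have "D * D2 * (?A * ?G) = (D * ?A) * (D2 * ?G)" by simp
  also have "\<dots> = D1\<^sup>2 * (F (k + s) (n + M - 1) * (F s (M - s) * F k (n - k - 1)))"
    unfolding r1[symmetric] r2 by (simp add: power2_eq_square)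
  also have "\<dots> \<le> D1\<^sup>2 * ((z ^ (k + s) * ?G) * ?A)"
  proof (intro mult_left_mono mult_mono[OF le2 le1])
    show "0 \<le> z ^ (k + s) * ?G" using le2 pos by linarith
    show "0 \<le> F s (M - s) * F k (n - k - 1)"
      unfolding F_def by (intro mult_nonneg_nonneg prod_nonneg) auto
  qed simp
  finally have "D * D2 * (?A * ?G) \<le> z ^ (k + s) * D1\<^sup>2 * (?A * ?G)" by (simp add: mult_ac)
  then have "D * D2 \<le> z ^ (k + s) * D1\<^sup>2"
    using pos by (meson mult_le_cancel_right_pos mult_pos_pos)
  then show ?thesis by (simp add: D_def D1_def D2_def z_def)
qed

lemma ncomps_single_ratio_le:
  assumes M: "2 * s \<le> M" and n: "2 * k < n"
  shows "real (ncomps n M) * (real M ^ s * real n ^ k) \<le>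
     2 ^ (k + s) * (real n + real M) ^ (k + s) * real (ncomps (n - k) (M - s))"
proof -
  have "(real M / 2) ^ s * (real n / 2) ^ k \<le> (\<Prod>i<s. real (M - i)) * (\<Prod>i<k. real (n - 1 - i))"
  proof (intro mult_mono)
    have "(real M / 2) ^ s = (\<Prod>i<s. real M / 2)" by simp
    also have "\<dots> \<le> (\<Prod>i<s. real (M - i))"
      using M by (intro prod_mono) auto
    finally show "(real M / 2) ^ s \<le> (\<Prod>i<s. real (M - i))" .
    have "(real n / 2) ^ k = (\<Prod>i<k. real n / 2)" by simp
    also have "\<dots> \<le> (\<Prod>i<k. real (n - 1 - i))"
      using n by (intro prod_mono) auto
    finally show "(real n / 2) ^ k \<le> (\<Prod>i<k. real (n - 1 - i))" .
  qed (auto intro!: prod_nonneg)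
  then have "real (ncomps n M) * ((real M / 2) ^ s * (real n / 2) ^ k) \<le>
      real (ncomps n M) * ((\<Prod>i<s. real (M - i)) * (\<Prod>i<k. real (n - 1 - i)))"
    by (rule mult_left_mono) simp
  also have "\<dots> = real (ncomps (n - k) (M - s)) * (\<Prod>i<k + s. real (n + M - 1 - i))"
    using ncomps_ratio[of s M k n] assms by (simp add: mult.assoc)
  also have "\<dots> \<le> real (ncomps (n - k) (M - s)) * (\<Prod>i<k + s. real n + real M)"
    by (intro mult_left_mono prod_mono) auto
  finally show ?thesis
    by (simp add: power_divide power_add field_simps)
qed

text \<open>
  In this bound for the proportion of compositions without a good block, the first line accounts for the
  correlation of two blocks and the second is at least one over the expected number of good blocks.
\<close>

lemma card_no_good_block_le:
  assumes c: "c \<in> comps {1..k} s" "s > 0" and M: "2 * s \<le> M" and n: "2 * k < n - r"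
  shows "real (card {e \<in> comps {r + 1..n} M. good_blocks k c r k ((n - r) div k) e = 0}) \<le>
     ((1 + real (k + s) / real (n - r - 2 * k)) ^ (k + s) - 1
       + 2 ^ (k + s + 1) * real k * (real (n - r) + real M) ^ (k + s) / (real M ^ s * real (n - r) ^ (k + 1)))
     * real (ncomps (n - r) M)"
proof -
  define N where "N = (n - r) div k"
  define l where "l = n - r"
  define D D1 D2 where "D = real (ncomps l M)" and "D1 = real (ncomps (l - k) (M - s))"
    and "D2 = real (ncomps (l - 2 * k) (M - 2 * s))"
  let ?X = "good_blocks k c r k N"
  have k: "k > 0" using c by (cases k) (auto simp: comps_def)
  have Nl: "real l \<le> 2 * real k * real N"
  proof -
    have "l < k * (N + 1)"
      using dividend_less_times_div[OF k, of l] by (simp add: N_def l_def)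
    moreover have "N \<ge> 1" using n k unfolding N_def by (simp add: div_greater_zero_iff Suc_le_eq)
    then have "k * 1 \<le> k * N" by (rule mult_le_mono2)
    moreover have "2 * k * N = k * N + k * N" "k * (N + 1) = k * N + k" "k * 1 = k" by (simp_all add: algebra_simps)
    ultimately have "l \<le> 2 * k * N" by linarith
    then show ?thesis by (metis of_nat_le_iff of_nat_mult of_nat_numeral)
  qed
  then have N0: "real N > 0" using n k by (cases N) (auto simp: l_def)
  have rN: "r + N * k \<le> n"
  proof -
    have "N * k \<le> n - r" unfolding N_def by simp
    then show ?thesis using n by linarith
  qed
  have pos: "D > 0" "D1 > 0" using n by (auto simp: D_def D1_def l_def intro!: ncomps_pos)
  have S1: "real (\<Sum>e\<in>comps {r + 1..n} M. ?X e) = real N * D1"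
    using sum_choose_good_blocks[OF c order_refl rN, where j = 1 and M = M] M by (simp add: D1_def l_def del: of_nat_sum)
  have S2: "real (\<Sum>e\<in>comps {r + 1..n} M. ?X e choose 2) = real (N choose 2) * D2"
    using sum_choose_good_blocks[OF c order_refl rN, where j = 2 and M = M] M by (simp add: D2_def l_def del: of_nat_sum)
  have cE: "real (card (comps {r + 1..n} M)) = D"
    by (simp add: card_comps D_def l_def)
  have zero: "real (card {e \<in> comps {r + 1..n} M. ?X e = 0}) \<le>
     D * (D * (2 * (real (N choose 2) * D2) + real N * D1) / (real N * D1)\<^sup>2 - 1)"
    using card_zero_second_moment[OF _ S1[symmetric] _ S2[symmetric]] N0 pos cE finite_comps by simp
  have "D * (2 * (real (N choose 2) * D2) + real N * D1) / (real N * D1)\<^sup>2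
      \<le> D * D2 / D1\<^sup>2 + D / (real N * D1)"
  proof -
    have "2 * real (N choose 2) \<le> real N ^ 2"
    proof -
      have "2 * (N choose 2) \<le> N * (N - 1)"
        unfolding choose_two by (rule times_div_less_eq_dividend)
      also have "\<dots> \<le> N\<^sup>2" by (simp add: power2_eq_square)
      finally have "2 * (N choose 2) \<le> N\<^sup>2" .
      then show ?thesis by (metis of_nat_le_iff of_nat_mult of_nat_numeral of_nat_power)
    qed
    then have "2 * real (N choose 2) * D2 \<le> real N ^ 2 * D2"
      by (rule mult_right_mono) (simp add: D2_def)
    then have "D * (2 * (real (N choose 2) * D2) + real N * D1) / (real N * D1)\<^sup>2
        \<le> D * (real N ^ 2 * D2 + real N * D1) / (real N * D1)\<^sup>2"
      using pos by (intro divide_right_mono mult_left_mono) auto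
    also have "\<dots> = D * D2 / D1\<^sup>2 + D / (real N * D1)"
    proof -
      have "D * (real N ^ 2 * D2) / (real N * D1)\<^sup>2 = D * D2 / D1\<^sup>2"
        using N0 by (simp add: power_mult_distrib)
      moreover have "D * (real N * D1) / (real N * D1)\<^sup>2 = D / (real N * D1)"
        using N0 pos by (simp add: power2_eq_square)
      ultimately show ?thesis by (simp only: distrib_left add_divide_distrib)
    qed
    finally show ?thesis .
  qed
  moreover have "D * D2 / D1\<^sup>2 \<le> (1 + real (k + s) / real (l - 2 * k)) ^ (k + s)"
    using ncomps_pair_ratio_le[OF M, of k l] n pos by (simp add: D_def D1_def D2_def l_def divide_le_eq)
  moreover have "D / (real N * D1) \<le> 2 ^ (k + s + 1) * real k * (real l + real M) ^ (k + s) / (real M ^ s * real l ^ (k + 1))"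
  proof -
    have lM: "real l > 0" "real M > 0" using n M c by (auto simp: l_def)
    have "D * (real M ^ s * real l ^ k) \<le> 2 ^ (k + s) * (real l + real M) ^ (k + s) * D1"
      using ncomps_single_ratio_le[OF M, of k l] n by (simp add: D_def D1_def l_def)
    then have "D * (real M ^ s * real l ^ k) * real l
        \<le> 2 ^ (k + s) * (real l + real M) ^ (k + s) * D1 * (2 * real k * real N)"
      using pos by (intro mult_mono[OF _ Nl]) auto
    then show ?thesis using pos N0 lM by (simp add: divide_le_eq pos_le_divide_eq mult_ac)
  qed
  ultimately have "D * (2 * (real (N choose 2) * D2) + real N * D1) / (real N * D1)\<^sup>2 - 1
      \<le> (1 + real (k + s) / real (l - 2 * k)) ^ (k + s) - 1
        + 2 ^ (k + s + 1) * real k * (real l + real M) ^ (k + s) / (real M ^ s * real l ^ (k + 1))"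
    (is "?x \<le> ?y") by linarith
  then have "D * ?x \<le> D * ?y" using pos by (intro mult_left_mono) auto
  then have "real (card {e \<in> comps {r + 1..n} M. ?X e = 0}) \<le> ?y * D"
    using zero by (simp only: mult.commute[of _ D])
  then show ?thesis unfolding N_def l_def D_def .
qed

text \<open>
  Conditioning on the first \<open>r\<close> entries. Given these, the other entries form a capped composition of
  what remains of \<open>m\<close>, and by the caps the prefix has used up at most \<open>0 + 1 + \<dots> + (r - 1)\<close>. The gain is
  that all other entries may be as large as \<open>r\<close>.
\<close>

lemma capped_fraction_by_prefix:
  assumes r: "r \<le> n"
    and P: "\<And>e e'. (\<And>i. i \<in> {r + 1..n} \<Longrightarrow> e i = e' i) \<Longrightarrow> P e \<longleftrightarrow> P e'"
    and x: "\<And>M. M \<le> m \<Longrightarrow> m \<le> M + (\<Sum>j=1..r. j - 1) \<Longrightarrow>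
       real (card {e \<in> capped {r + 1..n} M. P e}) \<le> x * real (card (capped {r + 1..n} M))"
  shows "real (card {e \<in> capped {1..n} m. P e}) \<le> x * real (card (capped {1..n} m))"
proof -
  let ?A = "capped {1..n} m" and ?R = "restrict_zero {1..r}"
  have fA: "finite ?A" by (rule finite_capped) simp
  have fibres: "card {e \<in> ?A. Q e} = (\<Sum>f\<in>?R ` ?A. card {e \<in> ?A. ?R e = f \<and> Q e})" for Q
  proof -
    have "card {e \<in> ?A. Q e} = (\<Sum>f\<in>?R ` ?A. card {e \<in> {e \<in> ?A. Q e}. ?R e = f})"
      using fA by (intro card_eq_sum_fibres) auto
    moreover have "{e \<in> {e \<in> ?A. Q e}. ?R e = f} = {e \<in> ?A. ?R e = f \<and> Q e}" for f by auto
    ultimately show ?thesis by simp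
  qed
  have "real (card {e \<in> ?A. ?R e = f \<and> P e}) \<le> x * real (card {e \<in> ?A. ?R e = f \<and> True})"
    if f: "f \<in> ?R ` ?A" for f
  proof -
    obtain e0 where e0: "e0 \<in> ?A" "f = ?R e0" using f by auto
    define u where "u = sum f {1..r}"
    have fu: "f \<in> comps {1..r} u" by (auto simp: comps_def u_def e0 restrict_zero_def)
    have lt: "f j < j" if "j \<in> {1..r}" for j
      using e0 that r by (auto simp: restrict_zero_def capped_def)
    have "u \<le> (\<Sum>j=1..r. j - 1)"
      unfolding u_def using lt by (intro sum_mono) fastforce
    moreover have "u \<le> m"
    proof -
      have "u = sum e0 {1..r}" unfolding u_def e0(2) by (intro sum.cong) (auto simp: restrict_zero_def)
      also have "\<dots> \<le> sum e0 {1..n}" using r by (intro sum_mono2) auto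
      finally show ?thesis using e0 by (simp add: capped_def comps_def)
    qed
    ultimately have um: "u \<le> m" "m - u \<le> m" "m \<le> (m - u) + (\<Sum>j=1..r. j - 1)" by auto
    have tail: "{1..n} - {1..r} = {r + 1..n}" using r by auto
    have "card {e \<in> ?A. ?R e = f \<and> Q e} = card {e \<in> capped {r + 1..n} (m - u). Q e}"
      if Q: "\<And>e e'. (\<And>i. i \<in> {r + 1..n} \<Longrightarrow> e i = e' i) \<Longrightarrow> Q e \<longleftrightarrow> Q e'" for Q
    proof -
      have 1: "{e \<in> ?A. ?R e = f \<and> Q e} = {e \<in> comps {1..n} m. ?R e = f \<and> (Q e \<and> (\<forall>j\<in>{r + 1..n}. e j < j))}"
      proof -
        have "e j < j" if "?R e = f" "\<forall>j\<in>{r + 1..n}. e j < j" "j \<in> {1..n}" for e j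
        proof (cases "j \<in> {1..r}")
          case True
          then show ?thesis using lt[OF True] fun_cong[OF that(1), of j] by (simp add: restrict_zero_def)
        next
          case False
          then show ?thesis using that by auto
        qed
        then show ?thesis unfolding capped_def by auto
      qed
      have 2: "card {e \<in> comps {1..n} m. ?R e = f \<and> (Q e \<and> (\<forall>j\<in>{r + 1..n}. e j < j))}
          = card {e \<in> comps {r + 1..n} (m - u). Q e \<and> (\<forall>j\<in>{r + 1..n}. e j < j)}"
      proof -
        have "(Q e \<and> (\<forall>j\<in>{r + 1..n}. e j < j)) \<longleftrightarrow> (Q e' \<and> (\<forall>j\<in>{r + 1..n}. e' j < j))"
          if "\<And>i. i \<in> {1..n} - {1..r} \<Longrightarrow> e i = e' i" for e e'
          using Q[of e e'] that unfolding tail by auto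
        from card_prescribed_on[where I = "{1..n}" and M = m and T = "{1..r}" and v = f and s = u
            and Q = "\<lambda>e. Q e \<and> (\<forall>j\<in>{r + 1..n}. e j < j)", OF _ _ fu this] show ?thesis
          using r um unfolding tail by simp
      qed
      have 3: "{e \<in> comps {r + 1..n} (m - u). Q e \<and> (\<forall>j\<in>{r + 1..n}. e j < j)}
          = {e \<in> capped {r + 1..n} (m - u). Q e}"
        unfolding capped_def by blast
      show ?thesis unfolding 1 2 3 ..
    qed
    note tail_count = this
    have "card {e \<in> ?A. ?R e = f \<and> P e} = card {e \<in> capped {r + 1..n} (m - u). P e}"
      by (rule tail_count[of P], rule P, simp)
    moreover have "card {e \<in> ?A. ?R e = f \<and> True} = card {e \<in> capped {r + 1..n} (m - u). True}"
      by (rule tail_count) simp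
    ultimately show ?thesis using x[OF um(2,3)] by simp
  qed
  then have "(\<Sum>f\<in>?R ` ?A. real (card {e \<in> ?A. ?R e = f \<and> P e}))
      \<le> (\<Sum>f\<in>?R ` ?A. x * real (card {e \<in> ?A. ?R e = f \<and> True}))"
    by (rule sum_mono)
  then show ?thesis
    using fibres[of P] fibres[of "\<lambda>_. True"] by (simp add: sum_distrib_left)
qed

lemma good_blocks_cong:
  assumes "r + N * L \<le> n" "\<And>i. i \<in> {r + 1..n} \<Longrightarrow> e i = e' i"
  shows "good_blocks k c r L N e = good_blocks k c r L N e'"
proof -
  have "restrict_zero (block r L b) e = restrict_zero (block r L b) e'" if "b < N" for b
  proof
    fix i
    show "restrict_zero (block r L b) e i = restrict_zero (block r L b) e' i"
      using block_subset[OF that assms(1)] assms(2)[of i] by (simp add: restrict_zero_def subset_iff)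
  qed
  then show ?thesis unfolding good_blocks_def by (intro arg_cong[of _ _ card]) auto
qed

lemma good_blocks_code_avoids:
  assumes "\<sigma> permutes {1..n}" "\<pi> permutes {1..k}" "\<not> contains_consecutive k \<pi> n \<sigma>"
    and "k \<le> L" "r + N * L \<le> n"
  shows "good_blocks k (code k \<pi>) r L N (code n \<sigma>) = 0"
proof (rule ccontr)
  assume "good_blocks k (code k \<pi>) r L N (code n \<sigma>) \<noteq> 0"
  then obtain p where "p + k \<le> n" "\<And>v. v \<in> {1..k} \<Longrightarrow> code n \<sigma> (p + v) = code k \<pi> v"
    using pattern_in_good_block[OF _ assms(4,5)] by blast
  then show False using occurs_if_window_code assms by blast
qed

text \<open>
  By \<open>r (r - 1) \<le> m\<close> the first \<open>r\<close> entries carry at most half of the inversions, whence only \<open>M\<close> with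
  \<open>m \<le> 2 M\<close> is relevant for \<open>\<eta>\<close>.
\<close>

lemma prob_avoids_second_moment:
  assumes m: "m \<le> n choose 2" and \<pi>: "\<pi> permutes {1..k}"
    and r: "r < n" "r * (r - 1) \<le> m"
    and \<delta>: "\<delta> < 1" "\<And>M. M \<le> m \<Longrightarrow> fill (n - r) M < 1" "\<And>M. M \<le> m \<Longrightarrow> cap_loss r (n - r) M \<le> \<delta>"
    and \<eta>: "\<And>M. M \<le> m \<Longrightarrow> m \<le> 2 * M \<Longrightarrow>
       real (card {e \<in> comps {r + 1..n} M. good_blocks k (code k \<pi>) r k ((n - r) div k) e = 0})
          \<le> \<eta> * real (ncomps (n - r) M)"
  shows "1 - prob_contains k \<pi> n m \<le> \<eta> / (1 - \<delta>)"
proof -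
  let ?N = "(n - r) div k"
  let ?P = "\<lambda>e. good_blocks k (code k \<pi>) r k ?N e = 0"
  have rN: "r + ?N * k \<le> n"
  proof -
    have "?N * k \<le> n - r" by simp
    then show ?thesis using r by linarith
  qed
  have "real (card {e \<in> capped {1..n} m. ?P e}) \<le> \<eta> / (1 - \<delta>) * real (card (capped {1..n} m))"
  proof (rule capped_fraction_by_prefix)
    show "r \<le> n" using r by simp
    show "?P e \<longleftrightarrow> ?P e'" if "\<And>i. i \<in> {r + 1..n} \<Longrightarrow> e i = e' i" for e e'
      using good_blocks_cong[OF rN that] by simp
    fix M assume M: "M \<le> m" "m \<le> M + (\<Sum>j=1..r. j - 1)"
    have "2 * (\<Sum>j=1..r. j - 1) = r * (r - 1)"
      by (induction r) (auto simp: algebra_simps)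
    then have M2: "m \<le> 2 * M" using M r by linarith
    have \<eta>0: "0 \<le> \<eta>"
    proof -
      have "0 \<le> \<eta> * real (ncomps (n - r) M)" using \<eta>[OF M(1) M2] by (rule order_trans[rotated]) simp
      then show ?thesis using ncomps_pos[of "n - r" M] r by (simp add: zero_le_mult_iff)
    qed
    have "real (card {e \<in> capped {r + 1..n} M. ?P e})
       \<le> \<eta> / (1 - cap_loss r (n - r) M) * real (card (capped {r + 1..n} M))"
      by (rule capped_fraction_le[OF r(1) \<delta>(2)[OF M(1)] _ \<eta>[OF M(1) M2]]) (use \<delta> M(1) in fastforce)
    also have "\<dots> \<le> \<eta> / (1 - \<delta>) * real (card (capped {r + 1..n} M))"
      using \<delta>(1) \<delta>(3)[OF M(1)] \<eta>0 by (intro mult_right_mono divide_left_mono) auto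
    finally show "real (card {e \<in> capped {r + 1..n} M. ?P e}) \<le> \<eta> / (1 - \<delta>) * real (card (capped {r + 1..n} M))" .
  qed
  moreover have "real (card (capped {1..n} m)) > 0"
    using capped_nonempty[OF m] finite_capped[of "{1..n}" m] by (simp add: card_gt_0_iff)
  ultimately have "real (card {e \<in> capped {1..n} m. ?P e}) / real (card (capped {1..n} m)) \<le> \<eta> / (1 - \<delta>)"
    by (subst pos_divide_le_eq)
  moreover have "1 - prob_contains k \<pi> n m
      \<le> real (card {e \<in> capped {1..n} m. ?P e}) / real (card (capped {1..n} m))"
    using good_blocks_code_avoids[OF _ \<pi> _ order_refl rN]
    by (intro prob_avoids_le[OF m]) (auto simp: perms_with_inv_def)
  ultimately show ?thesis by linarith
qed

section \<open>Inclusion-exclusion for the critical window\<close>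

text \<open>
  The proportion of weak compositions without a good block of length \<open>L\<close>, as the alternating sum of the
  binomial moments.
\<close>

definition avoid_fraction :: "nat \<Rightarrow> nat \<Rightarrow> nat \<Rightarrow> nat \<Rightarrow> nat \<Rightarrow> real" where
  "avoid_fraction k s L n m = (\<Sum>j\<le>n div L. (-1) ^ j * (real (n div L choose j) * real (L - k + 1) ^ j *
     (if j * s \<le> m then real (ncomps (n - j * L) (m - j * s)) / real (ncomps n m) else 0)))"

lemma card_no_good_block_eq:
  assumes c: "c \<in> comps {1..k} s" "s > 0" and L: "k \<le> L" and n: "n > 0"
  shows "real (card {e \<in> comps {1..n} m. good_blocks k c 0 L (n div L) e = 0})
       = avoid_fraction k s L n m * real (ncomps n m)"
proof -
  let ?N = "n div L" and ?X = "good_blocks k c 0 L (n div L)"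
  have D: "real (ncomps n m) > 0" using ncomps_pos[OF n] by simp
  have "?X e \<le> ?N" for e
  proof -
    have "?X e \<le> card {..<?N}" unfolding good_blocks_def by (intro card_mono) auto
    then show ?thesis by simp
  qed
  then have "real (card {e \<in> comps {1..n} m. ?X e = 0})
      = (\<Sum>j\<le>?N. (-1) ^ j * real (\<Sum>e\<in>comps {1..n} m. ?X e choose j))"
    by (intro card_zero_inclusion_exclusion finite_comps) auto
  also have "\<dots> = (\<Sum>j\<le>?N. ((-1) ^ j * (real (?N choose j) * real (L - k + 1) ^ j *
     (if j * s \<le> m then real (ncomps (n - j * L) (m - j * s)) / real (ncomps n m) else 0))) * real (ncomps n m))"
  proof (rule sum.cong[OF refl])
    fix j
    have "(\<Sum>e\<in>comps {1..n} m. ?X e choose j) =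
       (?N choose j) * (L - k + 1) ^ j * (if j * s \<le> m then ncomps (n - j * L) (m - j * s) else 0)"
      using sum_choose_good_blocks[OF c L, where r = 0 and N = ?N and n = n and M = m and j = j] by simp
    then show "(-1) ^ j * real (\<Sum>e\<in>comps {1..n} m. ?X e choose j)
       = ((-1) ^ j * (real (?N choose j) * real (L - k + 1) ^ j *
          (if j * s \<le> m then real (ncomps (n - j * L) (m - j * s)) / real (ncomps n m) else 0))) * real (ncomps n m)"
      using D by (simp only: of_nat_mult of_nat_power) simp
  qed
  finally show ?thesis unfolding avoid_fraction_def sum_distrib_right .
qed

lemma prob_avoids_le_avoid_fraction:
  assumes m: "m \<le> n choose 2" and n: "0 < n" and \<pi>: "\<pi> permutes {1..k}" and s: "inv_count k \<pi> > 0"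
    and L: "k \<le> L" and q: "fill n m < 1" "cap_loss 0 n m < 1"
  shows "1 - prob_contains k \<pi> n m \<le> avoid_fraction k (inv_count k \<pi>) L n m / (1 - cap_loss 0 n m)"
proof -
  let ?P = "\<lambda>e. good_blocks k (code k \<pi>) 0 L (n div L) e = 0"
  have "1 - prob_contains k \<pi> n m
      \<le> real (card {e \<in> capped {1..n} m. ?P e}) / real (card (capped {1..n} m))"
    using good_blocks_code_avoids[OF _ \<pi> _ L, of _ n 0 "n div L"]
    by (intro prob_avoids_le[OF m]) (auto simp: perms_with_inv_def)
  also have "\<dots> \<le> avoid_fraction k (inv_count k \<pi>) L n m / (1 - cap_loss 0 n m)"
    by (rule capped_fraction_le_unconditioned[OF n q]) (use card_no_good_block_eq[OF code_in_comps s L n] in simp)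
  finally show ?thesis .
qed

text \<open>
  Suppose that some window dominates \<open>c\<close>, although no block is good. Either the window is not contained
  in a block; there are about \<open>(n/L) k + L\<close> such windows, each dominating with probability at most \<open>q\<^sup>s\<close>.
  Or the block of the window has an entry that exceeds the shifted copy of \<open>c\<close>, which raises the dominated
  sum to \<open>s + 1\<close>, and there are at most \<open>n L\<close> pairs of a window and such an entry.
\<close>

lemma card_dominating_without_good_block:
  assumes c: "c \<in> comps {1..k} s" "s > 0" and L: "k \<le> L" and n: "n > 0"
  shows "real (card {e \<in> comps {1..n} m. good_blocks k c 0 L (n div L) e = 0 \<and>
           (\<exists>p. p + k \<le> n \<and> (\<forall>i. shift c p i \<le> e i))})
     \<le> (real ((n div L + 1) * k + L) * fill n m ^ s + real (n * L) * fill n m ^ (s + 1)) * real (ncomps n m)"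
proof -
  let ?q = "fill n m" and ?N = "n div L"
  have k: "k > 0" using c by (cases k) (auto simp: comps_def)
  have L0: "L > 0" using k L by simp
  have q0: "0 \<le> ?q" using fill_bounds(1)[OF n] .
  \<comment> \<open>The windows that are not contained in a block, and the windows inside a block together with a position of this block.\<close>
  define J where "J = {p. p + k \<le> n \<and> \<not> (p div L < ?N \<and> p mod L + k \<le> L)}"
  define K where "K = {(p, l). p + k \<le> n \<and> p div L < ?N \<and> p mod L + k \<le> L \<and> l \<in> block 0 L (p div L)}"
  define w where "w = (\<lambda>(p, l) x. shift c p x + (if x = l then 1 else 0))"
  have Jsub: "J \<subseteq> (\<lambda>(b, i). b * L + i) ` ({..?N} \<times> {L - k<..<L}) \<union> {?N * L..<n}"
  proof
    fix p assume p: "p \<in> J"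
    show "p \<in> (\<lambda>(b, i). b * L + i) ` ({..?N} \<times> {L - k<..<L}) \<union> {?N * L..<n}"
    proof (cases "p div L < ?N")
      case True
      then have "p mod L \<in> {L - k<..<L}" using p L0 L by (auto simp: J_def)
      moreover have "p = p div L * L + p mod L" by simp
      ultimately have "p \<in> (\<lambda>(b, i). b * L + i) ` ({..?N} \<times> {L - k<..<L})"
        using True by (intro image_eqI[of _ _ "(p div L, p mod L)"]) auto
      then show ?thesis by blast
    next
      case False
      then have "?N * L \<le> p div L * L" by (intro mult_le_mono1) simp
      also have "\<dots> \<le> p" by simp
      finally show ?thesis using p k by (auto simp: J_def)
    qed
  qed
  have fJ: "finite J" by (rule finite_subset[OF Jsub]) auto
  have cJ: "card J \<le> (?N + 1) * k + L"
  proof -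
    have "card J \<le> card ((\<lambda>(b, i). b * L + i) ` ({..?N} \<times> {L - k<..<L}) \<union> {?N * L..<n})"
      by (rule card_mono[OF _ Jsub]) auto
    also have "\<dots> \<le> card ((\<lambda>(b, i). b * L + i) ` ({..?N} \<times> {L - k<..<L})) + card {?N * L..<n}"
      by (rule card_Un_le)
    also have "card ((\<lambda>(b, i). b * L + i) ` ({..?N} \<times> {L - k<..<L})) \<le> card ({..?N} \<times> {L - k<..<L})"
      by (rule card_image_le) auto
    also have "\<dots> = (?N + 1) * (L - Suc (L - k))" by (simp add: card_cartesian_product)
    also have "\<dots> \<le> (?N + 1) * k" using L by (intro mult_le_mono2) simp
    also have "card {?N * L..<n} \<le> L"
      using mod_less_divisor[OF L0, of n] by (simp add: minus_div_mult_eq_mod)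
    finally show ?thesis by simp
  qed
  have Ksub: "K \<subseteq> (SIGMA p:{..<n}. block 0 L (p div L))" using k by (auto simp: K_def)
  have fK: "finite K" by (rule finite_subset[OF Ksub]) (auto simp: block_def)
  have cK: "card K \<le> n * L"
  proof -
    have "card K \<le> card (SIGMA p:{..<n}. block 0 L (p div L))"
      by (rule card_mono[OF _ Ksub]) (auto simp: block_def)
    also have "\<dots> = n * L" by (subst card_SigmaI) (auto simp: block_def)
    finally show ?thesis .
  qed
  have wJ: "shift c p \<in> comps {1..n} s" if "p \<in> J" for p
    using that by (intro shift_in_comps[OF c(1)]) (auto simp: J_def)
  have wK: "w x \<in> comps {1..n} (s + 1)" if "x \<in> K" for x
  proof -
    obtain p l where x: "x = (p, l)" by (cases x)
    have 1: "shift c p \<in> comps {1..n} s"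
      using that unfolding x by (intro shift_in_comps[OF c(1)]) (auto simp: K_def)
    have "block 0 L (p div L) \<subseteq> {0 + 1..n}"
      using that unfolding x K_def by (intro block_subset[of _ ?N]) auto
    then have "l \<in> {1..n}" using that unfolding x K_def by auto
    then show ?thesis using 1 unfolding x w_def comps_def by (auto simp: sum.distrib)
  qed
  have sub: "{e \<in> comps {1..n} m. good_blocks k c 0 L ?N e = 0 \<and> (\<exists>p. p + k \<le> n \<and> (\<forall>i. shift c p i \<le> e i))}
     \<subseteq> {e \<in> comps {1..n} m. \<exists>p\<in>J. \<forall>i. shift c p i \<le> e i} \<union> {e \<in> comps {1..n} m. \<exists>x\<in>K. \<forall>i. w x i \<le> e i}"
  proof
    fix e assume "e \<in> {e \<in> comps {1..n} m. good_blocks k c 0 L ?N e = 0 \<and> (\<exists>p. p + k \<le> n \<and> (\<forall>i. shift c p i \<le> e i))}"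
    then obtain p where e: "e \<in> comps {1..n} m" "good_blocks k c 0 L ?N e = 0"
      and p: "p + k \<le> n" "\<And>i. shift c p i \<le> e i" by auto
    show "e \<in> {e \<in> comps {1..n} m. \<exists>p\<in>J. \<forall>i. shift c p i \<le> e i} \<union> {e \<in> comps {1..n} m. \<exists>x\<in>K. \<forall>i. w x i \<le> e i}"
    proof (cases "p \<in> J")
      case True
      then show ?thesis using e p by blast
    next
      case False
      define b where "b = p div L"
      have inside: "b < ?N" "p mod L + k \<le> L" using False p by (auto simp: J_def b_def)
      have pb: "p = 0 + b * L + p mod L" by (simp add: b_def)
      have "restrict_zero (block 0 L b) e \<noteq> shift c p"
      proof
        assume "restrict_zero (block 0 L b) e = shift c p"
        also have "\<dots> \<in> good_words k c 0 L b"
          unfolding good_words_def by (subst pb, rule imageI) (use inside in simp)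
        finally have "b \<in> {b \<in> {..<?N}. restrict_zero (block 0 L b) e \<in> good_words k c 0 L b}"
          using inside by simp
        then have "card {b \<in> {..<?N}. restrict_zero (block 0 L b) e \<in> good_words k c 0 L b} \<noteq> 0"
          by (subst card_0_eq) auto
        then show False using e unfolding good_blocks_def by blast
      qed
      then obtain l where l: "restrict_zero (block 0 L b) e l \<noteq> shift c p l" by (auto simp: fun_eq_iff)
      have "shift c p \<in> comps (block 0 L b) s"
        using inside pb by (intro shift_in_comps[OF c(1)]) (auto simp: block_def)
      then have "l \<in> block 0 L b"
        using l by (auto simp: restrict_zero_def comps_def split: if_splits)
      moreover from this l have "shift c p l + 1 \<le> e l"
        using p(2)[of l] by (simp add: restrict_zero_def)
      ultimately have "(p, l) \<in> K" "\<forall>i. w (p, l) i \<le> e i"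
        using p inside by (auto simp: K_def w_def b_def)
      then show ?thesis using e by blast
    qed
  qed
  have "card {e \<in> comps {1..n} m. good_blocks k c 0 L ?N e = 0 \<and> (\<exists>p. p + k \<le> n \<and> (\<forall>i. shift c p i \<le> e i))}
    \<le> card ({e \<in> comps {1..n} m. \<exists>p\<in>J. \<forall>i. shift c p i \<le> e i} \<union> {e \<in> comps {1..n} m. \<exists>x\<in>K. \<forall>i. w x i \<le> e i})"
    by (rule card_mono[OF _ sub]) (auto intro: finite_subset[OF _ finite_comps[of "{1..n}" m]])
  also have "\<dots> \<le> card {e \<in> comps {1..n} m. \<exists>p\<in>J. \<forall>i. shift c p i \<le> e i} + card {e \<in> comps {1..n} m. \<exists>x\<in>K. \<forall>i. w x i \<le> e i}"
    by (rule card_Un_le)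
  finally have "real (card {e \<in> comps {1..n} m. good_blocks k c 0 L ?N e = 0 \<and> (\<exists>p. p + k \<le> n \<and> (\<forall>i. shift c p i \<le> e i))})
    \<le> real (card {e \<in> comps {1..n} m. \<exists>p\<in>J. \<forall>i. shift c p i \<le> e i}) + real (card {e \<in> comps {1..n} m. \<exists>x\<in>K. \<forall>i. w x i \<le> e i})"
    by (simp only: of_nat_le_iff flip: of_nat_add)
  also have "real (card {e \<in> comps {1..n} m. \<exists>p\<in>J. \<forall>i. shift c p i \<le> e i}) \<le> (\<Sum>p\<in>J. ?q ^ s) * real (ncomps n m)"
    using card_dominating_some_le[of "{1..n}" J "shift c" "\<lambda>_. s" m] fJ wJ n by simp
  also have "(\<Sum>p\<in>J. ?q ^ s) * real (ncomps n m) \<le> (real ((?N + 1) * k + L) * ?q ^ s) * real (ncomps n m)"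
    using cJ q0 by (intro mult_right_mono) (auto intro!: mult_right_mono simp del: of_nat_add of_nat_mult)
  also have "real (card {e \<in> comps {1..n} m. \<exists>x\<in>K. \<forall>i. w x i \<le> e i}) \<le> (\<Sum>x\<in>K. ?q ^ (s + 1)) * real (ncomps n m)"
    using card_dominating_some_le[of "{1..n}" K w "\<lambda>_. s + 1" m] fK wK n by simp
  also have "(\<Sum>x\<in>K. ?q ^ (s + 1)) * real (ncomps n m) \<le> (real (n * L) * ?q ^ (s + 1)) * real (ncomps n m)"
    using cK q0 by (intro mult_right_mono) (auto intro!: mult_right_mono simp del: of_nat_add of_nat_mult)
  finally show ?thesis by (simp only: distrib_right)
qed

lemma prob_contains_le_avoid_fraction:
  assumes m: "m \<le> n choose 2" and n: "0 < n" and \<pi>: "\<pi> permutes {1..k}" and s: "inv_count k \<pi> = s" "s > 0"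
    and L: "k \<le> L" and q: "fill n m < 1" "cap_loss 0 n m < 1"
  shows "prob_contains k \<pi> n m \<le>
    (1 - avoid_fraction k s L n m
       + (real ((n div L + 1) * k + L) * fill n m ^ s + real (n * L) * fill n m ^ (s + 1))) / (1 - cap_loss 0 n m)"
proof -
  let ?c = "code k \<pi>" and ?E = "comps {1..n} m"
  let ?X = "good_blocks k ?c 0 L (n div L)"
  let ?P = "\<lambda>e. \<exists>p. p + k \<le> n \<and> (\<forall>i. shift ?c p i \<le> e i)"
  have c: "?c \<in> comps {1..k} s" using code_in_comps[of k \<pi>] s by simp
  have fE: "finite ?E" by (rule finite_comps) simp
  have "card {e \<in> ?E. ?P e} \<le> card ({e \<in> ?E. ?X e \<noteq> 0} \<union> {e \<in> ?E. ?X e = 0 \<and> ?P e})"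
    using fE by (intro card_mono) auto
  also have "\<dots> \<le> card {e \<in> ?E. ?X e \<noteq> 0} + card {e \<in> ?E. ?X e = 0 \<and> ?P e}"
    by (rule card_Un_le)
  finally have 1: "card {e \<in> ?E. ?P e} \<le> card {e \<in> ?E. ?X e \<noteq> 0} + card {e \<in> ?E. ?X e = 0 \<and> ?P e}" .
  have "card {e \<in> ?E. ?X e \<noteq> 0} + card {e \<in> ?E. ?X e = 0} = card ?E"
    using fE by (subst card_Un_disjoint[symmetric]) (auto intro: arg_cong[of _ _ card])
  then have "real (card {e \<in> ?E. ?X e \<noteq> 0}) + real (card {e \<in> ?E. ?X e = 0}) = real (ncomps n m)"
    using card_comps[of "{1..n}" m] by simp
  then have "real (card {e \<in> ?E. ?X e \<noteq> 0}) = (1 - avoid_fraction k s L n m) * real (ncomps n m)"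
    using card_no_good_block_eq[OF c s(2) L n, of m] by (simp add: algebra_simps)
  moreover have "real (card {e \<in> ?E. ?P e}) \<le> real (card {e \<in> ?E. ?X e \<noteq> 0}) + real (card {e \<in> ?E. ?X e = 0 \<and> ?P e})"
    using 1 by (simp only: of_nat_le_iff flip: of_nat_add)
  ultimately have "real (card {e \<in> ?E. ?P e}) \<le> (1 - avoid_fraction k s L n m
       + (real ((n div L + 1) * k + L) * fill n m ^ s + real (n * L) * fill n m ^ (s + 1))) * real (ncomps n m)"
    using card_dominating_without_good_block[OF c s(2) L n, of m] by (simp only: distrib_right)
  from capped_fraction_le_unconditioned[OF n q this] show ?thesis
    by (intro order_trans[OF prob_contains_le[OF m, of k \<pi> ?P]]) (use code_dominates_if_contains in blast)+
qed

section \<open>Limits for few inversions\<close>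

lemma fill_le_ratio: "n > 0 \<Longrightarrow> fill n m \<le> real m / real n"
  by (cases "m = 0") (auto simp: fill_def intro!: divide_left_mono)

lemma fill_mono:
  assumes "n > 0" "M \<le> m"
  shows "fill n M \<le> fill n m"
proof (cases "M = 0")
  case True
  then show ?thesis using fill_bounds(1)[OF assms(1), of m] by (simp add: fill_def)
next
  case False
  have "real M * real (n + m - 1) \<le> real m * real (n + M - 1)"
  proof -
    obtain d where d: "m = M + d" using assms le_Suc_ex by blast
    obtain p where p: "n = Suc p" using assms by (cases n) auto
    show ?thesis by (simp add: d p algebra_simps)
  qed
  then show ?thesis using False assms by (simp add: fill_def field_simps)
qed

lemma sparse_limits:
  fixes m :: "nat \<Rightarrow> nat"
  assumes "(\<lambda>n. real (m n) / real n) \<longlonglongrightarrow> 0"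
  shows "(\<lambda>n. fill n (m n)) \<longlonglongrightarrow> 0" "(\<lambda>n. cap_loss 0 n (m n)) \<longlonglongrightarrow> 0"
    "eventually (\<lambda>n. fill n (m n) < 1 \<and> cap_loss 0 n (m n) < 1) sequentially"
proof -
  show q: "(\<lambda>n. fill n (m n)) \<longlonglongrightarrow> 0"
  proof (rule tendsto_sandwich[OF _ _ tendsto_const assms])
    show "\<forall>\<^sub>F n in sequentially. 0 \<le> fill n (m n)"
      using eventually_gt_at_top[of 0] by eventually_elim (rule fill_bounds)
    show "\<forall>\<^sub>F n in sequentially. fill n (m n) \<le> real (m n) / real n"
      using eventually_gt_at_top[of 0] by eventually_elim (rule fill_le_ratio)
  qed
  have "(\<lambda>n. fill n (m n) / (1 - fill n (m n))) \<longlonglongrightarrow> 0 / (1 - 0)"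
    by (intro tendsto_intros q) simp
  then show c: "(\<lambda>n. cap_loss 0 n (m n)) \<longlonglongrightarrow> 0" by (simp add: cap_loss_def)
  show "eventually (\<lambda>n. fill n (m n) < 1 \<and> cap_loss 0 n (m n) < 1) sequentially"
    using order_tendstoD(2)[OF q, of 1] order_tendstoD(2)[OF c, of 1] by (simp add: eventually_conj_iff)
qed

lemma prob_contains_bounds: "0 \<le> prob_contains k \<pi> n m" "prob_contains k \<pi> n m \<le> 1"
  by (auto simp: prob_contains_def)

text \<open>
  The expected number of occurrences is about \<open>n (m/n)\<^sup>s\<close> for sparse codes, whence the threshold
  \<open>n\<^sup>1\<^sup>-\<^sup>1\<^sup>/\<^sup>s\<close>; for dense codes it is about \<open>n (n/m)\<^sup>k\<close>, whence \<open>n\<^sup>1\<^sup>+\<^sup>1\<^sup>/\<^sup>k\<close> in the next lemma.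
\<close>

lemma lower_threshold_power:
  assumes "n > 0" "s > 0"
  shows "real n * (x / real n) ^ s = (x / real n powr (1 - 1 / real s)) ^ s"
proof -
  have "(real n powr (1 - 1 / real s)) ^ s = real n ^ s / real n"
  proof -
    have "(real n powr (1 - 1 / real s)) ^ s = real n powr ((1 - 1 / real s) * real s)"
      using assms by (simp add: powr_powr flip: powr_realpow)
    also have "(1 - 1 / real s) * real s = real s - 1" using assms by (simp add: field_simps)
    also have "real n powr (real s - 1) = real n ^ s / real n"
      using assms by (simp add: powr_diff powr_realpow)
    finally show ?thesis .
  qed
  then show ?thesis using assms by (simp add: power_divide)
qed

lemma upper_threshold_power:
  assumes "n > 0" "k > 0"
  shows "(x / real n) ^ k / real n = (x / real n powr (1 + 1 / real k)) ^ k"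
proof -
  have "(real n powr (1 + 1 / real k)) ^ k = real n powr ((1 + 1 / real k) * real k)"
    using assms by (simp add: powr_powr flip: powr_realpow)
  also have "(1 + 1 / real k) * real k = real k + 1" using assms by (simp add: field_simps)
  also have "real n powr (real k + 1) = real n ^ k * real n"
    using assms by (simp add: powr_add powr_realpow)
  finally show ?thesis using assms by (simp add: power_divide)
qed

lemma ratio_tendsto_0:
  fixes m :: "nat \<Rightarrow> nat"
  assumes "(\<lambda>n. real (m n) / real n powr (1 - 1 / real s)) \<longlonglongrightarrow> a" "s > 0"
  shows "(\<lambda>n. real (m n) / real n) \<longlonglongrightarrow> 0"
proof -
  have "(\<lambda>n. real n powr (- (1 / real s))) \<longlonglongrightarrow> 0"
    using assms(2) by (intro tendsto_neg_powr filterlim_real_sequentially) simp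
  from tendsto_mult[OF assms(1) this]
  have "(\<lambda>n. real (m n) / real n powr (1 - 1 / real s) * real n powr (- (1 / real s))) \<longlonglongrightarrow> 0" by simp
  moreover have "\<forall>\<^sub>F n in sequentially.
      real (m n) / real n powr (1 - 1 / real s) * real n powr (- (1 / real s)) = real (m n) / real n"
    using eventually_gt_at_top[of 0]
  proof eventually_elim
    case (elim n)
    have "real n powr (1 - 1 / real s) = real n * real n powr (- (1 / real s))"
      using elim by (simp add: powr_diff powr_minus field_simps)
    then show ?case using elim by simp
  qed
  ultimately show ?thesis by (simp cong: tendsto_cong)
qed

lemma limit_too_few_inversions:
  fixes m :: "nat \<Rightarrow> nat"
  assumes m: "\<And>n. m n \<le> n choose 2" and s: "inv_count k \<pi> = s" "s > 0" and k: "k \<ge> 1"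
    and o: "(\<lambda>n. real (m n)) \<in> o(\<lambda>n. real n powr (1 - 1 / real s))"
  shows "(\<lambda>n. prob_contains k \<pi> n (m n)) \<longlonglongrightarrow> 0"
proof -
  let ?g = "\<lambda>n. real (m n) / real n powr (1 - 1 / real s)"
  have g: "?g \<longlonglongrightarrow> 0" using o by (rule smalloD_tendsto)
  note sp = sparse_limits[OF ratio_tendsto_0[OF g s(2)]]
  have "(\<lambda>n. ?g n ^ s / (1 - cap_loss 0 n (m n))) \<longlonglongrightarrow> 0 ^ s / (1 - 0)"
    by (intro tendsto_intros g sp) simp
  then have lim: "(\<lambda>n. ?g n ^ s / (1 - cap_loss 0 n (m n))) \<longlonglongrightarrow> 0"
    using s(2) by (simp add: zero_power)
  show ?thesis
  proof (rule tendsto_sandwich[OF _ _ tendsto_const lim])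
    show "\<forall>\<^sub>F n in sequentially. 0 \<le> prob_contains k \<pi> n (m n)"
      by (simp add: prob_contains_bounds)
    show "\<forall>\<^sub>F n in sequentially. prob_contains k \<pi> n (m n) \<le> ?g n ^ s / (1 - cap_loss 0 n (m n))"
      using eventually_gt_at_top[of 0] sp(3)
    proof eventually_elim
      case (elim n)
      have "real n * fill n (m n) ^ s \<le> real n * (real (m n) / real n) ^ s"
        using fill_le_ratio fill_bounds(1) elim by (intro mult_left_mono power_mono) auto
      also have "\<dots> = ?g n ^ s" using elim s by (intro lower_threshold_power)
      finally show ?case
        using prob_contains_first_moment[OF m, of n k \<pi>] elim k s
        by (meson diff_gt_0_iff_gt divide_right_mono less_imp_le order_trans)
    qed
  qed
qed

lemma limit_single_inversion:
  fixes m :: "nat \<Rightarrow> nat"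
  assumes m: "\<And>n. m n \<le> n choose 2" and \<pi>: "\<pi> permutes {1..k}" and s: "inv_count k \<pi> = 1"
    and lim: "(\<lambda>n. real (m n)) \<longlonglongrightarrow> a" and a: "a > 0"
  shows "(\<lambda>n. prob_contains k \<pi> n (m n)) \<longlonglongrightarrow> 1"
proof -
  have inv: "(\<lambda>n. 1 / real n) \<longlonglongrightarrow> 0" by (rule lim_1_over_n)
  from tendsto_mult[OF lim inv] have mn: "(\<lambda>n. real (m n) / real n) \<longlonglongrightarrow> 0" by simp
  note sp = sparse_limits[OF mn]
  let ?U = "\<lambda>n. (2 * real k * fill n (m n) + real k * (real (m n) * (real (m n) / real n))) / (1 - cap_loss 0 n (m n))"
  have "?U \<longlonglongrightarrow> (2 * real k * 0 + real k * (a * 0)) / (1 - 0)"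
    by (intro tendsto_intros sp lim mn) simp
  then have U: "(\<lambda>n. 1 - ?U n) \<longlonglongrightarrow> 1" by (auto intro: tendsto_eq_intros)
  show ?thesis
  proof (rule tendsto_sandwich[OF _ _ U tendsto_const])
    show "\<forall>\<^sub>F n in sequentially. prob_contains k \<pi> n (m n) \<le> 1"
      by (simp add: prob_contains_bounds)
    show "\<forall>\<^sub>F n in sequentially. 1 - ?U n \<le> prob_contains k \<pi> n (m n)"
      using eventually_gt_at_top[of 0] sp(3) order_tendstoD(1)[OF lim a]
    proof eventually_elim
      case (elim n)
      have "fill n (m n) ^ 2 \<le> (real (m n) / real n) ^ 2"
        using fill_le_ratio fill_bounds(1) elim by (intro power_mono) auto
      then have "real n * real k * fill n (m n) ^ 2 \<le> real n * real k * (real (m n) / real n) ^ 2"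
        by (intro mult_left_mono) auto
      also have "\<dots> = real k * (real (m n) * (real (m n) / real n))"
        using elim by (simp add: power2_eq_square)
      finally have "2 * real k * fill n (m n) + real n * real k * fill n (m n) ^ 2
          \<le> 2 * real k * fill n (m n) + real k * (real (m n) * (real (m n) / real n))" by simp
      then have "(2 * real k * fill n (m n) + real n * real k * fill n (m n) ^ 2) / (1 - cap_loss 0 n (m n)) \<le> ?U n"
        using elim by (intro divide_right_mono) auto
      moreover have "1 - prob_contains k \<pi> n (m n)
          \<le> (2 * real k * fill n (m n) + real n * real k * fill n (m n) ^ 2) / (1 - cap_loss 0 n (m n))"
        using prob_avoids_single_inversion[OF m _ _ \<pi> s, of n] elim by auto
      ultimately show ?case by linarith
    qed
  qed
qed

section \<open>The limit for many inversions\<close>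

lemma one_plus_power_le: "0 \<le> x \<Longrightarrow> (1 + x) ^ p \<le> 2 ^ p * (1 + x ^ p)" for x :: real
proof -
  assume x: "0 \<le> x"
  have "(1 + x) ^ p \<le> (2 * max 1 x) ^ p" using x by (intro power_mono) auto
  also have "\<dots> = 2 ^ p * (max 1 x) ^ p" by (simp add: power_mult_distrib)
  also have "(max 1 x) ^ p \<le> 1 + x ^ p" using x by (auto simp: max_def)
  finally show ?thesis by simp
qed

text \<open>
  For \<open>r \<approx> \<surd>m\<close> the loss is at most \<open>exp (-z \<surd>m) / z\<close>, where \<open>z\<close> is of order \<open>n/(n+m)\<close>. Estimating the
  exponential by a fourth power suffices: if \<open>m\<close> tends to infinity and is of smaller order than
  \<open>n\<^sup>3\<^sup>/\<^sup>2\<close>, both terms of the bound vanish.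
\<close>

lemma cap_loss_le:
  assumes n: "n \<ge> 8" and r: "2 * r \<le> n" "real m \<le> (real r + 1)\<^sup>2" and m: "m > 0"
  shows "fill (n - r) m < 1"
    and "cap_loss r (n - r) m \<le> 256 * 4 ^ 5 * 2 ^ 5 * (1 / (real m)\<^sup>2 + real m ^ 3 / real n ^ 5)"
proof -
  define q where "q = fill (n - r) m"
  define z where "z = real n / (4 * (real n + real m))"
  have z: "0 < z" "z \<le> 1" using n by (auto simp: z_def)
  have q1: "q \<le> 1 - z"
  proof -
    have d: "real (n - r + m - 1) > 0" using n r by simp
    have "1 - q = real (n - r - 1) / real (n - r + m - 1)"
      using n r d by (simp add: q_def fill_def field_simps of_nat_diff)
    also have "\<dots> \<ge> (real n / 4) / (real n + real m)"
      using n r d by (intro frac_le) auto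
    finally show ?thesis by (simp add: z_def)
  qed
  show "fill (n - r) m < 1" using q1 z by (simp add: q_def)
  have q0: "0 \<le> q" using n r by (simp add: q_def fill_bounds)
  have m0: "real m > 0" using m by simp
  have "cap_loss r (n - r) m = q ^ (r + 1) / (1 - q)" by (simp add: cap_loss_def q_def)
  also have "\<dots> \<le> (1 - z) ^ (r + 1) / z"
    using q0 q1 z by (intro frac_le power_mono) auto
  also have "(1 - z) ^ (r + 1) \<le> exp (- (z * real (r + 1)))"
  proof -
    have "(1 - z) ^ (r + 1) \<le> exp (- z) ^ (r + 1)"
      using z exp_ge_add_one_self[of "- z"] by (intro power_mono) auto
    also have "\<dots> = exp (real (r + 1) * (- z))" by (rule exp_of_nat_mult[symmetric])
    finally show ?thesis by (simp add: mult.commute)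
  qed
  also have "exp (- (z * real (r + 1))) \<le> 256 / (z * real (r + 1)) ^ 4"
  proof -
    define y where "y = z * real (r + 1)"
    have y: "y > 0" using z by (simp add: y_def)
    have "(y / 4) ^ 4 \<le> (1 + y / real 4) ^ 4" using y by (intro power_mono) auto
    also have "\<dots> \<le> exp y" using y by (intro exp_ge_one_plus_x_over_n_power_n) auto
    finally have "1 / exp y \<le> 1 / (y / 4) ^ 4" using y by (intro divide_left_mono) auto
    then show ?thesis unfolding y_def[symmetric] by (simp add: exp_minus field_simps power_divide)
  qed
  also have "256 / (z * real (r + 1)) ^ 4 \<le> 256 / (z ^ 4 * (real m)\<^sup>2)"
  proof -
    have "(real m)\<^sup>2 \<le> ((real r + 1)\<^sup>2)\<^sup>2" using r by (intro power_mono) auto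
    then have "(real m)\<^sup>2 \<le> real (r + 1) ^ 4" by (simp add: add.commute flip: power_mult)
    then show ?thesis using z m0
      by (intro divide_left_mono) (auto simp: power_mult_distrib intro!: mult_left_mono mult_pos_pos)
  qed
  finally have "cap_loss r (n - r) m \<le> 256 / (z ^ 4 * (real m)\<^sup>2) / z"
    using z by (simp add: divide_right_mono)
  also have "\<dots> = 256 * 4 ^ 5 * ((1 + real m / real n) ^ 5 / (real m)\<^sup>2)"
  proof -
    have inv: "1 / z = 4 * (1 + real m / real n)" using n by (simp add: z_def field_simps)
    have "256 / (z ^ 4 * (real m)\<^sup>2) / z = 256 * (1 / z) ^ 5 / (real m)\<^sup>2"
      by (simp add: power_divide eval_nat_numeral)
    then show ?thesis unfolding inv power_mult_distrib by simp
  qed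
  also have "\<dots> \<le> 256 * 4 ^ 5 * ((2 ^ 5 * (1 + (real m / real n) ^ 5)) / (real m)\<^sup>2)"
    by (intro mult_left_mono divide_right_mono one_plus_power_le) auto
  also have "\<dots> = 256 * 4 ^ 5 * 2 ^ 5 * (1 / (real m)\<^sup>2 + real m ^ 3 / real n ^ 5)"
    using m0 by (simp add: power_divide add_divide_distrib distrib_left eval_nat_numeral)
  finally show "cap_loss r (n - r) m \<le> 256 * 4 ^ 5 * 2 ^ 5 * (1 / (real m)\<^sup>2 + real m ^ 3 / real n ^ 5)" .
qed

lemma two_le_if_inversion: "inv_count k \<pi> > 0 \<Longrightarrow> k \<ge> 2"
proof (rule ccontr)
  assume pos: "inv_count k \<pi> > 0" and "\<not> k \<ge> 2"
  then have "{(i, j). i \<in> {1..k} \<and> j \<in> {1..k} \<and> i < j \<and> \<pi> i > \<pi> j} = {}" by auto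
  then show False using pos unfolding inv_count_def by (metis card.empty less_irrefl)
qed

text \<open>
  The inverse of the expected number of good blocks behaves like the left-hand side. The two terms on the
  right vanish above the lower threshold and below the upper one, respectively.
\<close>

lemma mixed_power_le:
  assumes "n > 0" "m > 0"
  shows "(real n + real m) ^ (k + s) / (real m ^ s * real n ^ (k + 1))
     \<le> 2 ^ (k + s) * (1 / (real n * (real m / real n) ^ s) + (real m / real n) ^ k / real n)"
proof -
  let ?w = "real m / real n"
  have "real n + real m = real n * (1 + ?w)" using assms by (simp add: field_simps)
  then have "(real n + real m) ^ (k + s) = real n ^ (k + s) * (1 + ?w) ^ (k + s)"
    by (simp add: power_mult_distrib)
  also have "\<dots> \<le> real n ^ (k + s) * (2 ^ (k + s) * (1 + ?w ^ (k + s)))"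
    by (intro mult_left_mono one_plus_power_le) auto
  finally have "(real n + real m) ^ (k + s) / (real m ^ s * real n ^ (k + 1))
     \<le> real n ^ (k + s) * (2 ^ (k + s) * (1 + ?w ^ (k + s))) / (real m ^ s * real n ^ (k + 1))"
    by (rule divide_right_mono) simp
  also have "\<dots> = 2 ^ (k + s) * (1 / (real n * ?w ^ s) + ?w ^ k / real n)"
    using assms by (simp add: power_add power_divide field_simps)
  finally show ?thesis .
qed

lemma limit_many_inversions:
  fixes m :: "nat \<Rightarrow> nat"
  assumes m: "\<And>n. m n \<le> n choose 2" and \<pi>: "\<pi> permutes {1..k}" and s: "inv_count k \<pi> = s" "s > 0"
    and lower: "(\<lambda>n. real n powr (1 - 1 / real s)) \<in> o(\<lambda>n. real (m n))"
    and upper: "(\<lambda>n. real (m n)) \<in> o(\<lambda>n. real n powr (1 + 1 / real k))"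
  shows "(\<lambda>n. prob_contains k \<pi> n (m n)) \<longlonglongrightarrow> 1"
proof -
  have k: "k \<ge> 2" using two_le_if_inversion s by blast
  define x where "x = (\<lambda>n. real n powr (1 - 1 / real s) / real (m n))"
  define y where "y = (\<lambda>n. real (m n) / real n powr (1 + 1 / real k))"
  \<comment> \<open>As \<open>k \<ge> 2\<close>, the upper threshold is at most \<open>n\<^sup>3\<^sup>/\<^sup>2\<close>.\<close>
  define v where "v = (\<lambda>n. real (m n) / real n powr (3 / 2))"
  have x: "x \<longlonglongrightarrow> 0" unfolding x_def by (rule smalloD_tendsto[OF lower])
  have y: "y \<longlonglongrightarrow> 0" unfolding y_def by (rule smalloD_tendsto[OF upper])
  have v: "v \<longlonglongrightarrow> 0"
  proof (rule tendsto_sandwich[OF _ _ tendsto_const y])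
    show "\<forall>\<^sub>F n in sequentially. 0 \<le> v n" by (simp add: v_def)
    show "\<forall>\<^sub>F n in sequentially. v n \<le> y n"
      using eventually_gt_at_top[of 0]
    proof eventually_elim
      case (elim n)
      have "real n powr (1 + 1 / real k) \<le> real n powr (3 / 2)"
        using elim k by (intro powr_mono) (auto simp: field_simps)
      then show ?case using elim unfolding v_def y_def by (intro divide_left_mono) auto
    qed
  qed
  have mpos: "\<forall>\<^sub>F n in sequentially. m n > 0"
    using landau_o.smallD[OF lower zero_less_one] eventually_gt_at_top[of 0]
  proof eventually_elim
    case (elim n)
    then have "0 < real n powr (1 - 1 / real s)" by simp
    with elim(1) show ?case by (cases "m n = 0") auto
  qed
  have minv: "(\<lambda>n. 1 / real (m n)) \<longlonglongrightarrow> 0"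
  proof (rule tendsto_sandwich[OF _ _ tendsto_const x])
    show "\<forall>\<^sub>F n in sequentially. 1 / real (m n) \<le> x n"
      using eventually_gt_at_top[of 0]
    proof eventually_elim
      case (elim n)
      have "1 \<le> real n powr (1 - 1 / real s)"
        using elim s by (intro ge_one_powr_ge_zero) auto
      then show ?case unfolding x_def by (intro divide_right_mono) auto
    qed
  qed simp
  define r where "r = (\<lambda>n. nat \<lfloor>sqrt (real (m n))\<rfloor>)"
  have r1: "real (r n) ^ 2 \<le> real (m n)" for n
  proof -
    have "real (r n) \<le> sqrt (real (m n))" unfolding r_def by simp
    then have "real (r n) ^ 2 \<le> sqrt (real (m n)) ^ 2" by (intro power_mono) auto
    then show ?thesis by simp
  qed
  have r2: "real (m n) \<le> (real (r n) + 1) ^ 2" for n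
  proof -
    have "sqrt (real (m n)) \<le> real (r n) + 1" unfolding r_def by linarith
    then have "sqrt (real (m n)) ^ 2 \<le> (real (r n) + 1) ^ 2" by (intro power_mono) auto
    then show ?thesis by simp
  qed
  define \<delta> where "\<delta> = (\<lambda>n. cap_loss (r n) (n - r n) (m n))"
  define \<delta>' where "\<delta>' = (\<lambda>n. 256 * 4 ^ 5 * 2 ^ 5 * ((1 / real (m n)) ^ 2 + v n ^ 3))"
  \<comment> \<open>The powers of 2 pay for replacing \<open>M\<close> and \<open>n - r\<close> by their lower bounds \<open>m/2\<close> and \<open>n/2\<close>.\<close>
  define C where "C = 2 ^ (k + s + 1) * real k * (2 ^ s * 2 ^ (k + 1)) * 2 ^ (k + s)"
  define \<eta> where "\<eta> = (\<lambda>n. (1 + 4 * real (k + s) * (1 / real n)) ^ (k + s) - 1 + C * (x n ^ s + y n ^ k))"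
  have \<delta>': "\<delta>' \<longlonglongrightarrow> 0"
  proof -
    have "\<delta>' \<longlonglongrightarrow> 256 * 4 ^ 5 * 2 ^ 5 * (0 ^ 2 + 0 ^ 3)"
      unfolding \<delta>'_def by (intro tendsto_intros minv v)
    then show ?thesis by simp
  qed
  have \<eta>: "\<eta> \<longlonglongrightarrow> 0"
  proof -
    have "\<eta> \<longlonglongrightarrow> (1 + 4 * real (k + s) * 0) ^ (k + s) - 1 + C * (0 ^ s + 0 ^ k)"
      unfolding \<eta>_def by (intro tendsto_intros lim_1_over_n x y)
    then show ?thesis using s(2) k by (simp add: zero_power)
  qed
  have ev: "\<forall>\<^sub>F n in sequentially. n \<ge> 8 * k + 8 \<and> m n > 0 \<and> 2 * r n \<le> n \<and> 4 * s \<le> m n \<and> \<delta>' n < 1"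
  proof -
    have "\<forall>\<^sub>F n in sequentially. 2 * r n \<le> n"
      using order_tendstoD(2)[OF v, of "1/4", simplified] eventually_gt_at_top[of 0]
    proof eventually_elim
      case (elim n)
      have "real (m n) = v n * real n powr (3 / 2)" using elim by (simp add: v_def)
      also have "\<dots> \<le> 1 / 4 * real n powr 2"
        using elim by (intro mult_mono powr_mono) (auto simp: v_def)
      finally have "real (m n) \<le> (real n / 2) ^ 2" using elim by (simp add: powr_numeral power_divide)
      then have "real (r n) ^ 2 \<le> (real n / 2) ^ 2" using r1[of n] by linarith
      then have "real (r n) \<le> real n / 2" by (rule power2_le_imp_le) simp
      then show ?case by linarith
    qed
    moreover have s4: "1 / real (4 * s) > 0" using s(2) by simp
    have "\<forall>\<^sub>F n in sequentially. 4 * s \<le> m n"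
      using order_tendstoD(2)[OF minv s4] mpos
    proof eventually_elim
      case (elim n)
      then have "real (4 * s) < real (m n)" using s(2) by (simp add: field_simps)
      then show ?case by linarith
    qed
    ultimately show ?thesis
      using eventually_ge_at_top[of "8 * k + 8"] mpos order_tendstoD(2)[OF \<delta>', of 1]
      by (simp add: eventually_conj_iff)
  qed
  have bound: "\<forall>\<^sub>F n in sequentially. 1 - \<eta> n / (1 - \<delta>' n) \<le> prob_contains k \<pi> n (m n)"
    using ev
  proof eventually_elim
    case (elim n)
    let ?l = "n - r n"
    have rn: "r n < n" "?l > 0" "real n / 2 \<le> real ?l" "real ?l \<le> real n" "2 * k < ?l" using elim by auto
    have cap: "fill ?l (m n) < 1" "\<delta> n \<le> \<delta>' n"
    proof -
      show "fill ?l (m n) < 1" using cap_loss_le(1)[of n "r n" "m n"] elim r2 by simp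
      have "\<delta> n \<le> 256 * 4 ^ 5 * 2 ^ 5 * (1 / (real (m n))\<^sup>2 + real (m n) ^ 3 / real n ^ 5)"
        using cap_loss_le(2)[of n "r n" "m n"] elim r2 by (simp add: \<delta>_def)
      moreover have "real (m n) ^ 3 / real n ^ 5 \<le> v n ^ 3"
      proof -
        have "(real n powr (3 / 2)) ^ 3 = real n powr (9 / 2)"
          using elim by (simp add: powr_powr flip: powr_realpow)
        also have "\<dots> \<le> real n powr 5" using elim by (intro powr_mono) auto
        also have "\<dots> = real n ^ 5" using elim by (simp add: powr_numeral)
        finally show ?thesis
          unfolding v_def power_divide using elim by (intro divide_left_mono) auto
      qed
      ultimately show "\<delta> n \<le> \<delta>' n" unfolding \<delta>'_def by (simp add: power_divide)
    qed
    have "1 - prob_contains k \<pi> n (m n) \<le> \<eta> n / (1 - \<delta>' n)"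
    proof (rule prob_avoids_second_moment[OF m \<pi> rn(1)])
      show "r n * (r n - 1) \<le> m n"
      proof -
        have "r n * (r n - 1) \<le> r n ^ 2" by (simp add: power2_eq_square)
        also have "r n ^ 2 \<le> m n" using r1[of n] by (simp flip: of_nat_power)
        finally show ?thesis .
      qed
      show "\<delta>' n < 1" using elim by simp
      fix M assume M: "M \<le> m n"
      have qM: "fill ?l M \<le> fill ?l (m n)" using fill_mono[OF rn(2) M] .
      then show "fill ?l M < 1" using cap by simp
      have "cap_loss (r n) ?l M \<le> \<delta> n"
        unfolding cap_loss_def \<delta>_def using qM cap fill_bounds(1)[OF rn(2)]
        by (intro frac_le power_mono) auto
      then show "cap_loss (r n) ?l M \<le> \<delta>' n" using cap by simp
      assume M2: "m n \<le> 2 * M"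
      have Ms: "2 * s \<le> M" "M > 0" using M2 elim s by auto
      have c: "code k \<pi> \<in> comps {1..k} s" using code_in_comps[of k \<pi>] s by simp
      have "(1 + real (k + s) / real (?l - 2 * k)) ^ (k + s) \<le> (1 + 4 * real (k + s) * (1 / real n)) ^ (k + s)"
      proof (intro power_mono add_left_mono)
        have "real n / 4 \<le> real (?l - 2 * k)" using elim by simp
        then have "real (k + s) / real (?l - 2 * k) \<le> real (k + s) / (real n / 4)"
          using elim by (intro divide_left_mono) auto
        then show "real (k + s) / real (?l - 2 * k) \<le> 4 * real (k + s) * (1 / real n)" by (simp add: mult.commute)
      qed simp
      moreover have "2 ^ (k + s + 1) * real k * (real ?l + real M) ^ (k + s) / (real M ^ s * real ?l ^ (k + 1))
          \<le> C * (x n ^ s + y n ^ k)"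
      proof -
        have "2 ^ (k + s + 1) * real k * (real ?l + real M) ^ (k + s) / (real M ^ s * real ?l ^ (k + 1))
            \<le> 2 ^ (k + s + 1) * real k * (real n + real (m n)) ^ (k + s)
                / ((real (m n) / 2) ^ s * (real n / 2) ^ (k + 1))"
          using M M2 rn elim
          by (intro frac_le mult_left_mono power_mono mult_mono mult_pos_pos) auto
        also have "\<dots> = 2 ^ (k + s + 1) * real k * (2 ^ s * 2 ^ (k + 1))
            * ((real n + real (m n)) ^ (k + s) / (real (m n) ^ s * real n ^ (k + 1)))"
          by (simp add: power_divide)
        also have "\<dots> \<le> 2 ^ (k + s + 1) * real k * (2 ^ s * 2 ^ (k + 1))
            * (2 ^ (k + s) * (1 / (real n * (real (m n) / real n) ^ s) + (real (m n) / real n) ^ k / real n))"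
          using elim by (intro mult_left_mono mixed_power_le) auto
        also have "1 / (real n * (real (m n) / real n) ^ s) = x n ^ s"
          using elim lower_threshold_power[of n s "real (m n)"] s(2) by (simp add: x_def power_divide)
        also have "(real (m n) / real n) ^ k / real n = y n ^ k"
          using elim k by (simp add: y_def upper_threshold_power)
        finally show ?thesis by (simp add: C_def)
      qed
      ultimately have "(1 + real (k + s) / real (?l - 2 * k)) ^ (k + s) - 1
          + 2 ^ (k + s + 1) * real k * (real ?l + real M) ^ (k + s) / (real M ^ s * real ?l ^ (k + 1)) \<le> \<eta> n"
        unfolding \<eta>_def by linarith
      then show "real (card {e \<in> comps {r n + 1..n} M. good_blocks k (code k \<pi>) (r n) k (?l div k) e = 0})
          \<le> \<eta> n * real (ncomps ?l M)"
        by (intro order_trans[OF card_no_good_block_le[OF c s(2) Ms(1) rn(5)]] mult_right_mono) auto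
    qed
    then show ?case by linarith
  qed
  have "(\<lambda>n. 1 - \<eta> n / (1 - \<delta>' n)) \<longlonglongrightarrow> 1 - 0 / (1 - 0)"
    by (intro tendsto_intros \<eta> \<delta>') simp
  then have lim: "(\<lambda>n. 1 - \<eta> n / (1 - \<delta>' n)) \<longlonglongrightarrow> 1" by simp
  show ?thesis
    by (rule tendsto_sandwich[OF bound _ lim tendsto_const]) (simp add: prob_contains_bounds)
qed

section \<open>The Poisson limit in the critical window\<close>

lemma ncomps_mono_parts: "ncomps (n - t) m \<le> ncomps n m"
  unfolding ncomps_def by (rule binomial_right_mono) simp

lemma ncomps_ge:
  assumes u: "u \<le> m" and t: "t < n" and m: "m \<le> n - t"
  shows "real (ncomps n m) * ((real (m - u) / (real n + real m)) ^ u * (1 - real t * real m / real (n - t)))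
     \<le> real (ncomps (n - t) (m - u))"
proof -
  have nt: "real (n - t) > 0" using t by simp
  define y where "y = 1 - real m / real (n - t)"
  have y: "0 \<le> y" using m nt by (simp add: y_def)
  have 1: "real (ncomps n m) * (real (m - u) / (real n + real m)) ^ u \<le> real (ncomps n (m - u))"
  proof -
    have "real (ncomps n m) * real (m - u) ^ u \<le> real (ncomps n m) * (\<Prod>i<u. real (m - i))"
      using prod_mono[of "{..<u}" "\<lambda>_. real (m - u)" "\<lambda>i. real (m - i)"] by (intro mult_left_mono) auto
    also have "\<dots> = real (ncomps n (m - u)) * (\<Prod>i<u. real (n + m - 1 - i))"
      using ncomps_ratio[of u m 0 n] u t by simp
    also have "\<dots> \<le> real (ncomps n (m - u)) * (real n + real m) ^ u"
      using prod_mono[of "{..<u}" "\<lambda>i. real (n + m - 1 - i)" "\<lambda>_. real n + real m"]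
      by (intro mult_left_mono) auto
    finally show ?thesis using t by (simp add: power_divide divide_le_eq)
  qed
  have 2: "real (ncomps n (m - u)) * y ^ t \<le> real (ncomps (n - t) (m - u))"
  proof -
    let ?F = "\<Prod>i<t. real (n + (m - u) - 1 - i)"
    have F: "?F > 0" using t by (intro prod_pos) auto
    have "y ^ t * ?F = (\<Prod>i<t. y * real (n + (m - u) - 1 - i))" by (simp add: prod.distrib)
    also have "\<dots> \<le> (\<Prod>i<t. real (n - 1 - i))"
    proof (intro prod_mono conjI)
      fix i assume i: "i \<in> {..<t}"
      define z where "z = real (n - 1 - i)"
      have z: "real (n + (m - u) - 1 - i) = z + real (m - u)" "real (n - t) \<le> z"
        using i t by (auto simp: z_def)
      define X where "X = real m / real (n - t) * (z + real (m - u))"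
      have "real m / real (n - t) * real (n - t) \<le> X"
        unfolding X_def using z by (intro mult_left_mono) auto
      then have "real m \<le> X" using nt by simp
      moreover have "real (m - u) \<le> real m" by simp
      moreover have "y * (z + real (m - u)) = z + real (m - u) - X"
        by (simp add: y_def X_def left_diff_distrib)
      ultimately have "y * (z + real (m - u)) \<le> z" by linarith
      then show "y * real (n + (m - u) - 1 - i) \<le> real (n - 1 - i)" unfolding z z_def .
    qed (use y in auto)
    finally have "real (ncomps n (m - u)) * (y ^ t * ?F) \<le> real (ncomps n (m - u)) * (\<Prod>i<t. real (n - 1 - i))"
      by (rule mult_left_mono) simp
    also have "\<dots> = real (ncomps (n - t) (m - u)) * ?F"
      using ncomps_ratio[of 0 "m - u" t n] t by simp
    finally show ?thesis using F by (simp add: mult.assoc[symmetric])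
  qed
  have bern: "1 - real t * real m / real (n - t) \<le> y ^ t"
    using Bernoulli_inequality[of "- (real m / real (n - t))" t] y by (simp add: y_def)
  have "real (ncomps n m) * ((real (m - u) / (real n + real m)) ^ u * (1 - real t * real m / real (n - t)))
      \<le> real (ncomps n m) * ((real (m - u) / (real n + real m)) ^ u * y ^ t)"
    by (intro mult_left_mono bern) auto
  also have "\<dots> \<le> real (ncomps n (m - u)) * y ^ t"
    using 1 y by (simp add: mult_right_mono flip: mult.assoc)
  finally show ?thesis using 2 by linarith
qed

text \<open>
  The \<open>j\<close>-th binomial moment of the number of good blocks is \<open>(N choose j) \<beta>\<^sup>j\<close> times the probability \<open>\<rho>\<close> of
  \<open>j\<close> given words. The first factor is asymptotic to \<open>n\<^sup>j/j!\<close> because the blocks are long but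
  numerous (\<open>N \<beta>\<close> is asymptotic to \<open>n\<close>), and \<open>n\<^sup>j \<rho>\<close> tends to \<open>\<mu>\<^sup>j\<close> because blocks of total length \<open>j L\<close> are otherwise empty
  with probability close to 1 (this is where \<open>L m/n \<rightarrow> 0\<close> enters). All terms are dominated by
  \<open>(\<mu> + 1)\<^sup>j/j!\<close>, so that the limit can be taken inside the alternating sum.
\<close>

lemma avoid_fraction_tendsto:
  fixes m L :: "nat \<Rightarrow> nat"
  assumes s: "s > 0" and k: "k \<ge> 1"
    and \<mu>: "(\<lambda>n. real n * (real (m n) / real n) ^ s) \<longlonglongrightarrow> \<mu>"
    and mn: "(\<lambda>n. real (m n) / real n) \<longlonglongrightarrow> 0" and minf: "filterlim (\<lambda>n. real (m n)) at_top sequentially"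
    and Linf: "filterlim (\<lambda>n. real (L n)) at_top sequentially"
    and Ln: "(\<lambda>n. real (L n) / real n) \<longlonglongrightarrow> 0"
    and Lm: "(\<lambda>n. real (L n) * (real (m n) / real n)) \<longlonglongrightarrow> 0"
  shows "(\<lambda>n. avoid_fraction k s (L n) n (m n)) \<longlonglongrightarrow> exp (- \<mu>)"
proof -
  define N where "N = (\<lambda>n. n div L n)"
  define \<beta> where "\<beta> = (\<lambda>n. L n - k + 1)"
  define \<rho> where "\<rho> = (\<lambda>j n. if j * s \<le> m n then real (ncomps (n - j * L n) (m n - j * s)) / real (ncomps n (m n)) else 0)"
  define T where "T = (\<lambda>j n. (-1) ^ j * (real (N n choose j) * real (\<beta> n) ^ j * \<rho> j n))"
  have Lk: "\<forall>\<^sub>F n in sequentially. k \<le> L n \<and> 0 < n"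
    using filterlim_at_top[THEN iffD1, OF Linf, rule_format, of "real k"] eventually_gt_at_top[of 0]
    by eventually_elim auto
  have Linv: "(\<lambda>n. 1 / real (L n)) \<longlonglongrightarrow> 0"
    using tendsto_divide_0[OF tendsto_const filterlim_at_top_imp_at_infinity[OF Linf]] .
  have minv: "(\<lambda>n. 1 / real (m n)) \<longlonglongrightarrow> 0"
    using tendsto_divide_0[OF tendsto_const filterlim_at_top_imp_at_infinity[OF minf]] .
  have N\<beta>: "real (N n) * real (\<beta> n) \<le> real n" if "k \<le> L n" for n
  proof -
    have "N n * \<beta> n \<le> N n * L n" using that k by (intro mult_le_mono2) (simp add: \<beta>_def)
    also have "\<dots> \<le> n" by (simp add: N_def)
    finally show ?thesis by (simp flip: of_nat_mult)
  qed
  have A: "(\<lambda>n. real (N n) * real (\<beta> n) / real n) \<longlonglongrightarrow> 1"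
  proof (rule tendsto_sandwich[where f = "\<lambda>n. 1 - real (L n) / real n - real k * (1 / real (L n))"])
    have "(\<lambda>n. 1 - real (L n) / real n - real k * (1 / real (L n))) \<longlonglongrightarrow> 1 - 0 - real k * 0"
      by (intro tendsto_intros Ln Linv)
    then show "(\<lambda>n. 1 - real (L n) / real n - real k * (1 / real (L n))) \<longlonglongrightarrow> 1" by simp
    show "\<forall>\<^sub>F n in sequentially. real (N n) * real (\<beta> n) / real n \<le> 1"
      using Lk by eventually_elim (use N\<beta> in \<open>auto simp: divide_le_eq\<close>)
    show "\<forall>\<^sub>F n in sequentially. 1 - real (L n) / real n - real k * (1 / real (L n)) \<le> real (N n) * real (\<beta> n) / real n"
      using Lk
    proof eventually_elim
      case (elim n)
      then have L0: "real (L n) > 0" "real n > 0" using k by auto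
      have "n = N n * L n + n mod L n" by (simp add: N_def)
      moreover have "n mod L n \<le> L n" using elim k by (simp add: less_imp_le)
      ultimately have "n \<le> N n * L n + L n" by linarith
      then have 1: "real n \<le> real (N n) * real (L n) + real (L n)" by (metis of_nat_add of_nat_le_iff of_nat_mult)
      have "N n * L n \<le> n" by (simp add: N_def)
      then have "real (N n) * real (L n) \<le> real n" by (simp flip: of_nat_mult)
      then have 2: "real (N n) * real k \<le> real n * real k / real (L n)"
        using L0 by (simp add: pos_le_divide_eq mult.commute mult.left_commute mult_left_mono)
      have "real (N n) * real (\<beta> n) \<ge> real (N n) * (real (L n) - real k)"
        using elim by (intro mult_left_mono) (auto simp: \<beta>_def)
      then have "real n - real (L n) - real n * real k / real (L n) \<le> real (N n) * real (\<beta> n)"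
        using 1 2 by (simp add: right_diff_distrib)
      then have "(real n - real (L n) - real n * real k / real (L n)) / real n \<le> real (N n) * real (\<beta> n) / real n"
        by (rule divide_right_mono) simp
      then show ?case using L0 by (simp add: diff_divide_distrib)
    qed
  qed simp
  have B: "(\<lambda>n. real (\<beta> n) / real n) \<longlonglongrightarrow> 0"
  proof (rule tendsto_sandwich[OF _ _ tendsto_const Ln])
    show "\<forall>\<^sub>F n in sequentially. real (\<beta> n) / real n \<le> real (L n) / real n"
      using Lk by eventually_elim (use k in \<open>auto simp: \<beta>_def intro!: divide_right_mono\<close>)
  qed simp
  have choose: "(\<lambda>n. real (N n choose j) * real (\<beta> n) ^ j / real n ^ j) \<longlonglongrightarrow> 1 / fact j" for j
  proof -
    have "real (N n choose j) * real (\<beta> n) ^ j / real n ^ j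
        = (\<Prod>i<j. real (N n) * real (\<beta> n) / real n - real i * (real (\<beta> n) / real n)) / fact j" for n
    proof -
      have "real (N n choose j) = (\<Prod>i<j. real (N n) - real i) / fact j"
        by (simp add: binomial_gbinomial gbinomial_prod_rev atLeast0LessThan)
      moreover have "(\<Prod>i<j. real (N n) * real (\<beta> n) / real n - real i * (real (\<beta> n) / real n))
          = (\<Prod>i<j. real (N n) - real i) * (real (\<beta> n) / real n) ^ j"
      proof -
        have "real (N n) * real (\<beta> n) / real n - real i * (real (\<beta> n) / real n)
            = (real (N n) - real i) * (real (\<beta> n) / real n)" for i
          by (simp add: left_diff_distrib diff_divide_distrib)
        then show ?thesis by (simp only: prod.distrib prod_constant card_lessThan)
      qed
      ultimately show ?thesis by (simp add: power_divide)
    qed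
    moreover have "(\<lambda>n. (\<Prod>i<j. real (N n) * real (\<beta> n) / real n - real i * (real (\<beta> n) / real n)) / fact j)
        \<longlonglongrightarrow> (\<Prod>i<j. 1 - real i * 0) / fact j"
      by (intro tendsto_intros A B) auto
    ultimately show ?thesis by simp
  qed
  have \<rho>_le: "\<rho> j n \<le> (real (m n) / real n) ^ (j * s)" if "n > 0" for j n
  proof (cases "j * s \<le> m n")
    case True
    have "real (ncomps (n - j * L n) (m n - j * s)) \<le> real (ncomps n (m n - j * s))"
      using ncomps_mono_parts by simp
    also have "\<dots> \<le> fill n (m n) ^ (j * s) * real (ncomps n (m n))"
      by (rule ncomps_decrease_le[OF True that])
    also have "\<dots> \<le> (real (m n) / real n) ^ (j * s) * real (ncomps n (m n))"
      using fill_le_ratio[OF that] fill_bounds(1)[OF that] by (intro mult_right_mono power_mono) auto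
    finally show ?thesis using True ncomps_pos[OF that, of "m n"] by (simp add: \<rho>_def divide_le_eq)
  qed (simp add: \<rho>_def)
  have \<rho>0: "0 \<le> \<rho> j n" for j n by (simp add: \<rho>_def)
  have \<rho>_lim: "(\<lambda>n. real n ^ j * \<rho> j n) \<longlonglongrightarrow> \<mu> ^ j" for j
  proof -
    \<comment> \<open>The lower bound of \<open>ncomps_ge\<close>, written in terms of quantities with known limits.\<close>
    let ?h = "\<lambda>n. (real n * (real (m n) / real n) ^ s * ((1 - real (j * s) * (1 / real (m n))) ^ s * (1 / (1 + real (m n) / real n)) ^ s)) ^ j
        * (1 - real j * (real (L n) * (real (m n) / real n)) / (1 - real j * (real (L n) / real n)))"
    show ?thesis
    proof (rule tendsto_sandwich[where f = ?h])
      show "\<forall>\<^sub>F n in sequentially. real n ^ j * \<rho> j n \<le> (real n * (real (m n) / real n) ^ s) ^ j"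
        using eventually_gt_at_top[of 0]
      proof eventually_elim
        case (elim n)
        have "real n ^ j * \<rho> j n \<le> real n ^ j * (real (m n) / real n) ^ (j * s)"
          using \<rho>_le[OF elim] by (intro mult_left_mono) auto
        also have "\<dots> = (real n * (real (m n) / real n) ^ s) ^ j"
          unfolding power_mult_distrib mult.commute[of j s] power_mult ..
        finally show ?case .
      qed
      show "(\<lambda>n. (real n * (real (m n) / real n) ^ s) ^ j) \<longlonglongrightarrow> \<mu> ^ j"
        by (intro tendsto_intros \<mu>)
      have "?h \<longlonglongrightarrow> (\<mu> * ((1 - real (j * s) * 0) ^ s * (1 / (1 + 0)) ^ s)) ^ j * (1 - real j * 0 / (1 - real j * 0))"
        by (intro tendsto_intros \<mu> minv mn Ln Lm) auto
      then show "?h \<longlonglongrightarrow> \<mu> ^ j" by simp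
      have e1: "\<forall>\<^sub>F n in sequentially. real (j * s) + 1 \<le> real (m n)"
        using filterlim_at_top[THEN iffD1, OF minf] by blast
      have "(\<lambda>n. real (m n) / real n + real j * (real (L n) / real n)) \<longlonglongrightarrow> 0 + real j * 0"
        by (intro tendsto_intros mn Ln)
      then have e2: "\<forall>\<^sub>F n in sequentially. real (m n) / real n + real j * (real (L n) / real n) < 1"
        by (rule order_tendstoD(2)) simp
      show "\<forall>\<^sub>F n in sequentially. ?h n \<le> real n ^ j * \<rho> j n"
        using e1 e2 eventually_gt_at_top[of 0]
      proof eventually_elim
        case (elim n)
        let ?u = "j * s" and ?t = "j * L n"
        have u: "?u \<le> m n" "m n > 0" using elim(1) by linarith+
        have "real (m n) + real ?t < real n" using elim(2,3) by (simp add: field_simps)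
        then have t: "?t < n" "m n \<le> n - ?t" by linarith+
        have D: "real (ncomps n (m n)) > 0" using ncomps_pos[OF elim(3)] by simp
        have "real n ^ j * ((real (m n - ?u) / (real n + real (m n))) ^ ?u * (1 - real ?t * real (m n) / real (n - ?t)))
            \<le> real n ^ j * \<rho> j n"
          using ncomps_ge[OF u(1) t] D u by (intro mult_left_mono) (auto simp: \<rho>_def le_divide_eq mult.commute)
        moreover have "?h n = real n ^ j * ((real (m n - ?u) / (real n + real (m n))) ^ ?u * (1 - real ?t * real (m n) / real (n - ?t)))"
        proof -
          have "real (m n - ?u) / (real n + real (m n))
              = real (m n) / real n * ((1 - real ?u * (1 / real (m n))) * (1 / (1 + real (m n) / real n)))"
          proof -
            have "real (m n - ?u) = real (m n) * (1 - real ?u * (1 / real (m n)))"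
              using u by (simp add: of_nat_diff right_diff_distrib del: of_nat_mult)
            moreover have "real n + real (m n) = real n * (1 + real (m n) / real n)"
              using elim(3) by (simp add: distrib_left)
            ultimately show ?thesis by simp
          qed
          then have "(real (m n - ?u) / (real n + real (m n))) ^ ?u
              = ((real (m n) / real n) ^ s * ((1 - real ?u * (1 / real (m n))) ^ s * (1 / (1 + real (m n) / real n)) ^ s)) ^ j"
            by (simp only: mult.commute[of j s] power_mult power_mult_distrib)
          moreover have "real ?t * real (m n) / real (n - ?t)
              = real j * (real (L n) * (real (m n) / real n)) / (1 - real j * (real (L n) / real n))"
          proof -
            have "real (n - ?t) = real n * (1 - real j * (real (L n) / real n))"
              using t elim(3) by (simp add: of_nat_diff field_simps)
            then show ?thesis using elim(3) by simp
          qed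
          ultimately show ?thesis by (simp only: power_mult_distrib mult.assoc)
        qed
        ultimately show ?case by simp
      qed
    qed
  qed
  have lim: "T j \<longlonglongrightarrow> (- \<mu>) ^ j /\<^sub>R fact j" for j
  proof -
    have "(\<lambda>n. (-1) ^ j * ((real (N n choose j) * real (\<beta> n) ^ j / real n ^ j) * (real n ^ j * \<rho> j n)))
        \<longlonglongrightarrow> (-1) ^ j * (1 / fact j * \<mu> ^ j)"
      by (intro tendsto_intros choose \<rho>_lim)
    moreover have "\<forall>\<^sub>F n in sequentially. (-1) ^ j * ((real (N n choose j) * real (\<beta> n) ^ j / real n ^ j) * (real n ^ j * \<rho> j n)) = T j n"
      using eventually_gt_at_top[of 0] by eventually_elim (simp add: T_def)
    ultimately have "T j \<longlonglongrightarrow> (-1) ^ j * (1 / fact j * \<mu> ^ j)"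
      by (rule Lim_transform_eventually)
    then show ?thesis by (simp add: power_minus[of \<mu>] divide_inverse mult_ac)
  qed
  have bound: "norm (T j n) \<le> (\<mu> + 1) ^ j /\<^sub>R fact j"
    if n: "k \<le> L n" "0 < n" "real n * (real (m n) / real n) ^ s < \<mu> + 1" for j n
  proof -
    have "(N n choose j) * fact j \<le> N n ^ j" by (rule binomial_fact_pow)
    then have c: "real (N n choose j) \<le> real (N n) ^ j / fact j"
      by (simp add: le_divide_eq) (metis of_nat_fact of_nat_le_iff of_nat_mult of_nat_power)
    have "norm (T j n) = real (N n choose j) * real (\<beta> n) ^ j * \<rho> j n"
      using \<rho>0 by (simp add: T_def abs_mult power_abs)
    also have "\<dots> \<le> (real (N n) ^ j / fact j) * real (\<beta> n) ^ j * (real (m n) / real n) ^ (j * s)"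
      using c \<rho>_le[OF n(2)] \<rho>0 by (intro mult_mono) auto
    also have "\<dots> = (real (N n) * real (\<beta> n) * (real (m n) / real n) ^ s) ^ j / fact j"
      by (simp add: power_mult_distrib mult.commute[of j s] power_mult)
    also have "\<dots> \<le> (real n * (real (m n) / real n) ^ s) ^ j / fact j"
      using N\<beta>[OF n(1)] by (intro divide_right_mono power_mono mult_right_mono) auto
    also have "\<dots> \<le> (\<mu> + 1) ^ j / fact j"
      using n by (intro divide_right_mono power_mono) auto
    finally show ?thesis by (simp add: divide_inverse mult.commute)
  qed
  have ev: "\<forall>\<^sub>F n in sequentially. \<forall>j. norm (T j n) \<le> (\<mu> + 1) ^ j /\<^sub>R fact j"
    using Lk order_tendstoD(2)[OF \<mu>, of "\<mu> + 1", simplified] by eventually_elim (use bound in blast)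
  have "((\<lambda>n. suminf (\<lambda>j. T j n)) \<longlonglongrightarrow> suminf (\<lambda>j. (- \<mu>) ^ j /\<^sub>R fact j))"
  proof -
    have "\<forall>\<^sub>F (j, n) in at_top \<times>\<^sub>F sequentially. norm (T j n) \<le> (\<mu> + 1) ^ j /\<^sub>R fact j"
      using eventually_prodI[OF always_eventually[of "\<lambda>_. True" sequentially] ev] by (auto elim: eventually_mono)
    from tannerys_theorem[OF lim this summable_exp_generic] show ?thesis by simp
  qed
  moreover have "suminf (\<lambda>j. T j n) = avoid_fraction k s (L n) n (m n)" for n
  proof -
    have "suminf (\<lambda>j. T j n) = (\<Sum>j\<le>N n. T j n)"
      by (intro suminf_finite) (auto simp: T_def binomial_eq_0)
    then show ?thesis by (simp add: avoid_fraction_def T_def N_def \<beta>_def \<rho>_def)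
  qed
  ultimately show ?thesis by (simp add: exp_def)
qed

text \<open>
  The block length \<open>n\<^sup>1\<^sup>/\<^sup>(\<^sup>2\<^sup>s\<^sup>)\<close> tends to infinity, so that few windows cross a boundary, but slowly
  enough that a block contains an extra inversion with vanishing probability, as \<open>m/n\<close> is of order \<open>n\<^sup>-\<^sup>1\<^sup>/\<^sup>s\<close>.
\<close>

lemma limit_critical_window:
  fixes m :: "nat \<Rightarrow> nat"
  assumes m: "\<And>n. m n \<le> n choose 2" and \<pi>: "\<pi> permutes {1..k}" and s: "inv_count k \<pi> = s" "s > 1"
    and a: "a > 0" and g: "(\<lambda>n. real (m n) / real n powr (1 - 1 / real s)) \<longlonglongrightarrow> a"
  shows "(\<lambda>n. prob_contains k \<pi> n (m n)) \<longlonglongrightarrow> 1 - exp (- (a ^ s))"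
proof -
  have s0: "s > 0" using s by simp
  have k: "k \<ge> 2" using two_le_if_inversion[of k \<pi>] s by simp
  note mn = ratio_tendsto_0[OF g s0]
  note sp = sparse_limits[OF mn]
  have \<mu>: "(\<lambda>n. real n * (real (m n) / real n) ^ s) \<longlonglongrightarrow> a ^ s"
  proof (rule Lim_transform_eventually)
    show "(\<lambda>n. (real (m n) / real n powr (1 - 1 / real s)) ^ s) \<longlonglongrightarrow> a ^ s"
      by (intro tendsto_intros g)
    show "\<forall>\<^sub>F n in sequentially. (real (m n) / real n powr (1 - 1 / real s)) ^ s = real n * (real (m n) / real n) ^ s"
      using eventually_gt_at_top[of 0] by eventually_elim (simp only: lower_threshold_power[OF _ s0])
  qed
  have powr_inf: "filterlim (\<lambda>n. real n powr e) at_top sequentially" if "e > 0" for e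
    using that by real_asymp
  have minf: "filterlim (\<lambda>n. real (m n)) at_top sequentially"
  proof -
    have "filterlim (\<lambda>n. real (m n) / real n powr (1 - 1 / real s) * real n powr (1 - 1 / real s)) at_top sequentially"
      using s by (intro filterlim_tendsto_pos_mult_at_top[OF g a] powr_inf) simp
    then show ?thesis
      by (rule filterlim_cong[THEN iffD1, rotated -1, OF _ refl refl])
        (use eventually_gt_at_top[of 0] in eventually_elim, simp)
  qed
  define L where "L = (\<lambda>n. nat \<lfloor>real n powr (1 / (2 * real s))\<rfloor>)"
  have L_le: "real (L n) \<le> real n powr (1 / (2 * real s))" for n by (simp add: L_def)
  have Linf: "filterlim (\<lambda>n. real (L n)) at_top sequentially"
  proof (rule filterlim_at_top_mono)
    show "filterlim (\<lambda>n. - 1 + real n powr (1 / (2 * real s))) at_top sequentially"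
      using s0 by (intro filterlim_tendsto_add_at_top[OF tendsto_const] powr_inf) simp
    show "\<forall>\<^sub>F n in sequentially. - 1 + real n powr (1 / (2 * real s)) \<le> real (L n)"
      unfolding L_def by (intro always_eventually allI) linarith
  qed
  have neg: "(\<lambda>n. real n powr e) \<longlonglongrightarrow> 0" if "e < 0" for e
    using that by (intro tendsto_neg_powr filterlim_real_sequentially)
  have Ln: "(\<lambda>n. real (L n) / real n) \<longlonglongrightarrow> 0"
  proof (rule tendsto_sandwich[OF _ _ tendsto_const])
    show "(\<lambda>n. real n powr (1 / (2 * real s) - 1)) \<longlonglongrightarrow> 0" using s by (intro neg) simp
    show "\<forall>\<^sub>F n in sequentially. real (L n) / real n \<le> real n powr (1 / (2 * real s) - 1)"
      using eventually_gt_at_top[of 0]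
    proof eventually_elim
      case (elim n)
      then show ?case using divide_right_mono[OF L_le[of n], of "real n"] by (simp add: powr_diff)
    qed
  qed simp
  have Lm: "(\<lambda>n. real (L n) * (real (m n) / real n)) \<longlonglongrightarrow> 0"
  proof (rule tendsto_sandwich[OF _ _ tendsto_const])
    have "(\<lambda>n. real (m n) / real n powr (1 - 1 / real s) * real n powr (- (1 / (2 * real s)))) \<longlonglongrightarrow> a * 0"
      using s by (intro tendsto_mult[OF g] neg) simp
    then show "(\<lambda>n. real (m n) / real n powr (1 - 1 / real s) * real n powr (- (1 / (2 * real s)))) \<longlonglongrightarrow> 0" by simp
    show "\<forall>\<^sub>F n in sequentially. real (L n) * (real (m n) / real n)
        \<le> real (m n) / real n powr (1 - 1 / real s) * real n powr (- (1 / (2 * real s)))"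
      using eventually_gt_at_top[of 0]
    proof eventually_elim
      case (elim n)
      have "real (L n) * (real (m n) / real n) \<le> real n powr (1 / (2 * real s)) * (real (m n) / real n)"
        by (intro mult_right_mono L_le) simp
      also have "\<dots> = real (m n) * real n powr (1 / (2 * real s) - 1)"
        using elim by (simp add: powr_diff)
      also have "1 / (2 * real s) - 1 = - (1 / (2 * real s)) - (1 - 1 / real s)"
        using s0 by (simp add: field_simps)
      also have "real (m n) * real n powr (- (1 / (2 * real s)) - (1 - 1 / real s))
          = real (m n) / real n powr (1 - 1 / real s) * real n powr (- (1 / (2 * real s)))"
        unfolding powr_diff by simp
      finally show ?case .
    qed
  qed simp
  have Z: "(\<lambda>n. avoid_fraction k s (L n) n (m n)) \<longlonglongrightarrow> exp (- (a ^ s))"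
    using k by (intro avoid_fraction_tendsto s0 \<mu> mn minf Linf Ln Lm) simp
  have Linv: "(\<lambda>n. 1 / real (L n)) \<longlonglongrightarrow> 0"
    using tendsto_divide_0[OF tendsto_const filterlim_at_top_imp_at_infinity[OF Linf]] .
  have Lk: "\<forall>\<^sub>F n in sequentially. k \<le> L n \<and> 0 < n"
    using filterlim_at_top[THEN iffD1, OF Linf, rule_format, of "real k"] eventually_gt_at_top[of 0]
    by eventually_elim auto
  define w where "w = (\<lambda>n. real n * (real (m n) / real n) ^ s)"
  define E where "E = (\<lambda>n. w n * (real k * (1 / real (L n)) + real k * (1 / real n) + real (L n) / real n)
    + w n * (real (L n) * (real (m n) / real n)))"
  have w: "w \<longlonglongrightarrow> a ^ s" using \<mu> by (simp add: w_def)
  have "E \<longlonglongrightarrow> a ^ s * (real k * 0 + real k * 0 + 0) + a ^ s * 0"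
    unfolding E_def by (intro tendsto_intros w Linv lim_1_over_n Ln Lm)
  then have E: "E \<longlonglongrightarrow> 0" by simp
  have lo: "(\<lambda>n. 1 - avoid_fraction k s (L n) n (m n) / (1 - cap_loss 0 n (m n))) \<longlonglongrightarrow> 1 - exp (- (a ^ s)) / (1 - 0)"
    by (intro tendsto_intros Z sp) simp
  have up: "(\<lambda>n. (1 - avoid_fraction k s (L n) n (m n) + E n) / (1 - cap_loss 0 n (m n))) \<longlonglongrightarrow> (1 - exp (- (a ^ s)) + 0) / (1 - 0)"
    by (intro tendsto_intros Z E sp) simp
  show ?thesis
  proof (rule tendsto_sandwich[OF _ _ lo[simplified] up[simplified]])
    show "\<forall>\<^sub>F n in sequentially. 1 - avoid_fraction k s (L n) n (m n) / (1 - cap_loss 0 n (m n)) \<le> prob_contains k \<pi> n (m n)"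
      using Lk sp(3)
    proof eventually_elim
      case (elim n)
      then have "1 - prob_contains k \<pi> n (m n) \<le> avoid_fraction k s (L n) n (m n) / (1 - cap_loss 0 n (m n))"
        using prob_avoids_le_avoid_fraction[OF m _ \<pi>, of n "L n"] s s0 by simp
      then show ?case by linarith
    qed
    show "\<forall>\<^sub>F n in sequentially. prob_contains k \<pi> n (m n)
        \<le> (1 - avoid_fraction k s (L n) n (m n) + E n) / (1 - cap_loss 0 n (m n))"
      using Lk sp(3)
    proof eventually_elim
      case (elim n)
      let ?q = "fill n (m n)" and ?x = "real (m n) / real n"
      have L0: "real (L n) > 0" "real n > 0" using elim k by auto
      have q: "0 \<le> ?q" "?q \<le> ?x" using fill_bounds(1) fill_le_ratio elim by auto
      have "real (n div L n) + 1 \<le> real n / real (L n) + 1" by (simp add: of_nat_div_le_of_nat)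
      then have "(real (n div L n) + 1) * real k \<le> (real n / real (L n) + 1) * real k"
        by (rule mult_right_mono) simp
      then have "real ((n div L n + 1) * k + L n) \<le> (real n / real (L n) + 1) * real k + real (L n)"
        by (simp only: of_nat_add of_nat_mult of_nat_1 add_right_mono)
      then have "real ((n div L n + 1) * k + L n) * ?q ^ s \<le> ((real n / real (L n) + 1) * real k + real (L n)) * ?x ^ s"
        using q L0 by (intro mult_mono power_mono) auto
      also have "\<dots> = w n * (real k * (1 / real (L n)) + real k * (1 / real n) + real (L n) / real n)"
        using L0 by (simp add: w_def distrib_left distrib_right add_divide_distrib mult_ac)
      finally have 1: "real ((n div L n + 1) * k + L n) * ?q ^ s
          \<le> w n * (real k * (1 / real (L n)) + real k * (1 / real n) + real (L n) / real n)" .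
      have "real (n * L n) * ?q ^ (s + 1) \<le> real (n * L n) * ?x ^ (s + 1)"
        using q by (intro mult_left_mono power_mono) auto
      also have "\<dots> = w n * (real (L n) * ?x)" by (simp add: w_def)
      finally have 2: "1 - avoid_fraction k s (L n) n (m n)
            + (real ((n div L n + 1) * k + L n) * ?q ^ s + real (n * L n) * ?q ^ (s + 1))
          \<le> 1 - avoid_fraction k s (L n) n (m n) + E n"
        using 1 unfolding E_def by linarith
      have "prob_contains k \<pi> n (m n) \<le> (1 - avoid_fraction k s (L n) n (m n)
            + (real ((n div L n + 1) * k + L n) * ?q ^ s + real (n * L n) * ?q ^ (s + 1))) / (1 - cap_loss 0 n (m n))"
        using prob_contains_le_avoid_fraction[OF m _ \<pi> s(1) s0] elim by blast
      also have "\<dots> \<le> (1 - avoid_fraction k s (L n) n (m n) + E n) / (1 - cap_loss 0 n (m n))"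
        using elim by (intro divide_right_mono 2) auto
      finally show ?case .
    qed
  qed
qed

section \<open>Complementation\<close>

lemma perm_complement_permutes:
  assumes "\<sigma> permutes {1..n}"
  shows "perm_complement n \<sigma> permutes {1..n}"
proof (rule bij_imp_permutes)
  have "bij_betw (\<lambda>x. n + 1 - x) {1..n} {1..n}"
    by (rule bij_betw_byWitness[where f' = "\<lambda>x. n + 1 - x"]) auto
  then have "bij_betw ((\<lambda>x. n + 1 - x) \<circ> \<sigma>) {1..n} {1..n}"
    using permutes_imp_bij[OF assms] by (rule bij_betw_trans[rotated])
  then show "bij_betw (perm_complement n \<sigma>) {1..n} {1..n}"
    by (rule bij_betw_cong[THEN iffD1, rotated]) (simp add: perm_complement_def)
qed (auto simp only: perm_complement_def if_False)

lemma perm_complement_less_iff: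
  assumes "\<sigma> permutes {1..n}" "i \<in> {1..n}" "j \<in> {1..n}"
  shows "perm_complement n \<sigma> i < perm_complement n \<sigma> j \<longleftrightarrow> \<sigma> j < \<sigma> i"
proof -
  have "\<sigma> i \<in> {1..n}" "\<sigma> j \<in> {1..n}"
    using assms(2,3) by (simp_all only: permutes_in_image[OF assms(1)])
  then show ?thesis using assms(2,3) by (auto simp: perm_complement_def)
qed

lemma perm_complement_involution:
  assumes "\<sigma> permutes {1..n}"
  shows "perm_complement n (perm_complement n \<sigma>) = \<sigma>"
proof
  fix i
  show "perm_complement n (perm_complement n \<sigma>) i = \<sigma> i"
  proof (cases "i \<in> {1..n}")
    case True
    then have "\<sigma> i \<in> {1..n}" by (simp only: permutes_in_image[OF assms])
    then show ?thesis using True by (auto simp: perm_complement_def)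
  next
    case False
    then have "perm_complement n (perm_complement n \<sigma>) i = i" by (simp only: perm_complement_def if_False)
    then show ?thesis using permutes_not_in[OF assms False] by simp
  qed
qed

lemma inv_count_plus_complement:
  assumes \<sigma>: "\<sigma> permutes {1..n}"
  shows "inv_count n \<sigma> + inv_count n (perm_complement n \<sigma>) = n choose 2"
proof -
  let ?P = "\<lambda>\<sigma>. {(i, j). i \<in> {1..n} \<and> j \<in> {1..n} \<and> i < j \<and> \<sigma> i > \<sigma> j}"
  have fin: "finite (?P \<tau>)" for \<tau> :: "nat \<Rightarrow> nat"
    by (rule finite_subset[of _ "{1..n} \<times> {1..n}"]) auto
  have eq: "?P (perm_complement n \<sigma>) = {(i, j). i \<in> {1..n} \<and> j \<in> {1..n} \<and> i < j \<and> \<sigma> i < \<sigma> j}"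
    using perm_complement_less_iff[OF \<sigma>] by blast
  have ne: "\<sigma> i \<noteq> \<sigma> j" if "i < j" for i j
    using permutes_inj[OF \<sigma>] that by (metis injD less_irrefl)
  have un: "?P \<sigma> \<union> ?P (perm_complement n \<sigma>) = (\<lambda>(j, i). (i, j)) ` (SIGMA j:{1..n}. {1..<j})"
  proof -
    have "?P \<sigma> \<union> ?P (perm_complement n \<sigma>) = {(i, j). i \<in> {1..n} \<and> j \<in> {1..n} \<and> i < j}"
      unfolding eq using ne by (force dest: linorder_neq_iff[THEN iffD1])
    also have "\<dots> = (\<lambda>(j, i). (i, j)) ` (SIGMA j:{1..n}. {1..<j})"
      by (auto simp: image_iff)
    finally show ?thesis .
  qed
  have dis: "?P \<sigma> \<inter> ?P (perm_complement n \<sigma>) = {}"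
    unfolding eq by auto
  have "inv_count n \<sigma> + inv_count n (perm_complement n \<sigma>) = card (?P \<sigma> \<union> ?P (perm_complement n \<sigma>))"
    unfolding inv_count_def by (rule card_Un_disjoint[OF fin fin dis, symmetric])
  also have "\<dots> = card (SIGMA j:{1..n}. {1..<j})"
    unfolding un by (rule card_image) (auto simp: inj_on_def)
  also have "\<dots> = (\<Sum>j\<in>{1..n}. j - 1)" by (subst card_SigmaI) auto
  also have "\<dots> = n choose 2" by (induction n) (auto simp: numeral_2_eq_2)
  finally show ?thesis .
qed

lemma contains_complement_iff:
  assumes "\<sigma> permutes {1..n}" "\<pi> permutes {1..k}"
  shows "contains_consecutive k (perm_complement k \<pi>) n (perm_complement n \<sigma>) \<longleftrightarrow> contains_consecutive k \<pi> n \<sigma>"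
proof -
  have "occurs_at k (perm_complement k \<pi>) n (perm_complement n \<sigma>) j \<longleftrightarrow> occurs_at k \<pi> n \<sigma> j" for j
  proof (cases "1 \<le> j \<and> j + k \<le> n + 1")
    case True
    then have in_range: "j + u - 1 \<in> {1..n}" if "u \<in> {1..k}" for u using that by auto
    show ?thesis
      unfolding occurs_at_def
      using perm_complement_less_iff[OF assms(1) in_range in_range] perm_complement_less_iff[OF assms(2)] by blast
  qed (auto simp: occurs_at_def)
  then show ?thesis by (simp add: contains_consecutive_def)
qed

lemma bij_betw_perm_complement:
  assumes m: "m \<le> n choose 2"
  shows "bij_betw (perm_complement n) (perms_with_inv n m) (perms_with_inv n ((n choose 2) - m))"
proof (rule bij_betw_byWitness[where f' = "perm_complement n"])
  have "perm_complement n \<sigma> \<in> perms_with_inv n ((n choose 2) - l)" if "\<sigma> \<in> perms_with_inv n l" for l \<sigma>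
    using that inv_count_plus_complement[of \<sigma> n] perm_complement_permutes[of \<sigma> n]
    by (auto simp: perms_with_inv_def)
  from this[of _ m] this[of _ "(n choose 2) - m"]
  show "perm_complement n ` perms_with_inv n m \<subseteq> perms_with_inv n ((n choose 2) - m)"
    "perm_complement n ` perms_with_inv n ((n choose 2) - m) \<subseteq> perms_with_inv n m"
    using m by auto
qed (auto simp: perms_with_inv_def perm_complement_involution)

lemma prob_contains_complement:
  assumes m: "m \<le> n choose 2" and \<pi>: "\<pi> permutes {1..k}"
  shows "prob_contains k (perm_complement k \<pi>) n ((n choose 2) - m) = prob_contains k \<pi> n m"
proof -
  note bij = bij_betw_perm_complement[OF m]
  let ?A = "{\<sigma> \<in> perms_with_inv n m. contains_consecutive k \<pi> n \<sigma>}"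
  have "{\<sigma> \<in> perms_with_inv n ((n choose 2) - m). contains_consecutive k (perm_complement k \<pi>) n \<sigma>}
      = perm_complement n ` ?A"
    unfolding bij_betw_imp_surj_on[OF bij, symmetric]
    using contains_complement_iff[OF _ \<pi>] by (auto simp: perms_with_inv_def)
  moreover have "card (perm_complement n ` ?A) = card ?A"
    by (rule card_image, rule inj_on_subset[OF bij_betw_imp_inj_on[OF bij]]) auto
  ultimately show ?thesis
    using bij_betw_same_card[OF bij] by (simp add: prob_contains_eq_card m)
qed

section \<open>The theorem\<close>

text \<open>
  Part (i), stated for an arbitrary pattern so that it also applies to the complement of \<open>\<pi>\<close>.
\<close>

lemma limits_by_inversions:
  fixes m :: "nat \<Rightarrow> nat"
  assumes \<pi>: "\<pi> permutes {1..k}" and s: "inv_count k \<pi> = s" "s > 0" and a: "a > 0" and m: "\<And>n. m n \<le> n choose 2"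
  shows "((\<lambda>n. real (m n)) \<in> o(\<lambda>n. real n powr (1 - 1 / real s))
          \<longrightarrow> (\<lambda>n. prob_contains k \<pi> n (m n)) \<longlonglongrightarrow> 0) \<and>
       ((\<lambda>n. real (m n)) \<sim>[sequentially] (\<lambda>n. a * real n powr (1 - 1 / real s)) \<and> s > 1
          \<longrightarrow> (\<lambda>n. prob_contains k \<pi> n (m n)) \<longlonglongrightarrow> 1 - exp (- (a ^ s))) \<and>
       ((\<lambda>n. real (m n)) \<sim>[sequentially] (\<lambda>n. a) \<and> s = 1
          \<longrightarrow> (\<lambda>n. prob_contains k \<pi> n (m n)) \<longlonglongrightarrow> 1) \<and>
       ((\<lambda>n. real n powr (1 - 1 / real s)) \<in> o(\<lambda>n. real (m n)) \<and>
        (\<lambda>n. real (m n)) \<in> o(\<lambda>n. real n powr (1 + 1 / real k))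
          \<longrightarrow> (\<lambda>n. prob_contains k \<pi> n (m n)) \<longlonglongrightarrow> 1)"
proof (intro conjI impI; (elim conjE)?)
  have k: "k \<ge> 1" using two_le_if_inversion[of k \<pi>] s by simp
  assume "(\<lambda>n. real (m n)) \<in> o(\<lambda>n. real n powr (1 - 1 / real s))"
  with m s k show "(\<lambda>n. prob_contains k \<pi> n (m n)) \<longlonglongrightarrow> 0" by (intro limit_too_few_inversions)
next
  assume eq: "(\<lambda>n. real (m n)) \<sim>[sequentially] (\<lambda>n. a * real n powr (1 - 1 / real s))" and "s > 1"
  have "\<forall>\<^sub>F n in sequentially. real (m n) \<noteq> 0 \<or> a * real n powr (1 - 1 / real s) \<noteq> 0"
    using eventually_gt_at_top[of 0] by eventually_elim (use a in simp)
  from tendsto_mult[OF tendsto_const[of a] asymp_equivD_strong[OF eq this]]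
  have "(\<lambda>n. real (m n) / real n powr (1 - 1 / real s)) \<longlonglongrightarrow> a" using a by simp
  then show "(\<lambda>n. prob_contains k \<pi> n (m n)) \<longlonglongrightarrow> 1 - exp (- (a ^ s))"
    by (rule limit_critical_window[OF m \<pi> s(1) \<open>s > 1\<close> a])
next
  assume "(\<lambda>n. real (m n)) \<sim>[sequentially] (\<lambda>n. a)" "s = 1"
  then show "(\<lambda>n. prob_contains k \<pi> n (m n)) \<longlonglongrightarrow> 1"
    using limit_single_inversion[OF m \<pi> _ asymp_equivD_const a] s by simp
next
  assume "(\<lambda>n. real n powr (1 - 1 / real s)) \<in> o(\<lambda>n. real (m n))"
    "(\<lambda>n. real (m n)) \<in> o(\<lambda>n. real n powr (1 + 1 / real k))"
  then show "(\<lambda>n. prob_contains k \<pi> n (m n)) \<longlonglongrightarrow> 1"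
    by (rule limit_many_inversions[OF m \<pi> s])
qed

theorem theorem1:
  fixes k s s' :: nat and \<pi> :: "nat \<Rightarrow> nat" and a :: real and m :: "nat \<Rightarrow> nat"
  assumes "\<pi> permutes {1..k}"
    and "s = inv_count k \<pi>"
    and "s' = inv_count k (perm_complement k \<pi>)"
    and "a > 0"
    and "\<And>n. m n \<le> n choose 2"
  shows
    "(s > 0 \<longrightarrow>
       ((\<lambda>n. real (m n)) \<in> o(\<lambda>n. real n powr (1 - 1 / real s))
          \<longrightarrow> (\<lambda>n. prob_contains k \<pi> n (m n)) \<longlonglongrightarrow> 0) \<and>
       ((\<lambda>n. real (m n)) \<sim>[sequentially] (\<lambda>n. a * real n powr (1 - 1 / real s)) \<and> s > 1
          \<longrightarrow> (\<lambda>n. prob_contains k \<pi> n (m n)) \<longlonglongrightarrow> 1 - exp (- (a ^ s))) \<and>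
       ((\<lambda>n. real (m n)) \<sim>[sequentially] (\<lambda>n. a) \<and> s = 1
          \<longrightarrow> (\<lambda>n. prob_contains k \<pi> n (m n)) \<longlonglongrightarrow> 1) \<and>
       ((\<lambda>n. real n powr (1 - 1 / real s)) \<in> o(\<lambda>n. real (m n)) \<and>
        (\<lambda>n. real (m n)) \<in> o(\<lambda>n. real n powr (1 + 1 / real k))
          \<longrightarrow> (\<lambda>n. prob_contains k \<pi> n (m n)) \<longlonglongrightarrow> 1)) \<and>
     (s' > 0 \<longrightarrow>
       ((\<lambda>n. real (n choose 2) - real (m n)) \<in> o(\<lambda>n. real n powr (1 + 1 / real k)) \<and>
        (\<lambda>n. real n powr (1 - 1 / real s')) \<in> o(\<lambda>n. real (n choose 2) - real (m n))
          \<longrightarrow> (\<lambda>n. prob_contains k \<pi> n (m n)) \<longlonglongrightarrow> 1) \<and>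
       ((\<lambda>n. real (n choose 2) - real (m n)) \<sim>[sequentially] (\<lambda>n. a) \<and> s' = 1
          \<longrightarrow> (\<lambda>n. prob_contains k \<pi> n (m n)) \<longlonglongrightarrow> 1) \<and>
       ((\<lambda>n. real (n choose 2) - real (m n)) \<sim>[sequentially] (\<lambda>n. a * real n powr (1 - 1 / real s')) \<and> s' > 1
          \<longrightarrow> (\<lambda>n. prob_contains k \<pi> n (m n)) \<longlonglongrightarrow> 1 - exp (- (a ^ s'))) \<and>
       ((\<lambda>n. real (n choose 2) - real (m n)) \<in> o(\<lambda>n. real n powr (1 - 1 / real s'))
          \<longrightarrow> (\<lambda>n. prob_contains k \<pi> n (m n)) \<longlonglongrightarrow> 0))"
proof (intro conjI[of "s > 0 \<longrightarrow> _"] impI)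
  assume "s > 0"
  then show "((\<lambda>n. real (m n)) \<in> o(\<lambda>n. real n powr (1 - 1 / real s))
          \<longrightarrow> (\<lambda>n. prob_contains k \<pi> n (m n)) \<longlonglongrightarrow> 0) \<and>
       ((\<lambda>n. real (m n)) \<sim>[sequentially] (\<lambda>n. a * real n powr (1 - 1 / real s)) \<and> s > 1
          \<longrightarrow> (\<lambda>n. prob_contains k \<pi> n (m n)) \<longlonglongrightarrow> 1 - exp (- (a ^ s))) \<and>
       ((\<lambda>n. real (m n)) \<sim>[sequentially] (\<lambda>n. a) \<and> s = 1
          \<longrightarrow> (\<lambda>n. prob_contains k \<pi> n (m n)) \<longlonglongrightarrow> 1) \<and>
       ((\<lambda>n. real n powr (1 - 1 / real s)) \<in> o(\<lambda>n. real (m n)) \<and>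
        (\<lambda>n. real (m n)) \<in> o(\<lambda>n. real n powr (1 + 1 / real k))
          \<longrightarrow> (\<lambda>n. prob_contains k \<pi> n (m n)) \<longlonglongrightarrow> 1)"
    by (rule limits_by_inversions[OF assms(1) assms(2)[symmetric] _ assms(4,5)])
next
  assume s': "s' > 0"
  have comp: "prob_contains k \<pi> n (m n) = prob_contains k (perm_complement k \<pi>) n ((n choose 2) - m n)"
    "real (n choose 2) - real (m n) = real ((n choose 2) - m n)" for n
    using prob_contains_complement[OF assms(5) assms(1)] assms(5)[of n] by (auto simp: of_nat_diff)
  show "((\<lambda>n. real (n choose 2) - real (m n)) \<in> o(\<lambda>n. real n powr (1 + 1 / real k)) \<and>
        (\<lambda>n. real n powr (1 - 1 / real s')) \<in> o(\<lambda>n. real (n choose 2) - real (m n))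
          \<longrightarrow> (\<lambda>n. prob_contains k \<pi> n (m n)) \<longlonglongrightarrow> 1) \<and>
       ((\<lambda>n. real (n choose 2) - real (m n)) \<sim>[sequentially] (\<lambda>n. a) \<and> s' = 1
          \<longrightarrow> (\<lambda>n. prob_contains k \<pi> n (m n)) \<longlonglongrightarrow> 1) \<and>
       ((\<lambda>n. real (n choose 2) - real (m n)) \<sim>[sequentially] (\<lambda>n. a * real n powr (1 - 1 / real s')) \<and> s' > 1
          \<longrightarrow> (\<lambda>n. prob_contains k \<pi> n (m n)) \<longlonglongrightarrow> 1 - exp (- (a ^ s'))) \<and>
       ((\<lambda>n. real (n choose 2) - real (m n)) \<in> o(\<lambda>n. real n powr (1 - 1 / real s'))
          \<longrightarrow> (\<lambda>n. prob_contains k \<pi> n (m n)) \<longlonglongrightarrow> 0)"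
    unfolding comp
    using limits_by_inversions[OF perm_complement_permutes[OF assms(1)] assms(3)[symmetric] s' assms(4),
        of "\<lambda>n. (n choose 2) - m n"] by simp
qed

end
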